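(* Let $z(t)=x(t)-X^*(y(t))$. Then (as long as $y(t)\in K$) the process $z$ satisfies $$dz=\Bigl[f(X^*+z,y)-\varepsilon\,DX^*\,g(X^*+z,y)-\tfrac{\sigma^2}{2}D^2X^*[h\otimes h]\Bigr]dt-\sigma\,DX^*\,h(y)\,dW_t,$$ where all coefficients are evaluated at $y=y(t)$ (in particular $X^*=X^*(y(t))$). The diffusion coefficient $\Sigma_z(y)=-\sigma\,DX^*(y)\,h(y)$ is independent of $z$.
   Context: $x(t)\in\mathbb{R}^n$ and $y(t)\in\mathbb{R}^m$ solve $dx=f(x,y)\,dt$, $dy=\varepsilon g(x,y)\,dt+\sigma h(y)\,dW_t$, where $W$ is a standard $d$-dimensional Brownian motion, $\varepsilon,\sigma>0$, $f\in C^4$, $g\in C^2$, $h\in C^2$ with $h(y)\in\mathbb{R}^{m\times d}$. $K\subset\mathbb{R}^m$ is compact and $X^*\in C^3(K,\mathbb{R}^n)$ satisfies $f(X^*(y),y)=0$ for all $y\in K$. In coordinates, $(D^2X^*[h\otimes h])_i=\sum_{j,k=1}^m\sum_{\ell=1}^d\frac{\partial^2X_i^*}{\partial y_j\partial y_k}h_{j\ell}h_{k\ell}$. *)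

theory Defs
  imports "HOL-Probability.Probability"
begin

section \<open>Smoothness and derivatives\<close>

text \<open>In finite dimension, a map is \<open>k + 1\<close> times continuously differentiable on an open set \<open>U\<close>
  iff it is differentiable and all its directional derivatives are \<open>k\<close> times continuously
  differentiable.  Meant for open \<open>U\<close> only.\<close>

primrec C_k_on ::
    "nat \<Rightarrow> ('a::euclidean_space \<Rightarrow> 'b::euclidean_space) \<Rightarrow> 'a set \<Rightarrow> bool" where
  "C_k_on 0 \<phi> U \<longleftrightarrow> continuous_on U \<phi>"
| "C_k_on (Suc k) \<phi> U \<longleftrightarrow>
     (\<forall>u\<in>U. \<phi> differentiable (at u)) \<and>
     (\<forall>v. C_k_on k (\<lambda>u. frechet_derivative \<phi> (at u) v) U)"

text \<open>\<open>C\<^sup>k\<close> on a compact set \<open>K\<close>: the map is (the restriction of) a \<open>C\<^sup>k\<close> map on an open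
  neighbourhood of \<open>K\<close>, so that its derivatives make sense at boundary points of \<open>K\<close> as well.
  The values outside the neighbourhood are arbitrary.\<close>

definition C_k_on_compact ::
    "nat \<Rightarrow> ('a::euclidean_space \<Rightarrow> 'b::euclidean_space) \<Rightarrow> 'a set \<Rightarrow> bool" where
  "C_k_on_compact k \<phi> K \<longleftrightarrow> compact K \<and> (\<exists>U. open U \<and> K \<subseteq> U \<and> C_k_on k \<phi> U)"

definition partial_deriv ::
    "'m::finite \<Rightarrow> (real^'m \<Rightarrow> real) \<Rightarrow> real^'m \<Rightarrow> real" where
  "partial_deriv j \<phi> v = frechet_derivative \<phi> (at v) (axis j 1)"

text \<open>The contraction \<open>D\<^sup>2X[a \<otimes> a]\<close> at the point \<open>v\<close>, for an \<open>m \<times> d\<close> matrix \<open>a\<close>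
  (\<open>a $ j $ l\<close> is the entry in row \<open>j\<close> and column \<open>l\<close>).\<close>

definition D2_contract ::
    "(real^'m::finite \<Rightarrow> real^'n::finite) \<Rightarrow> real^'m \<Rightarrow> real^'d::finite^'m \<Rightarrow> real^'n" where
  "D2_contract X v a =
     (\<chi> i. \<Sum>j\<in>UNIV. \<Sum>k\<in>UNIV. \<Sum>l\<in>UNIV.
        partial_deriv j (partial_deriv k (\<lambda>w. X w $ i)) v * a $ j $ l * a $ k $ l)"


section \<open>Processes and Brownian motion\<close>

text \<open>Processes are functions of \<open>t :: real\<close>, of which only the times \<open>t \<ge> 0\<close> matter.  A filtration
  indexed by \<open>[0, \<infinity>)\<close> becomes one indexed by \<open>real\<close> by setting \<open>F t = F 0\<close> for \<open>t < 0\<close>.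
  No completeness or right-continuity of the filtration is required.\<close>

definition filtered_prob_space :: "'w measure \<Rightarrow> (real \<Rightarrow> 'w measure) \<Rightarrow> bool" where
  "filtered_prob_space M F \<longleftrightarrow>
     prob_space M \<and> filtration (space M) F \<and> (\<forall>t. subalgebra M (F t))"

definition prog_measurable ::
    "(real \<Rightarrow> 'w measure) \<Rightarrow> (real \<Rightarrow> 'w \<Rightarrow> 'b::euclidean_space) \<Rightarrow> bool" where
  "prog_measurable F Z \<longleftrightarrow>
     (\<forall>T\<ge>0. (\<lambda>(t, \<omega>). Z t \<omega>) \<in> borel_measurable (restrict_space borel {0..T} \<Otimes>\<^sub>M F T))"

definition continuous_paths ::
    "'w measure \<Rightarrow> (real \<Rightarrow> 'w \<Rightarrow> 'b::euclidean_space) \<Rightarrow> bool" where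
  "continuous_paths M Z \<longleftrightarrow> (AE \<omega> in M. continuous_on {0..} (\<lambda>t. Z t \<omega>))"

definition brownian_motion ::
    "'w measure \<Rightarrow> (real \<Rightarrow> 'w measure) \<Rightarrow> (real \<Rightarrow> 'w \<Rightarrow> real^'d::finite) \<Rightarrow> bool" where
  "brownian_motion M F W \<longleftrightarrow>
     filtered_prob_space M F \<and>
     (\<forall>t\<ge>0. W t \<in> borel_measurable (F t)) \<and>
     continuous_paths M W \<and>
     (AE \<omega> in M. W 0 \<omega> = 0) \<and>
     (\<forall>s t. 0 \<le> s \<and> s < t \<longrightarrow>
        prob_space.indep_set M (sets (F s))
          (sets (vimage_algebra (space M) (\<lambda>\<omega>. W t \<omega> - W s \<omega>) borel)) \<and>
        prob_space.indep_vars M (\<lambda>_. borel) (\<lambda>i \<omega>. (W t \<omega> - W s \<omega>) $ i) UNIV \<and>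
        (\<forall>i. distributed M lborel (\<lambda>\<omega>. (W t \<omega> - W s \<omega>) $ i)
               (\<lambda>u. ennreal (normal_density 0 (sqrt (t - s)) u))))"


section \<open>The Ito integral\<close>

definition conv_in_prob ::
    "'w measure \<Rightarrow> (nat \<Rightarrow> 'w \<Rightarrow> 'b::euclidean_space) \<Rightarrow> ('w \<Rightarrow> 'b) \<Rightarrow> bool" where
  "conv_in_prob M Y L \<longleftrightarrow>
     (\<forall>r. Y r \<in> borel_measurable M) \<and> L \<in> borel_measurable M \<and>
     (\<forall>e>0. (\<lambda>r. measure M {\<omega>\<in>space M. e < norm (Y r \<omega> - L \<omega>)}) \<longlonglongrightarrow> 0)"

text \<open>A simple process is given by a number \<open>k\<close> of steps, grid points \<open>\<tau> 0 \<le> \<dots> \<le> \<tau> k\<close>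
  and bounded matrix-valued \<open>\<xi> i\<close>, measurable with respect to \<open>F (\<tau> i)\<close>; its value is
  \<open>\<xi> i\<close> on the interval \<open>(\<tau> i, \<tau> (i + 1)]\<close>.\<close>

definition simple_process_data ::
    "'w measure \<Rightarrow> (real \<Rightarrow> 'w measure) \<Rightarrow> nat \<Rightarrow> (nat \<Rightarrow> real)
      \<Rightarrow> (nat \<Rightarrow> 'w \<Rightarrow> real^'d::finite^'k::finite) \<Rightarrow> bool" where
  "simple_process_data M F k \<tau> \<xi> \<longleftrightarrow>
     0 \<le> \<tau> 0 \<and> (\<forall>i<k. \<tau> i \<le> \<tau> (Suc i)) \<and>
     (\<forall>i<k. \<xi> i \<in> borel_measurable (F (\<tau> i)) \<and> bounded (\<xi> i ` space M))"

definition simple_process ::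
    "nat \<Rightarrow> (nat \<Rightarrow> real) \<Rightarrow> (nat \<Rightarrow> 'w \<Rightarrow> real^'d::finite^'k::finite)
      \<Rightarrow> real \<Rightarrow> 'w \<Rightarrow> real^'d^'k" where
  "simple_process k \<tau> \<xi> t \<omega> =
     (\<Sum>i<k. indicator {\<tau> i<..\<tau> (Suc i)} t *\<^sub>R \<xi> i \<omega>)"

definition simple_integral ::
    "(real \<Rightarrow> 'w \<Rightarrow> real^'d::finite) \<Rightarrow> nat \<Rightarrow> (nat \<Rightarrow> real)
      \<Rightarrow> (nat \<Rightarrow> 'w \<Rightarrow> real^'d^'k::finite) \<Rightarrow> real \<Rightarrow> 'w \<Rightarrow> real^'k" where
  "simple_integral W k \<tau> \<xi> t \<omega> =
     (\<Sum>i<k. \<xi> i \<omega> *v (W (min t (\<tau> (Suc i))) \<omega> - W (min t (\<tau> i)) \<omega>))"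

text \<open>\<open>is_ito_integral M F W H N\<close>: the process \<open>N\<close> is (a continuous version of)
  \<open>t \<mapsto> \<integral>\<^sub>0\<^sup>t H dW\<close>.  The integrand is progressively measurable with locally square-integrable
  paths, and the integral is the limit in probability of the integrals of simple processes that
  approximate \<open>H\<close>.  The limit does not depend on the approximating sequence, so this determines
  \<open>N\<close> up to indistinguishability.\<close>

definition is_ito_integral ::
    "'w measure \<Rightarrow> (real \<Rightarrow> 'w measure) \<Rightarrow> (real \<Rightarrow> 'w \<Rightarrow> real^'d::finite)
      \<Rightarrow> (real \<Rightarrow> 'w \<Rightarrow> real^'d^'k::finite) \<Rightarrow> (real \<Rightarrow> 'w \<Rightarrow> real^'k) \<Rightarrow> bool" where
  "is_ito_integral M F W H N \<longleftrightarrow>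
     prog_measurable F H \<and>
     (AE \<omega> in M. \<forall>T\<ge>0. set_integrable lborel {0..T} (\<lambda>t. (norm (H t \<omega>))\<^sup>2)) \<and>
     continuous_paths M N \<and>
     (\<exists>k \<tau> \<xi>. (\<forall>r. simple_process_data M F (k r) (\<tau> r) (\<xi> r)) \<and>
        (\<forall>T\<ge>0.
           conv_in_prob M
             (\<lambda>r \<omega>. LINT t:{0..T}|lborel.
                (norm (simple_process (k r) (\<tau> r) (\<xi> r) t \<omega> - H t \<omega>))\<^sup>2)
             (\<lambda>\<omega>. 0) \<and>
           conv_in_prob M (\<lambda>r. simple_integral W (k r) (\<tau> r) (\<xi> r) T) (N T)))"


section \<open>Ito differentials and the slow-fast system\<close>

text \<open>\<open>has_ito_differential_on M F W R Z b S\<close>: the equation \<open>dZ = b dt + S dW\<close> holds as long as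
  \<open>t \<in> R \<omega>\<close>.  That is, almost surely
  \<open>Z t - Z s = \<integral>\<^sub>s\<^sup>t b du + \<integral>\<^sub>s\<^sup>t S dW\<close> for all intervals \<open>[s, t]\<close> contained in \<open>R \<omega>\<close>.

  Outside \<open>R\<close> the coefficients may be ill-behaved (or meaningless), so they are first replaced by
  globally defined progressively measurable \<open>B\<close> and \<open>H\<close> that coincide with \<open>b\<close> and \<open>S\<close> on \<open>R\<close>.
  By locality of the Ito integral the increments of \<open>\<integral> H dW\<close> over intervals contained in \<open>R\<close>
  do not depend on the choice of \<open>H\<close>.  For \<open>R \<omega> = {0..}\<close> this is the usual notion.\<close>

definition has_ito_differential_on ::
    "'w measure \<Rightarrow> (real \<Rightarrow> 'w measure) \<Rightarrow> (real \<Rightarrow> 'w \<Rightarrow> real^'d::finite) \<Rightarrow> ('w \<Rightarrow> real set)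
      \<Rightarrow> (real \<Rightarrow> 'w \<Rightarrow> real^'k::finite) \<Rightarrow> (real \<Rightarrow> 'w \<Rightarrow> real^'k) \<Rightarrow> (real \<Rightarrow> 'w \<Rightarrow> real^'d^'k)
      \<Rightarrow> bool" where
  "has_ito_differential_on M F W R Z b S \<longleftrightarrow>
     (\<forall>t\<ge>0. (\<lambda>\<omega>. if t \<in> R \<omega> then Z t \<omega> else 0) \<in> borel_measurable (F t)) \<and>
     (\<exists>B H N.
        prog_measurable F B \<and> is_ito_integral M F W H N \<and>
        (\<forall>\<omega>\<in>space M. \<forall>t\<ge>0. t \<in> R \<omega> \<longrightarrow> B t \<omega> = b t \<omega> \<and> H t \<omega> = S t \<omega>) \<and>
        (AE \<omega> in M. \<forall>s t. 0 \<le> s \<and> s \<le> t \<and> {s..t} \<subseteq> R \<omega> \<longrightarrow>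
           set_integrable lborel {s..t} (\<lambda>u. B u \<omega>) \<and>
           Z t \<omega> - Z s \<omega> = (LINT u:{s..t}|lborel. B u \<omega>) + (N t \<omega> - N s \<omega>)))"

text \<open>\<open>(x, y)\<close> solves \<open>dx = f(x,y) dt\<close>, \<open>dy = \<epsilon> g(x,y) dt + \<sigma> h(y) dW\<close>.  (Adapted processes all of
  whose paths are continuous are progressively measurable.)\<close>

definition slow_fast_solution ::
    "'w measure \<Rightarrow> (real \<Rightarrow> 'w measure) \<Rightarrow> (real \<Rightarrow> 'w \<Rightarrow> real^'d::finite)
      \<Rightarrow> ((real^'n::finite) \<times> (real^'m::finite) \<Rightarrow> real^'n) \<Rightarrow> ((real^'n) \<times> (real^'m) \<Rightarrow> real^'m)
      \<Rightarrow> (real^'m \<Rightarrow> real^'d^'m) \<Rightarrow> real \<Rightarrow> real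
      \<Rightarrow> (real \<Rightarrow> 'w \<Rightarrow> real^'n) \<Rightarrow> (real \<Rightarrow> 'w \<Rightarrow> real^'m) \<Rightarrow> bool" where
  "slow_fast_solution M F W f g h \<epsilon> \<sigma> x y \<longleftrightarrow>
     prog_measurable F x \<and> continuous_paths M x \<and>
     prog_measurable F y \<and> continuous_paths M y \<and>
     (AE \<omega> in M. \<forall>t\<ge>0. x t \<omega> = x 0 \<omega> + (LINT s:{0..t}|lborel. f (x s \<omega>, y s \<omega>))) \<and>
     has_ito_differential_on M F W (\<lambda>\<omega>. {0..}) y
       (\<lambda>t \<omega>. \<epsilon> *\<^sub>R g (x t \<omega>, y t \<omega>))
       (\<lambda>t \<omega>. \<sigma> *\<^sub>R h (y t \<omega>))"

end

theory Submission
  imports Defs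
begin

text \<open>
  As long as \<open>y\<close> stays in \<open>K\<close>, the process \<open>z = x - X(y)\<close> is the difference of a
  process \<open>x\<close> of bounded variation and a smooth function of the Ito process \<open>y\<close>, so the claim is
  the multidimensional Ito formula for the components of \<open>X\<close>.  The formula itself is proved here,
  from the definition of the stochastic integral as a limit of integrals of simple processes.

  Near the compact set \<open>K\<close>, the map \<open>X\<close> may be replaced by a compactly supported \<open>C\<^sup>2\<close> map
  (\<open>C_k_on_compact_extension\<close>).  For such a map \<open>\<psi>\<close> the martingale part of \<open>\<psi>(y)\<close> is defined to be
  what the Ito formula says it should be; its paths are then continuous, and only one thing has to be
  shown: the left-point sums \<open>\<Sum>\<^sub>i D\<psi>(y(t\<^sub>i)) H(t\<^sub>i) (W(t\<^sub>i\<^sub>+\<^sub>1) - W(t\<^sub>i))\<close>, where \<open>H = \<sigma> h(y)\<close>, converge in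
  probability to it (\<open>ito_left_point_sums\<close>).  These sums are integrals of bounded simple processes
  that approximate \<open>D\<psi>(y) H\<close>, because \<open>\<psi>\<close> has compact support and paths are continuous.

  The convergence follows from a Taylor expansion of \<open>\<psi>(y(t\<^sub>i\<^sub>+\<^sub>1)) - \<psi>(y(t\<^sub>i))\<close> to second order over
  a fine grid.  The increment of \<open>y\<close> is the sum of its drift, of the leading part
  \<open>H(t\<^sub>i) (W(t\<^sub>i\<^sub>+\<^sub>1) - W(t\<^sub>i))\<close> and of an error.  The errors are negligible
  (\<open>integral_increment_deviation\<close>), since an integral against \<open>W\<close> is small in probability when the
  time integral of the squared integrand is; this is obtained from the isometry for stochastic sums by
  stopping (\<open>simple_integral_deviation\<close>).  In the quadratic term, the products of Brownian increments
  may be replaced by their means because their deviations are orthogonal with second moments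
  \<open>O((\<Delta>t)\<^sup>2)\<close> (\<open>quadratic_sum_second_moment\<close>).  The Taylor remainder is \<open>o(|\<Delta>y|\<^sup>2)\<close> uniformly along
  each path.  Unbounded coefficients are treated by localisation.  All estimates are stated as
  smallness outside events of small probability.\<close>

section \<open>Maps of class \<open>C\<^sup>k\<close>\<close>

lemma C_k_on_cong:
  assumes "open U" "\<And>u. u \<in> U \<Longrightarrow> \<phi> u = \<psi> u" "C_k_on k \<phi> U"
  shows "C_k_on k \<psi> U"
  using assms(2,3)
proof (induction k arbitrary: \<phi> \<psi>)
  case 0
  then show ?case by (simp cong: continuous_on_cong)
next
  case (Suc k)
  have D: "(\<psi> has_derivative frechet_derivative \<phi> (at u)) (at u)" if "u \<in> U" for u
    using Suc.prems that \<open>open U\<close>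
    by (auto intro: has_derivative_transform_within_open[of \<phi> _ u UNIV U \<psi>]
        simp: frechet_derivative_works[symmetric])
  have eq: "frechet_derivative \<phi> (at u) v = frechet_derivative \<psi> (at u) v" if "u \<in> U" for u v
    using frechet_derivative_at[OF D[OF that]] by simp
  have "\<psi> differentiable (at u)" if "u \<in> U" for u
    using D[OF that] by (auto simp: differentiable_def)
  moreover have "C_k_on k (\<lambda>u. frechet_derivative \<psi> (at u) v) U" for v
    by (rule Suc.IH[OF eq]) (use Suc.prems(2) in auto)
  ultimately show ?case by simp
qed

text \<open>The derivative may be certified by any family of linear maps, not only by the one that
  \<open>frechet_derivative\<close> picks.\<close>

lemma C_k_on_SucI:
  assumes U: "open U" and D: "\<And>u. u \<in> U \<Longrightarrow> (\<phi> has_derivative \<phi>' u) (at u)"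
    and C: "\<And>v. C_k_on k (\<lambda>u. \<phi>' u v) U"
  shows "C_k_on (Suc k) \<phi> U"
proof -
  have "frechet_derivative \<phi> (at u) = \<phi>' u" if "u \<in> U" for u
    using frechet_derivative_at[OF D[OF that]] by simp
  then have "C_k_on k (\<lambda>u. frechet_derivative \<phi> (at u) v) U" for v
    using C[of v] by (intro C_k_on_cong[OF U _ C[of v]]) auto
  then show ?thesis
    using D by (auto simp: differentiable_def)
qed

lemma C_k_on_SucD:
  assumes "C_k_on (Suc k) \<phi> U" "u \<in> U"
  shows "(\<phi> has_derivative frechet_derivative \<phi> (at u)) (at u)"
  using assms by (simp add: frechet_derivative_works[symmetric])

lemma C_k_on_imp_continuous_on:
  assumes "C_k_on k \<phi> U"
  shows "continuous_on U \<phi>"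
proof (cases k)
  case 0
  then show ?thesis using assms by simp
next
  case (Suc j)
  then show ?thesis
    using assms
    by (intro differentiable_imp_continuous_on) (simp add: differentiable_on_def differentiable_at_withinI)
qed

lemma C_k_on_Suc_imp: "C_k_on (Suc k) \<phi> U \<Longrightarrow> C_k_on k \<phi> U"
proof (induction k arbitrary: \<phi>)
  case 0
  show ?case using C_k_on_imp_continuous_on[OF 0] by simp
next
  case (Suc k)
  have *: "(\<forall>u\<in>U. \<phi> differentiable (at u)) \<and>
      (\<forall>v. C_k_on (Suc k) (\<lambda>u. frechet_derivative \<phi> (at u) v) U)"
    by (rule iffD1[OF C_k_on.simps(2) Suc.prems])
  show ?case
    by (rule iffD2[OF C_k_on.simps(2)], rule conjI[OF conjunct1[OF *]], rule allI,
        rule Suc.IH, rule spec[OF conjunct2[OF *]])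
qed

lemma C_k_on_le: "j \<le> k \<Longrightarrow> C_k_on k \<phi> U \<Longrightarrow> C_k_on j \<phi> U"
proof (induction rule: inc_induct)
  case (step i)
  show ?case using step.IH[OF step.prems] by (rule C_k_on_Suc_imp)
qed

lemma C_k_on_subset: "C_k_on k \<phi> U \<Longrightarrow> V \<subseteq> U \<Longrightarrow> C_k_on k \<phi> V"
proof (induction k arbitrary: \<phi>)
  case 0
  then show ?case using continuous_on_subset by auto
next
  case (Suc k)
  then show ?case by (simp add: subset_iff)
qed

text \<open>Being of class \<open>C\<^sup>k\<close> is a local property; this glues the product with a cut-off function to zero
  outside its support.\<close>

lemma C_k_on_Un:
  "open U \<Longrightarrow> open V \<Longrightarrow> C_k_on k \<phi> U \<Longrightarrow> C_k_on k \<phi> V \<Longrightarrow> C_k_on k \<phi> (U \<union> V)"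
proof (induction k arbitrary: \<phi>)
  case 0
  then show ?case using continuous_on_open_Un by auto
next
  case (Suc k)
  then show ?case by simp blast
qed

lemma C_k_on_const: "C_k_on k (\<lambda>u. c) U"
proof (induction k arbitrary: c)
  case (Suc k)
  then show ?case by simp
qed simp

lemma C_k_on_add:
  "open U \<Longrightarrow> C_k_on k \<phi> U \<Longrightarrow> C_k_on k \<psi> U \<Longrightarrow> C_k_on k (\<lambda>u. \<phi> u + \<psi> u) U"
proof (induction k arbitrary: \<phi> \<psi>)
  case 0
  then show ?case by (auto intro: continuous_on_add)
next
  case (Suc k)
  show ?case
  proof (rule C_k_on_SucI[OF \<open>open U\<close>])
    show "((\<lambda>u. \<phi> u + \<psi> u) has_derivative
        (\<lambda>v. frechet_derivative \<phi> (at u) v + frechet_derivative \<psi> (at u) v)) (at u)"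
      if "u \<in> U" for u
      using Suc.prems that by (intro has_derivative_add) (auto dest: C_k_on_SucD simp del: C_k_on.simps)
  qed (use Suc in auto)
qed

lemma C_k_on_mult:
  fixes \<phi> \<psi> :: "'a::euclidean_space \<Rightarrow> real"
  shows "open U \<Longrightarrow> C_k_on k \<phi> U \<Longrightarrow> C_k_on k \<psi> U \<Longrightarrow> C_k_on k (\<lambda>u. \<phi> u * \<psi> u) U"
proof (induction k arbitrary: \<phi> \<psi>)
  case 0
  then show ?case by (auto intro: continuous_on_mult)
next
  case (Suc k)
  show ?case
  proof (rule C_k_on_SucI[OF \<open>open U\<close>])
    show "((\<lambda>u. \<phi> u * \<psi> u) has_derivative
        (\<lambda>v. \<phi> u * frechet_derivative \<psi> (at u) v + frechet_derivative \<phi> (at u) v * \<psi> u)) (at u)"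
      if "u \<in> U" for u
      using Suc.prems that by (intro has_derivative_mult) (auto dest: C_k_on_SucD simp del: C_k_on.simps)
    show "C_k_on k (\<lambda>u. \<phi> u * frechet_derivative \<psi> (at u) v + frechet_derivative \<phi> (at u) v * \<psi> u) U"
      for v
      using Suc.prems C_k_on_Suc_imp[OF Suc.prems(2)] C_k_on_Suc_imp[OF Suc.prems(3)]
      by (intro C_k_on_add Suc.IH) auto
  qed
qed

lemma C_k_on_sum:
  assumes "open U" "\<And>i. i \<in> I \<Longrightarrow> C_k_on k (\<phi> i) U"
  shows "C_k_on k (\<lambda>u. \<Sum>i\<in>I. \<phi> i u) U"
  using assms(2)
  by (induction I rule: infinite_finite_induct) (auto intro: C_k_on_const C_k_on_add[OF \<open>open U\<close>])

lemma C_k_on_bounded_linear_comp: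
  assumes "open U" "bounded_linear L"
  shows "C_k_on k \<phi> U \<Longrightarrow> C_k_on k (\<lambda>u. L (\<phi> u)) U"
proof (induction k arbitrary: \<phi>)
  case 0
  then show ?case
    using assms(2) by (auto intro: bounded_linear.continuous_on)
next
  case (Suc k)
  show ?case
  proof (rule C_k_on_SucI[OF \<open>open U\<close>])
    show "((\<lambda>u. L (\<phi> u)) has_derivative (\<lambda>v. L (frechet_derivative \<phi> (at u) v))) (at u)"
      if "u \<in> U" for u
      using Suc.prems that
      by (intro bounded_linear.has_derivative[OF assms(2)]) (auto dest: C_k_on_SucD simp del: C_k_on.simps)
  qed (use Suc in auto)
qed

lemma C_k_on_dist_square: "C_k_on k (\<lambda>u. (u - c) \<bullet> (u - c)) UNIV"
proof -
  have lin: "C_k_on j (\<lambda>u. 2 * ((u - c) \<bullet> v)) UNIV" for j v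
  proof (cases j)
    case (Suc i)
    then show ?thesis
      by (auto intro!: C_k_on_SucI[where \<phi>' = "\<lambda>u w. 2 * (w \<bullet> v)"] C_k_on_const derivative_eq_intros
          simp del: C_k_on.simps)
  qed (auto intro!: continuous_intros)
  show ?thesis
  proof (cases k)
    case (Suc i)
    have "((\<lambda>u. (u - c) \<bullet> (u - c)) has_derivative (\<lambda>v. 2 * ((u - c) \<bullet> v))) (at u)" for u
      by (auto intro!: derivative_eq_intros simp: inner_commute)
    then show ?thesis
      unfolding Suc by (intro C_k_on_SucI[where \<phi>' = "\<lambda>u v. 2 * ((u - c) \<bullet> v)"] lin) auto
  qed (auto intro!: continuous_intros)
qed

lemma has_real_derivative_positive_part_power:
  "((\<lambda>s::real. max 0 s ^ Suc (Suc k)) has_real_derivative real (Suc (Suc k)) * max 0 s ^ Suc k) (at s)"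
proof -
  consider "s < 0" | "s > 0" | "s = 0" by linarith
  then show ?thesis
  proof cases
    case 1
    have "((\<lambda>s::real. 0) has_real_derivative real (Suc (Suc k)) * max 0 s ^ Suc k) (at s)"
      using 1 by auto
    then show ?thesis
      by (rule has_field_derivative_transform_within_open[where S = "{..<0}"]) (use 1 in auto)
  next
    case 2
    have "((\<lambda>s::real. s ^ Suc (Suc k)) has_real_derivative real (Suc (Suc k)) * max 0 s ^ Suc k) (at s)"
      using 2 DERIV_pow[of "Suc (Suc k)" s UNIV] by (simp del: power_Suc of_nat_Suc)
    then show ?thesis
      by (rule has_field_derivative_transform_within_open[where S = "{0<..}"]) (use 2 in auto)
  next
    case 3
    have "((\<lambda>h::real. max 0 h ^ Suc (Suc k) / h) \<longlongrightarrow> 0) (at 0)"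
    proof (rule tendsto_rabs_zero_cancel, rule tendsto_sandwich[of "\<lambda>h. 0" _ _ "\<lambda>h. \<bar>h\<bar> ^ Suc k"])
      have "max 0 h ^ Suc (Suc k) / h = max 0 h ^ Suc k" for h :: real
        by (auto simp: max_def)
      then show "\<forall>\<^sub>F h in at (0::real). \<bar>max 0 h ^ Suc (Suc k) / h\<bar> \<le> \<bar>h\<bar> ^ Suc k"
        by (intro always_eventually allI) (simp add: power_abs power_mono del: power_Suc)
      show "((\<lambda>h::real. \<bar>h\<bar> ^ Suc k) \<longlongrightarrow> 0) (at 0)"
        by (auto intro!: tendsto_eq_intros)
    qed auto
    then show ?thesis
      using 3 by (simp add: DERIV_def del: power_Suc)
  qed
qed

text \<open>Powers of the positive part are the building blocks of cut-off functions: \<open>max 0 s ^ (k + 1)\<close>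
  is of class \<open>C\<^sup>k\<close>, and composing with it preserves that class.\<close>

lemma C_k_on_positive_part_power:
  assumes "open U"
  shows "C_k_on k s U \<Longrightarrow> C_k_on k (\<lambda>u. max 0 (s u :: real) ^ Suc k) U"
proof (induction k)
  case 0
  then show ?case by (auto intro!: continuous_intros)
next
  case (Suc k)
  show ?case
  proof (rule C_k_on_SucI[OF assms])
    show "((\<lambda>u. max 0 (s u) ^ Suc (Suc k)) has_derivative
        (\<lambda>v. real (Suc (Suc k)) * max 0 (s u) ^ Suc k * frechet_derivative s (at u) v)) (at u)"
      if "u \<in> U" for u
      using has_derivative_compose[OF C_k_on_SucD[OF Suc.prems that]
          has_real_derivative_positive_part_power[of k "s u", unfolded has_field_derivative_def]]
      by simp
    show "C_k_on k (\<lambda>u. real (Suc (Suc k)) * max 0 (s u) ^ Suc k * frechet_derivative s (at u) v) U" for v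
      using Suc.IH[OF C_k_on_Suc_imp[OF Suc.prems]] Suc.prems
      by (intro C_k_on_mult[OF assms] C_k_on_const) (auto simp del: power_Suc)
  qed
qed

text \<open>A finite sum of bumps \<open>max 0 (1 - |v - c|\<^sup>2 / r\<^sup>2) ^ (k + 1)\<close> is positive on \<open>K\<close> and lives near
  \<open>K\<close>; composing it with a function that vanishes at \<open>0\<close> and equals \<open>1\<close> above the minimum on
  \<open>K\<close> makes it constant near \<open>K\<close>.\<close>

lemma C_k_cutoff_exists:
  fixes K U :: "'a::euclidean_space set"
  assumes "compact K" "open U" "K \<subseteq> U"
  obtains \<theta> :: "'a \<Rightarrow> real" and V C where "C_k_on k \<theta> UNIV" "open V" "K \<subseteq> V" "V \<subseteq> U"
    "\<And>v. v \<in> V \<Longrightarrow> \<theta> v = 1" "compact C" "C \<subseteq> U" "\<And>v. v \<notin> C \<Longrightarrow> \<theta> v = 0"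
proof -
  have "\<exists>r. \<forall>c\<in>K. 0 < r c \<and> cball c (r c) \<subseteq> U"
    using assms(2,3) by (intro bchoice) (auto simp: open_contains_cball subset_iff)
  then obtain r where r: "\<And>c. c \<in> K \<Longrightarrow> 0 < r c" "\<And>c. c \<in> K \<Longrightarrow> cball c (r c) \<subseteq> U"
    by blast
  obtain P where P: "P \<subseteq> K" "finite P" "K \<subseteq> (\<Union>c\<in>P. ball c (r c))"
  proof (rule compactE_image[OF assms(1), of K "\<lambda>c. ball c (r c)"])
    show "K \<subseteq> (\<Union>c\<in>K. ball c (r c))"
      using r(1) by force
  qed auto
  define b where "b = (\<lambda>c v. max 0 (1 + - (1 / (r c)\<^sup>2) * ((v - c) \<bullet> (v - c))) ^ Suc k)"
  define s where "s v = (\<Sum>c\<in>P. b c v)" for v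
  have C_b: "C_k_on k (b c) UNIV" for c
    unfolding b_def
    by (intro C_k_on_positive_part_power C_k_on_add C_k_on_mult C_k_on_const C_k_on_dist_square open_UNIV)
  then have C_s: "C_k_on k s UNIV"
    unfolding s_def by (intro C_k_on_sum) auto
  have b_pos: "0 < b c v" if "c \<in> P" "v \<in> ball c (r c)" for c v
  proof -
    have "norm (v - c) < r c" "0 < r c"
      using that r(1) P(1) by (auto simp: dist_norm norm_minus_commute)
    then have "(norm (v - c))\<^sup>2 < (r c)\<^sup>2"
      by (intro power_strict_mono) auto
    then have "1 / (r c)\<^sup>2 * ((v - c) \<bullet> (v - c)) < 1"
      using \<open>0 < r c\<close> by (simp add: power2_norm_eq_inner divide_simps)
    then show ?thesis by (auto simp: b_def simp del: power_Suc)
  qed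
  have b_zero: "b c v = 0" if "c \<in> P" "v \<notin> cball c (r c)" for c v
  proof -
    have "norm (v - c) > r c" "0 < r c"
      using that r(1) P(1) by (auto simp: dist_norm norm_minus_commute)
    then have "(norm (v - c))\<^sup>2 > (r c)\<^sup>2"
      by (intro power_strict_mono) auto
    then have "1 / (r c)\<^sup>2 * ((v - c) \<bullet> (v - c)) > 1"
      using \<open>0 < r c\<close> by (simp add: power2_norm_eq_inner divide_simps)
    then show ?thesis by (auto simp: b_def)
  qed
  have s_pos: "0 < s v" if "v \<in> K" for v
  proof -
    have "v \<in> (\<Union>c\<in>P. ball c (r c))" using that P(3) by blast
    then obtain c where "c \<in> P" "v \<in> ball c (r c)" by blast
    then show ?thesis
      unfolding s_def by (intro sum_pos2[OF P(2)] b_pos) (auto simp: b_def)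
  qed
  have cont_s: "continuous_on UNIV s"
    using C_k_on_imp_continuous_on[OF C_s] .
  obtain m where m: "0 < m" "\<And>v. v \<in> K \<Longrightarrow> m < s v"
  proof (cases "K = {}")
    case False
    then obtain v where "v \<in> K" "\<And>w. w \<in> K \<Longrightarrow> s v \<le> s w"
      using continuous_attains_inf[OF assms(1) _ continuous_on_subset[OF cont_s]] by blast
    then show thesis
      using s_pos[of v] by (intro that[of "s v / 2"]) fastforce+
  qed (use that[of 1] in auto)
  define \<theta> where "\<theta> v = 1 + - 1 * max 0 (1 + - (1 / m) * s v) ^ Suc k" for v
  define C where "C = (\<Union>c\<in>P. cball c (r c))"
  have "C_k_on k \<theta> UNIV"
    unfolding \<theta>_def
    by (intro C_k_on_positive_part_power C_k_on_add C_k_on_mult C_k_on_const C_s open_UNIV)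
  moreover have "open (s -` {m<..})"
    using cont_s by (intro open_vimage) auto
  moreover have "K \<subseteq> s -` {m<..}"
    using m(2) by auto
  moreover have "\<theta> v = 1" if "v \<in> s -` {m<..}" for v
    using that m(1) by (auto simp: \<theta>_def max_def divide_simps)
  moreover have "compact C" "C \<subseteq> U"
    using P(1,2) r(2) by (auto simp: C_def intro!: compact_UN)
  moreover have s_zero: "s v = 0" if "v \<notin> C" for v
    unfolding s_def using that by (intro sum.neutral ballI b_zero) (auto simp: C_def)
  moreover have "\<theta> v = 0" if "v \<notin> C" for v
    using s_zero[OF that] by (simp add: \<theta>_def)
  moreover have "s -` {m<..} \<subseteq> U"
    using s_zero m(1) \<open>C \<subseteq> U\<close> by fastforce
  ultimately show thesis
    by (intro that[of \<theta> "s -` {m<..}" C]) auto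
qed

text \<open>Multiplication with a cut-off function extends a \<open>C\<^sup>k\<close> map from a neighbourhood of \<open>K\<close> to the
  whole space.  What matters is the compact support: the derivatives of the extension are globally
  bounded.\<close>

lemma C_k_on_compact_extension:
  fixes \<phi> :: "'a::euclidean_space \<Rightarrow> real"
  assumes "compact K" "open U" "K \<subseteq> U" "C_k_on k \<phi> U"
  obtains \<psi> V C where "C_k_on k \<psi> UNIV" "open V" "K \<subseteq> V" "V \<subseteq> U" "\<And>v. v \<in> V \<Longrightarrow> \<psi> v = \<phi> v"
    "compact C" "\<And>v. v \<notin> C \<Longrightarrow> \<psi> v = 0"
proof -
  obtain \<theta> V C where \<theta>: "C_k_on k \<theta> UNIV" "open V" "K \<subseteq> V" "V \<subseteq> U"
    "\<And>v. v \<in> V \<Longrightarrow> \<theta> v = (1::real)" "compact C" "C \<subseteq> U" "\<And>v. v \<notin> C \<Longrightarrow> \<theta> v = 0"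
    using C_k_cutoff_exists[OF assms(1-3)] by metis
  define \<psi> where "\<psi> v = (if v \<in> C then \<theta> v * \<phi> v else 0)" for v
  have "C_k_on k (\<lambda>v. \<theta> v * \<phi> v) U"
    using assms \<theta>(1) by (intro C_k_on_mult) (auto intro: C_k_on_subset)
  then have "C_k_on k \<psi> U"
    by (rule C_k_on_cong[OF assms(2), rotated]) (auto simp: \<psi>_def \<theta>(8))
  moreover have open_C: "open (- C)" using \<theta>(6) by (simp add: compact_imp_closed open_Compl)
  have "C_k_on k \<psi> (- C)"
    by (rule C_k_on_cong[OF open_C _ C_k_on_const[of k 0]]) (auto simp: \<psi>_def)
  moreover have "U \<union> - C = UNIV" using \<theta>(7) by auto
  ultimately have "C_k_on k \<psi> UNIV"
    using C_k_on_Un[OF assms(2) open_C] by metis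
  moreover have "\<psi> v = \<phi> v" if "v \<in> V" for v
    using \<theta>(5,8) that by (fastforce simp: \<psi>_def)
  ultimately show thesis
    using \<theta> by (intro that[of \<psi> V C]) (auto simp: \<psi>_def)
qed

section \<open>Second-order Taylor expansion\<close>

lemma linear_basis_expansion:
  fixes L :: "'a::euclidean_space \<Rightarrow> real"
  assumes "linear L"
  shows "L a = (\<Sum>e\<in>Basis. (a \<bullet> e) * L e)"
proof -
  have "L a = L (\<Sum>e\<in>Basis. (a \<bullet> e) *\<^sub>R e)"
    by (simp add: euclidean_representation)
  also have "\<dots> = (\<Sum>e\<in>Basis. (a \<bullet> e) * L e)"
    by (simp add: linear_sum[OF assms] linear_scale[OF assms])
  finally show ?thesis .
qed

text \<open>Both derivatives are parameters instead of being taken from \<open>frechet_derivative\<close>, so that second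
  derivatives are plain functions of the base point and two directions.\<close>

locale C2_function =
  fixes \<phi> :: "'a::euclidean_space \<Rightarrow> real" and \<phi>1 :: "'a \<Rightarrow> 'a \<Rightarrow> real"
    and \<phi>2 :: "'a \<Rightarrow> 'a \<Rightarrow> 'a \<Rightarrow> real"
  assumes deriv1: "(\<phi> has_derivative \<phi>1 v) (at v)"
    and deriv2: "((\<lambda>u. \<phi>1 u a) has_derivative \<phi>2 v a) (at v)"
    and continuous_deriv2: "continuous_on UNIV (\<lambda>v. \<phi>2 v a b)"
begin

lemma linear_deriv1: "linear (\<phi>1 v)"
  using deriv1 by (rule has_derivative_linear)

lemma linear_deriv2_right: "linear (\<phi>2 v a)"
  using deriv2 by (rule has_derivative_linear)

text \<open>In its first argument, \<open>\<phi>2\<close> is linear because derivatives are unique and \<open>\<phi>1\<close> is linear.\<close>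

lemma linear_deriv2_left: "linear (\<lambda>a. \<phi>2 v a b)"
proof (rule linearI)
  show "\<phi>2 v (a + c) b = \<phi>2 v a b + \<phi>2 v c b" for a c
  proof -
    have "((\<lambda>u. \<phi>1 u (a + c)) has_derivative (\<lambda>b. \<phi>2 v a b + \<phi>2 v c b)) (at v)"
      unfolding linear_add[OF linear_deriv1] by (intro has_derivative_add deriv2)
    from fun_cong[OF has_derivative_unique[OF deriv2 this]] show ?thesis .
  qed
  show "\<phi>2 v (r *\<^sub>R a) b = r *\<^sub>R \<phi>2 v a b" for r a
  proof -
    have "((\<lambda>u. \<phi>1 u (r *\<^sub>R a)) has_derivative (\<lambda>b. r *\<^sub>R \<phi>2 v a b)) (at v)"
      unfolding linear_scale[OF linear_deriv1] by (intro has_derivative_scaleR_right deriv2)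
    from fun_cong[OF has_derivative_unique[OF deriv2 this]] show ?thesis .
  qed
qed

lemma deriv1_basis: "\<phi>1 v a = (\<Sum>e\<in>Basis. (a \<bullet> e) * \<phi>1 v e)"
  by (rule linear_basis_expansion[OF linear_deriv1])

lemma deriv2_basis: "\<phi>2 v a b = (\<Sum>e\<in>Basis. \<Sum>e'\<in>Basis. (a \<bullet> e) * (b \<bullet> e') * \<phi>2 v e e')"
  by (subst linear_basis_expansion[OF linear_deriv2_left], subst linear_basis_expansion[OF linear_deriv2_right])
    (simp add: sum_distrib_left mult.assoc)

lemma continuous_function: "continuous_on UNIV \<phi>"
  using has_derivative_continuous[OF deriv1] by (auto simp: continuous_on_eq_continuous_at)

lemma continuous_deriv1: "continuous_on UNIV (\<lambda>v. \<phi>1 v a)"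
  using has_derivative_continuous[OF deriv2] by (auto simp: continuous_on_eq_continuous_at)

lemma continuous_on_function_comp [continuous_intros]:
  "continuous_on S f \<Longrightarrow> continuous_on S (\<lambda>x. \<phi> (f x))"
  by (rule continuous_on_compose2[OF continuous_function]) auto

lemma continuous_on_deriv1_comp [continuous_intros]:
  "continuous_on S f \<Longrightarrow> continuous_on S g \<Longrightarrow> continuous_on S (\<lambda>x. \<phi>1 (f x) (g x))"
  by (subst deriv1_basis)
    (intro continuous_intros continuous_on_compose2[OF continuous_deriv1], auto)

lemma continuous_on_deriv2_comp [continuous_intros]:
  "continuous_on S f \<Longrightarrow> continuous_on S g \<Longrightarrow> continuous_on S k \<Longrightarrow>
    continuous_on S (\<lambda>x. \<phi>2 (f x) (g x) (k x))"
  by (subst deriv2_basis)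
    (intro continuous_intros continuous_on_compose2[OF continuous_deriv2], auto)

lemma measurable_function_comp [measurable (raw)]:
  "f \<in> borel_measurable N \<Longrightarrow> (\<lambda>x. \<phi> (f x)) \<in> borel_measurable N"
  by (rule borel_measurable_continuous_on[OF continuous_function])

lemma measurable_deriv1_comp [measurable (raw)]:
  assumes [measurable]: "f \<in> borel_measurable N" "g \<in> borel_measurable N"
  shows "(\<lambda>x. \<phi>1 (f x) (g x)) \<in> borel_measurable N"
proof -
  have [measurable]: "(\<lambda>x. \<phi>1 (f x) e) \<in> borel_measurable N" for e
    by (rule borel_measurable_continuous_on[OF continuous_deriv1]) measurable
  show ?thesis
    by (subst deriv1_basis) measurable
qed

lemma measurable_deriv2_comp [measurable (raw)]:
  assumes [measurable]: "f \<in> borel_measurable N" "g \<in> borel_measurable N" "k \<in> borel_measurable N"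
  shows "(\<lambda>x. \<phi>2 (f x) (g x) (k x)) \<in> borel_measurable N"
proof -
  have [measurable]: "(\<lambda>x. \<phi>2 (f x) e e') \<in> borel_measurable N" for e e'
    by (rule borel_measurable_continuous_on[OF continuous_deriv2]) measurable
  show ?thesis
    by (subst deriv2_basis) measurable
qed

definition bound1 :: "'a \<Rightarrow> real" where "bound1 v = (\<Sum>e\<in>Basis. \<bar>\<phi>1 v e\<bar>)"

definition bound2 :: "'a \<Rightarrow> real" where "bound2 v = (\<Sum>e\<in>Basis. \<Sum>e'\<in>Basis. \<bar>\<phi>2 v e e'\<bar>)"

lemma bound_nonneg: "0 \<le> bound1 v" "0 \<le> bound2 v"
  by (auto simp: bound1_def bound2_def intro!: sum_nonneg)

lemma bilinear_basis_le:
  "\<bar>\<Sum>e\<in>Basis. \<Sum>e'\<in>Basis. (a \<bullet> e) * (b \<bullet> e') * (c e e' :: real)\<bar>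
    \<le> (\<Sum>e\<in>Basis. \<Sum>e'\<in>Basis. \<bar>c e e'\<bar>) * norm (a :: 'a) * norm (b :: 'a)"
proof -
  have "\<bar>\<Sum>e\<in>Basis. \<Sum>e'\<in>Basis. (a \<bullet> e) * (b \<bullet> e') * c e e'\<bar>
      \<le> (\<Sum>e\<in>Basis. \<Sum>e'\<in>Basis. \<bar>(a \<bullet> e) * (b \<bullet> e') * c e e'\<bar>)"
    by (rule order_trans[OF sum_abs], intro sum_mono sum_abs)
  also have "\<dots> \<le> (\<Sum>e\<in>(Basis::'a set). \<Sum>e'\<in>(Basis::'a set). norm a * norm b * \<bar>c e e'\<bar>)"
    by (intro sum_mono) (auto simp: abs_mult intro!: mult_right_mono mult_mono Basis_le_norm)
  finally show ?thesis by (simp add: sum_distrib_left ac_simps)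
qed

lemma deriv2_le: "\<bar>\<phi>2 v a b\<bar> \<le> bound2 v * norm a * norm b"
  unfolding bound2_def by (subst deriv2_basis) (rule bilinear_basis_le)

lemma continuous_on_bounds [continuous_intros]:
  "continuous_on S f \<Longrightarrow> continuous_on S (\<lambda>x. bound1 (f x))"
  "continuous_on S f \<Longrightarrow> continuous_on S (\<lambda>x. bound2 (f x))"
  unfolding bound1_def bound2_def by (auto intro!: continuous_intros)

lemma measurable_bounds [measurable (raw)]:
  assumes [measurable]: "f \<in> borel_measurable N"
  shows "(\<lambda>x. bound1 (f x)) \<in> borel_measurable N" "(\<lambda>x. bound2 (f x)) \<in> borel_measurable N"
  unfolding bound1_def bound2_def
  by (intro borel_measurable_sum borel_measurable_abs measurable_deriv1_comp measurable_deriv2_comp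
      borel_measurable_const assms)+

definition taylor_remainder :: "'a \<Rightarrow> 'a \<Rightarrow> real" where
  "taylor_remainder v w = \<phi> w - \<phi> v - \<phi>1 v (w - v) - \<phi>2 v (w - v) (w - v) / 2"

text \<open>Maclaurin's theorem along the segment from \<open>v\<close> to \<open>w\<close>.\<close>

lemma taylor_lagrange:
  "\<exists>s. 0 \<le> s \<and> s \<le> 1 \<and>
    \<phi> w = \<phi> v + \<phi>1 v (w - v) + \<phi>2 (v + s *\<^sub>R (w - v)) (w - v) (w - v) / 2"
proof -
  define d where "d = w - v"
  define diff where "diff m s = (if m = 0 then \<phi> (v + s *\<^sub>R d) else if m = 1 then \<phi>1 (v + s *\<^sub>R d) d
     else \<phi>2 (v + s *\<^sub>R d) d d)" for m :: nat and s :: real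
  have path: "((\<lambda>s. v + s *\<^sub>R d) has_derivative (\<lambda>h. h *\<^sub>R d)) (at s)" for s
    by (auto intro!: derivative_eq_intros)
  have d0: "(diff 0 has_real_derivative diff 1 s) (at s)" for s
    using has_derivative_compose[OF path[of s] deriv1]
    by (simp add: diff_def[abs_def] has_field_derivative_def linear_scale[OF linear_deriv1] mult_commute_abs)
  have d1: "(diff 1 has_real_derivative diff 2 s) (at s)" for s
    using has_derivative_compose[OF path[of s] deriv2[of d]]
    by (simp add: diff_def[abs_def] has_field_derivative_def linear_scale[OF linear_deriv2_right] mult_commute_abs)
  have "\<exists>t>0. t < 1 \<and> diff 0 1 = (\<Sum>m<2. (diff m 0 / fact m) * 1 ^ m) + (diff 2 t / fact 2) * 1 ^ 2"
    by (rule Maclaurin) (use d0 d1 in \<open>auto simp: less_Suc_eq eval_nat_numeral\<close>)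
  then obtain t where "0 < t" "t < 1"
    "diff 0 1 = (\<Sum>m<2. (diff m 0 / fact m) * 1 ^ m) + (diff 2 t / fact 2) * 1 ^ 2"
    by auto
  then show ?thesis
    by (intro exI[of _ t]) (simp add: diff_def d_def eval_nat_numeral)
qed

text \<open>Uniform continuity of the second derivative on balls makes the Taylor remainder uniformly
  \<open>o(|w - v|\<^sup>2)\<close> there.\<close>

lemma taylor_remainder_uniform:
  assumes "0 < e"
  shows "\<exists>d>0. \<forall>v w. norm v \<le> R \<longrightarrow> norm w \<le> R \<longrightarrow> norm (w - v) < d \<longrightarrow>
    \<bar>taylor_remainder v w\<bar> \<le> e * (norm (w - v))\<^sup>2"
proof -
  define D where "D = real (DIM('a) * DIM('a))"
  have "0 < D" by (simp add: D_def)
  have "\<exists>d>0. \<forall>v\<in>cball 0 R. \<forall>w\<in>cball 0 R. dist w v < d \<longrightarrow> dist (\<phi>2 w b b') (\<phi>2 v b b') < e / D" for b b'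
  proof -
    have "uniformly_continuous_on (cball 0 R) (\<lambda>v. \<phi>2 v b b')"
      by (intro compact_uniformly_continuous continuous_on_subset[OF continuous_deriv2]) auto
    moreover have "0 < e / D" using assms \<open>0 < D\<close> by simp
    ultimately show ?thesis
      unfolding uniformly_continuous_on_def by blast
  qed
  then obtain d where d: "\<And>b b'. d b b' > 0"
    "\<And>b b' v w. v \<in> cball 0 R \<Longrightarrow> w \<in> cball 0 R \<Longrightarrow> dist w v < d b b' \<Longrightarrow>
      dist (\<phi>2 w b b') (\<phi>2 v b b') < e / D"
    by metis
  define d0 where "d0 = Min ((\<lambda>(b, b'). d b b') ` ((Basis::'a set) \<times> Basis))"
  have d0: "0 < d0" "\<And>b b'. b \<in> Basis \<Longrightarrow> b' \<in> Basis \<Longrightarrow> d0 \<le> d b b'"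
    using d(1) by (auto simp: d0_def Min_gr_iff intro!: Min_le)
  have "\<bar>taylor_remainder v w\<bar> \<le> e * (norm (w - v))\<^sup>2"
    if R: "norm v \<le> R" "norm w \<le> R" and near: "norm (w - v) < d0" for v w
  proof -
    obtain s where s: "0 \<le> s" "s \<le> 1"
      "\<phi> w = \<phi> v + \<phi>1 v (w - v) + \<phi>2 (v + s *\<^sub>R (w - v)) (w - v) (w - v) / 2"
      using taylor_lagrange by blast
    define u where "u = v + s *\<^sub>R (w - v)"
    have "u = (1 - s) *\<^sub>R v + s *\<^sub>R w" by (simp add: u_def algebra_simps)
    then have u: "u \<in> cball 0 R"
      using R s convexD[OF convex_cball, of v 0 R w "1 - s" s] by auto
    have "dist u v = s * norm (w - v)" using s by (simp add: u_def dist_norm)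
    also have "\<dots> \<le> norm (w - v)" using s by (simp add: mult_left_le_one_le)
    finally have "dist u v < d0" using near by simp
    then have close: "\<bar>\<phi>2 u b b' - \<phi>2 v b b'\<bar> \<le> e / D" if "b \<in> Basis" "b' \<in> Basis" for b b'
      using d(2)[of v u b b'] u R(1) d0(2)[OF that] by (simp add: dist_real_def)
    have "2 * taylor_remainder v w = \<phi>2 u (w - v) (w - v) - \<phi>2 v (w - v) (w - v)"
      using s(3) by (simp add: taylor_remainder_def u_def)
    also have "\<dots> = (\<Sum>b\<in>Basis. \<Sum>b'\<in>Basis. ((w - v) \<bullet> b) * ((w - v) \<bullet> b') * (\<phi>2 u b b' - \<phi>2 v b b'))"
      unfolding deriv2_basis[of u "w - v" "w - v"] deriv2_basis[of v "w - v" "w - v"]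
      by (simp only: sum_subtractf[symmetric] right_diff_distrib)
    finally have eq: "2 * taylor_remainder v w = (\<Sum>b\<in>Basis. \<Sum>b'\<in>Basis.
        ((w - v) \<bullet> b) * ((w - v) \<bullet> b') * (\<phi>2 u b b' - \<phi>2 v b b'))" .
    have "2 * \<bar>taylor_remainder v w\<bar> = \<bar>2 * taylor_remainder v w\<bar>" by simp
    also have "\<dots> \<le>
        (\<Sum>b\<in>(Basis::'a set). \<Sum>b'\<in>(Basis::'a set). \<bar>\<phi>2 u b b' - \<phi>2 v b b'\<bar>) * norm (w - v) * norm (w - v)"
      using bilinear_basis_le[of "w - v" "w - v" "\<lambda>b b'. \<phi>2 u b b' - \<phi>2 v b b'"]
      unfolding eq .
    also have "\<dots> \<le> (\<Sum>b\<in>(Basis::'a set). \<Sum>b'\<in>(Basis::'a set). e / D) * norm (w - v) * norm (w - v)"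
      by (intro mult_right_mono sum_mono close) auto
    also have "\<dots> = e * (norm (w - v))\<^sup>2"
      by (simp add: D_def power2_eq_square)
    finally show ?thesis using abs_ge_zero[of "taylor_remainder v w"] by linarith
  qed
  then show ?thesis using d0(1) by blast
qed

end

section \<open>Left-point sums\<close>

lemma set_integral_combine:
  fixes g :: "real \<Rightarrow> 'b::euclidean_space"
  assumes "a \<le> b" "b \<le> c" "set_integrable lborel {a..c} g"
  shows "(LINT u:{a..c}|lborel. g u) = (LINT u:{a..b}|lborel. g u) + (LINT u:{b..c}|lborel. g u)"
proof -
  have i: "set_integrable lborel {a..b} g" "set_integrable lborel {b..c} g"
    using assms by (auto intro: set_integrable_subset)
  show ?thesis
    using Henstock_Kurzweil_Integration.integral_combine[OF assms(1,2)
        set_borel_integral_eq_integral(1)[OF assms(3)]]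
    by (simp add: set_borel_integral_eq_integral(2) i assms(3))
qed

lemma steps_mono:
  fixes t :: "nat \<Rightarrow> real"
  assumes "\<And>i. i < n \<Longrightarrow> t i \<le> t (Suc i)" "i \<le> j" "j \<le> n"
  shows "t i \<le> t j"
  using assms(2,3)
proof (induction j rule: dec_induct)
  case (step j)
  then show ?case using assms(1)[of j] by simp
qed simp

lemma set_integral_combine_sum:
  fixes g :: "real \<Rightarrow> 'b::euclidean_space"
  assumes "\<And>i. i < n \<Longrightarrow> t i \<le> t (Suc i)" "set_integrable lborel {t 0..t n} g"
  shows "(\<Sum>i<n. LINT u:{t i..t (Suc i)}|lborel. g u) = (LINT u:{t 0..t n}|lborel. g u)"
  using assms
proof (induction n)
  case 0
  have "(LINT u:{t 0..t 0}|lborel. g u) = 0"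
    using set_borel_integral_eq_integral(2)[OF 0(2)] by simp
  then show ?case by (subst lessThan_0, subst sum.empty) (rule sym)
next
  case (Suc n)
  have "t 0 \<le> t n"
    by (rule steps_mono[of "Suc n" t, OF Suc.prems(1)]) simp_all
  then show ?case
  proof -
    have "set_integrable lborel {t 0..t n} g"
      by (rule set_integrable_subset[OF Suc.prems(2)]) (use Suc.prems(1)[of n] in auto)
    then show ?thesis
      using Suc set_integral_combine[of "t 0" "t n" "t (Suc n)" g] \<open>t 0 \<le> t n\<close> by simp
  qed
qed

text \<open>The times \<open>i / (n + 1)\<close>, stopped at \<open>T\<close>.  The underlying times do not depend on \<open>T\<close>, since
  one sequence of simple processes has to serve all horizons; \<open>(n + 1)\<^sup>2\<close> cells reach up to time
  \<open>n + 1\<close>, and therefore exhaust \<open>[0, T]\<close> as soon as \<open>T \<le> n + 1\<close>.\<close>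

definition grid :: "real \<Rightarrow> nat \<Rightarrow> nat \<Rightarrow> real" where
  "grid T n i = min T (real i / real (Suc n))"

abbreviation grid_size :: "nat \<Rightarrow> nat" where "grid_size n \<equiv> (Suc n)\<^sup>2"

lemma grid_0: "0 \<le> T \<Longrightarrow> grid T n 0 = 0"
  by (simp add: grid_def)

lemma grid_nonneg: "0 \<le> T \<Longrightarrow> 0 \<le> grid T n i"
  by (simp add: grid_def)

lemma grid_le: "grid T n i \<le> T"
  by (simp add: grid_def)

lemma grid_mono: "i \<le> j \<Longrightarrow> grid T n i \<le> grid T n j"
proof -
  assume "i \<le> j"
  then have "real i / real (Suc n) \<le> real j / real (Suc n)" by (intro divide_right_mono) auto
  then show ?thesis unfolding grid_def by linarith
qed

lemma grid_end:
  assumes "T \<le> real (Suc n)"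
  shows "grid T n (grid_size n) = T"
proof -
  have "real (grid_size n) / real (Suc n) = real (Suc n)"
    by (simp only: power2_eq_square of_nat_mult) simp
  then show ?thesis using assms unfolding grid_def by linarith
qed

lemma grid_mesh: "grid T n (Suc i) - grid T n i \<le> 1 / real (Suc n)"
proof -
  have "real (Suc i) / real (Suc n) = real i / real (Suc n) + 1 / real (Suc n)"
    by (simp add: add_divide_distrib[symmetric] add.commute)
  moreover have "0 \<le> 1 / real (Suc n)" by simp
  ultimately show ?thesis unfolding grid_def min_def by argo
qed

lemma sum_grid_le: "0 \<le> T \<Longrightarrow> (\<Sum>i<m. grid T n (Suc i) - grid T n i) \<le> T"
  using grid_le[of T n m] grid_0[of T n] by (simp add: sum_lessThan_telescope)

text \<open>The integrand is a function of the left end point and of the running time, which covers both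
  Riemann sums and sums such as \<open>\<Sum>c(t\<^sub>i) \<integral>b\<close>.\<close>

lemma left_point_sums_converge:
  fixes G :: "real \<Rightarrow> real \<Rightarrow> real"
  assumes T: "0 \<le> T" and G: "continuous_on ({0..T} \<times> {0..T}) (\<lambda>(s, u). G s u)"
  shows "(\<lambda>n. (\<Sum>i<grid_size n. LINT u:{grid T n i..grid T n (Suc i)}|lborel. G (grid T n i) u)
      - (LINT u:{0..T}|lborel. G u u)) \<longlonglongrightarrow> 0"
proof (rule LIMSEQ_I)
  fix e :: real assume "0 < e"
  define e' where "e' = e / (T + 1)"
  have "0 < e'" using \<open>0 < e\<close> T by (simp add: e'_def)
  obtain d where d: "0 < d" "\<And>p q. p \<in> {0..T} \<times> {0..T} \<Longrightarrow> q \<in> {0..T} \<times> {0..T} \<Longrightarrow> dist p q < d \<Longrightarrow>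
      dist ((\<lambda>(s, u). G s u) p) ((\<lambda>(s, u). G s u) q) < e'"
    using compact_uniformly_continuous[OF G] \<open>0 < e'\<close>
    unfolding uniformly_continuous_on_def by (metis compact_Icc compact_Times)
  have contG: "continuous_on {a..b} (G s)" if "s \<in> {0..T}" "{a..b} \<subseteq> {0..T}" for s a b
    using that by (intro continuous_on_compose2[OF G, of _ "\<lambda>u. (s, u)", simplified] continuous_intros) auto
  have contD: "continuous_on {0..T} (\<lambda>u. G u u)"
    by (intro continuous_on_compose2[OF G, of _ "\<lambda>u. (u, u)", simplified] continuous_intros) auto
  obtain n0 where n0: "max T (1 / d) < real n0" using reals_Archimedean2 by blast
  have "\<bar>(\<Sum>i<grid_size n. LINT u:{grid T n i..grid T n (Suc i)}|lborel. G (grid T n i) u)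
      - (LINT u:{0..T}|lborel. G u u)\<bar> < e" if "n \<ge> n0" for n
  proof -
    let ?t = "grid T n"
    have n: "T \<le> real (Suc n)" "1 / d < real (Suc n)" using n0 that by auto
    have mesh: "1 / real (Suc n) < d" using n(2) d(1) by (simp add: field_simps)
    have sub: "{?t i..?t (Suc i)} \<subseteq> {0..T}" "?t i \<in> {0..T}" "?t i \<le> ?t (Suc i)" for i
      using grid_nonneg[OF T, of n i] grid_le[of T n] by (auto intro: grid_mono order_trans)
    have int1: "set_integrable lborel {?t i..?t (Suc i)} (G (?t i))" for i
      by (intro borel_integrable_atLeastAtMost' contG sub)
    have int2: "set_integrable lborel {?t i..?t (Suc i)} (\<lambda>u. G u u)" for i
      by (intro borel_integrable_atLeastAtMost' continuous_on_subset[OF contD] sub)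
    have "(LINT u:{0..T}|lborel. G u u) = (\<Sum>i<grid_size n. LINT u:{?t i..?t (Suc i)}|lborel. G u u)"
      using set_integral_combine_sum[of "grid_size n" ?t "\<lambda>u. G u u"] sub(3)
        borel_integrable_atLeastAtMost'[OF contD]
      by (simp add: grid_0[OF T] grid_end[OF n(1)])
    then have "\<bar>(\<Sum>i<grid_size n. LINT u:{?t i..?t (Suc i)}|lborel. G (?t i) u) - (LINT u:{0..T}|lborel. G u u)\<bar>
       = \<bar>\<Sum>i<grid_size n. LINT u:{?t i..?t (Suc i)}|lborel. G (?t i) u - G u u\<bar>"
      by (simp add: sum_subtractf[symmetric] set_integral_diff[OF int1 int2])
    also have "\<dots> \<le> (\<Sum>i<grid_size n. \<bar>LINT u:{?t i..?t (Suc i)}|lborel. G (?t i) u - G u u\<bar>)"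
      by (rule sum_abs)
    also have "\<dots> \<le> (\<Sum>i<grid_size n. e' * (?t (Suc i) - ?t i))"
    proof (rule sum_mono)
      fix i
      have i: "set_integrable lborel {?t i..?t (Suc i)} (\<lambda>u. G (?t i) u - G u u)"
        by (intro set_integral_diff int1 int2)
      have "\<bar>G (?t i) u - G u u\<bar> \<le> e'" if "u \<in> {?t i..?t (Suc i)}" for u
      proof -
        have "dist (?t i, u) (u, u) < d"
          using that grid_mesh[of T n i] mesh by (simp add: dist_Pair_Pair dist_real_def)
        then show ?thesis
          using d(2)[of "(?t i, u)" "(u, u)"] that sub(1)[of i] sub(2)[of i] by (auto simp: dist_real_def)
      qed
      then have "norm (LINT u:{?t i..?t (Suc i)}|lborel. G (?t i) u - G u u)
          \<le> (LINT u:{?t i..?t (Suc i)}|lborel. e')"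
        by (intro order_trans[OF set_integral_norm_bound[OF i]] set_integral_mono set_integrable_norm[OF i])
           (auto intro!: borel_integrable_atLeastAtMost' continuous_intros)
      then show "\<bar>LINT u:{?t i..?t (Suc i)}|lborel. G (?t i) u - G u u\<bar> \<le> e' * (?t (Suc i) - ?t i)"
        using sub(3)[of i] by (simp add: set_lebesgue_integral_def mult.commute)
    qed
    also have "\<dots> \<le> e' * T"
      using sum_grid_le[OF T, of n "grid_size n"] \<open>0 < e'\<close> by (simp add: sum_distrib_left[symmetric])
    also have "\<dots> < e"
      using T \<open>0 < e\<close> by (simp add: e'_def field_simps)
    finally show ?thesis .
  qed
  then show "\<exists>n0. \<forall>n\<ge>n0. norm ((\<Sum>i<grid_size n. LINT u:{grid T n i..grid T n (Suc i)}|lborel. G (grid T n i) u)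
      - (LINT u:{0..T}|lborel. G u u) - 0) < e"
    by auto
qed

section \<open>Smallness in probability\<close>

text \<open>The set where \<open>P\<close> fails need not be measurable, so that pathwise estimates can be chained
  without measurability side conditions.\<close>

definition mostly :: "'w measure \<Rightarrow> real \<Rightarrow> ('w \<Rightarrow> bool) \<Rightarrow> bool" where
  "mostly M d P \<longleftrightarrow> (\<exists>A\<in>sets M. measure M A \<le> d \<and> (\<forall>\<omega>\<in>space M - A. P \<omega>))"

definition small_in_prob :: "'w measure \<Rightarrow> (nat \<Rightarrow> 'w \<Rightarrow> real) \<Rightarrow> bool" where
  "small_in_prob M X \<longleftrightarrow> (\<forall>e>0. \<forall>d>0. \<forall>\<^sub>F n in sequentially. mostly M d (\<lambda>\<omega>. \<bar>X n \<omega>\<bar> \<le> e))"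

definition bounded_in_prob :: "'w measure \<Rightarrow> (nat \<Rightarrow> 'w \<Rightarrow> real) \<Rightarrow> bool" where
  "bounded_in_prob M X \<longleftrightarrow> (\<forall>d>0. \<exists>C. \<forall>\<^sub>F n in sequentially. mostly M d (\<lambda>\<omega>. \<bar>X n \<omega>\<bar> \<le> C))"

lemma small_in_probI:
  "(\<And>e d. 0 < e \<Longrightarrow> 0 < d \<Longrightarrow> \<forall>\<^sub>F n in sequentially. mostly M d (\<lambda>\<omega>. \<bar>X n \<omega>\<bar> \<le> e)) \<Longrightarrow> small_in_prob M X"
  unfolding small_in_prob_def by blast

lemma small_in_probD:
  "small_in_prob M X \<Longrightarrow> 0 < e \<Longrightarrow> 0 < d \<Longrightarrow> \<forall>\<^sub>F n in sequentially. mostly M d (\<lambda>\<omega>. \<bar>X n \<omega>\<bar> \<le> e)"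
  unfolding small_in_prob_def by blast

lemma bounded_in_probI:
  "(\<And>d. 0 < d \<Longrightarrow> \<exists>C. \<forall>\<^sub>F n in sequentially. mostly M d (\<lambda>\<omega>. \<bar>X n \<omega>\<bar> \<le> C)) \<Longrightarrow> bounded_in_prob M X"
  unfolding bounded_in_prob_def by blast

lemma bounded_in_probD:
  "bounded_in_prob M X \<Longrightarrow> 0 < d \<Longrightarrow> \<exists>C. \<forall>\<^sub>F n in sequentially. mostly M d (\<lambda>\<omega>. \<bar>X n \<omega>\<bar> \<le> C)"
  unfolding bounded_in_prob_def by blast

lemma mostlyI: "A \<in> sets M \<Longrightarrow> measure M A \<le> d \<Longrightarrow> (\<And>\<omega>. \<omega> \<in> space M \<Longrightarrow> \<omega> \<notin> A \<Longrightarrow> P \<omega>) \<Longrightarrow> mostly M d P"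
  unfolding mostly_def by (intro bexI[of _ A]) auto

lemma mostly_mono:
  "mostly M a P \<Longrightarrow> a \<le> b \<Longrightarrow> (\<And>\<omega>. \<omega> \<in> space M \<Longrightarrow> P \<omega> \<Longrightarrow> Q \<omega>) \<Longrightarrow> mostly M b Q"
  unfolding mostly_def by (meson DiffD1 order_trans)

lemma mostly_conj:
  assumes "mostly M a P" "mostly M b Q"
  shows "mostly M (a + b) (\<lambda>\<omega>. P \<omega> \<and> Q \<omega>)"
proof -
  obtain A where A: "A \<in> sets M" "measure M A \<le> a" "\<forall>\<omega>\<in>space M - A. P \<omega>"
    using assms(1) unfolding mostly_def by blast
  obtain B where B: "B \<in> sets M" "measure M B \<le> b" "\<forall>\<omega>\<in>space M - B. Q \<omega>"
    using assms(2) unfolding mostly_def by blast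
  show ?thesis
    using A B measure_Un_le[OF A(1) B(1)] by (intro mostlyI[of "A \<union> B"]) auto
qed

lemma mostly_halves:
  assumes "mostly M (d / 2) P" "mostly M (d / 2) Q" "\<And>\<omega>. \<omega> \<in> space M \<Longrightarrow> P \<omega> \<Longrightarrow> Q \<omega> \<Longrightarrow> R \<omega>"
  shows "mostly M d R"
  by (rule mostly_mono[OF mostly_conj[OF assms(1,2)]]) (use assms(3) in auto)

lemma mostly_AE:
  assumes "AE \<omega> in M. P \<omega>"
  shows "mostly M 0 P"
proof -
  obtain N where "{\<omega> \<in> space M. \<not> P \<omega>} \<subseteq> N" "emeasure M N = 0" "N \<in> sets M"
    using assms by (rule AE_E)
  then show ?thesis by (intro mostlyI[of N]) (auto simp: measure_def)
qed

lemma small_in_prob_mono: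
  assumes X: "small_in_prob M X" and le: "\<forall>\<^sub>F n in sequentially. AE \<omega> in M. \<bar>Y n \<omega>\<bar> \<le> \<bar>X n \<omega>\<bar>"
  shows "small_in_prob M Y"
proof (rule small_in_probI)
  fix e d :: real assume "0 < e" "0 < d"
  from small_in_probD[OF X this] le
  show "\<forall>\<^sub>F n in sequentially. mostly M d (\<lambda>\<omega>. \<bar>Y n \<omega>\<bar> \<le> e)"
  proof eventually_elim
    case (elim n)
    show ?case by (rule mostly_mono[OF mostly_conj[OF elim(1) mostly_AE[OF elim(2)]]]) auto
  qed
qed

lemma small_in_prob_mono_pointwise:
  assumes "small_in_prob M X" "\<And>n \<omega>. \<bar>Y n \<omega>\<bar> \<le> X n \<omega>"
  shows "small_in_prob M Y"
  by (rule small_in_prob_mono[OF assms(1)])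
    (intro always_eventually allI AE_I2 order_trans[OF assms(2) abs_ge_self])

lemma small_in_prob_add:
  assumes "small_in_prob M X" "small_in_prob M Y"
  shows "small_in_prob M (\<lambda>n \<omega>. X n \<omega> + Y n \<omega>)"
proof (rule small_in_probI)
  fix e d :: real assume "0 < e" "0 < d"
  then have "0 < e / 2" "0 < d / 2" by auto
  from small_in_probD[OF assms(1) this] small_in_probD[OF assms(2) this]
  show "\<forall>\<^sub>F n in sequentially. mostly M d (\<lambda>\<omega>. \<bar>X n \<omega> + Y n \<omega>\<bar> \<le> e)"
    by eventually_elim (erule (1) mostly_halves, linarith)
qed

lemma small_in_prob_mult:
  assumes "small_in_prob M X" "bounded_in_prob M Y"
  shows "small_in_prob M (\<lambda>n \<omega>. X n \<omega> * Y n \<omega>)"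
proof (rule small_in_probI)
  fix e d :: real assume "0 < e" "0 < d"
  then have d2: "0 < d / 2" by auto
  from bounded_in_probD[OF assms(2) this]
  obtain C where C: "\<forall>\<^sub>F n in sequentially. mostly M (d / 2) (\<lambda>\<omega>. \<bar>Y n \<omega>\<bar> \<le> C)" by blast
  define C' where "C' = max C 1"
  have C': "0 < C'" "C \<le> C'" by (auto simp: C'_def)
  then have "0 < e / C'" using \<open>0 < e\<close> by auto
  from small_in_probD[OF assms(1) this d2] C
  show "\<forall>\<^sub>F n in sequentially. mostly M d (\<lambda>\<omega>. \<bar>X n \<omega> * Y n \<omega>\<bar> \<le> e)"
  proof eventually_elim
    case (elim n)
    then show ?case
    proof (rule mostly_halves)
      fix \<omega> assume "\<bar>X n \<omega>\<bar> \<le> e / C'" "\<bar>Y n \<omega>\<bar> \<le> C"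
      then have "\<bar>X n \<omega>\<bar> * \<bar>Y n \<omega>\<bar> \<le> e / C' * C'"
        using C' \<open>0 < e / C'\<close> by (intro mult_mono) auto
      then show "\<bar>X n \<omega> * Y n \<omega>\<bar> \<le> e" using C'(1) by (simp add: abs_mult)
    qed
  qed
qed

lemma bounded_in_prob_add:
  assumes "bounded_in_prob M X" "bounded_in_prob M Y"
  shows "bounded_in_prob M (\<lambda>n \<omega>. X n \<omega> + Y n \<omega>)"
proof (rule bounded_in_probI)
  fix d :: real assume "0 < d"
  then have "0 < d / 2" by auto
  from bounded_in_probD[OF assms(1) this] bounded_in_probD[OF assms(2) this]
  obtain C C' where "\<forall>\<^sub>F n in sequentially. mostly M (d / 2) (\<lambda>\<omega>. \<bar>X n \<omega>\<bar> \<le> C)"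
    "\<forall>\<^sub>F n in sequentially. mostly M (d / 2) (\<lambda>\<omega>. \<bar>Y n \<omega>\<bar> \<le> C')" by blast
  then have "\<forall>\<^sub>F n in sequentially. mostly M d (\<lambda>\<omega>. \<bar>X n \<omega> + Y n \<omega>\<bar> \<le> C + C')"
    by eventually_elim (erule (1) mostly_halves, linarith)
  then show "\<exists>C. \<forall>\<^sub>F n in sequentially. mostly M d (\<lambda>\<omega>. \<bar>X n \<omega> + Y n \<omega>\<bar> \<le> C)" by blast
qed

lemma small_imp_bounded_in_prob: "small_in_prob M X \<Longrightarrow> bounded_in_prob M X"
  by (rule bounded_in_probI, rule exI[of _ 1]) (rule small_in_probD[OF _ zero_less_one])

lemma bounded_in_prob_mono:
  assumes "bounded_in_prob M X" and "\<And>n \<omega>. \<bar>Y n \<omega>\<bar> \<le> X n \<omega>"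
  shows "bounded_in_prob M Y"
proof (rule bounded_in_probI)
  fix d :: real assume "0 < d"
  from bounded_in_probD[OF assms(1) this]
  obtain C where "\<forall>\<^sub>F n in sequentially. mostly M d (\<lambda>\<omega>. \<bar>X n \<omega>\<bar> \<le> C)" by blast
  then have "\<forall>\<^sub>F n in sequentially. mostly M d (\<lambda>\<omega>. \<bar>Y n \<omega>\<bar> \<le> C)"
    by eventually_elim
      (erule mostly_mono, simp, erule order_trans[OF order_trans[OF assms(2) abs_ge_self]])
  then show "\<exists>C. \<forall>\<^sub>F n in sequentially. mostly M d (\<lambda>\<omega>. \<bar>Y n \<omega>\<bar> \<le> C)" by blast
qed

lemma small_in_prob_cmult: "small_in_prob M X \<Longrightarrow> small_in_prob M (\<lambda>n \<omega>. X n \<omega> * c)"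
  by (rule small_in_prob_mult)
    (auto intro!: bounded_in_probI exI[of _ "\<bar>c\<bar>"] always_eventually mostlyI[of "{}"])

lemma small_in_prob_sum:
  assumes "\<And>i. i \<in> I \<Longrightarrow> small_in_prob M (X i)"
  shows "small_in_prob M (\<lambda>n \<omega>. \<Sum>i\<in>I. X i n \<omega>)"
proof -
  have "small_in_prob M (\<lambda>n \<omega>. 0)"
    by (auto intro!: small_in_probI always_eventually mostlyI[of "{}"])
  then show ?thesis
    using assms by (induction I rule: infinite_finite_induct) (auto intro: small_in_prob_add)
qed

lemma small_in_prob_sqrt:
  assumes "small_in_prob M (\<lambda>n \<omega>. (X n \<omega>)\<^sup>2)"
  shows "small_in_prob M X"
proof (rule small_in_probI)
  fix e d :: real assume "0 < e" "0 < d"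
  then have "0 < e\<^sup>2" by simp
  from small_in_probD[OF assms this \<open>0 < d\<close>]
  show "\<forall>\<^sub>F n in sequentially. mostly M d (\<lambda>\<omega>. \<bar>X n \<omega>\<bar> \<le> e)"
    by eventually_elim (use \<open>0 < e\<close> in \<open>simp add: abs_le_square_iff[symmetric]\<close>)
qed

text \<open>This is what permits localisation: unbounded coefficients may be treated as bounded ones, at the
  price of an event whose probability is as small as desired.\<close>

lemma small_in_prob_localize:
  assumes "\<And>d. 0 < d \<Longrightarrow> \<exists>X. small_in_prob M X \<and>
     (\<forall>\<^sub>F n in sequentially. mostly M d (\<lambda>\<omega>. \<bar>Y n \<omega>\<bar> \<le> \<bar>X n \<omega>\<bar>))"
  shows "small_in_prob M Y"
proof (rule small_in_probI)
  fix e d :: real assume "0 < e" "0 < d"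
  then have d2: "0 < d / 2" by auto
  from assms[OF this] obtain X where X: "small_in_prob M X"
    and le: "\<forall>\<^sub>F n in sequentially. mostly M (d / 2) (\<lambda>\<omega>. \<bar>Y n \<omega>\<bar> \<le> \<bar>X n \<omega>\<bar>)" by blast
  from small_in_probD[OF X \<open>0 < e\<close> d2] le
  show "\<forall>\<^sub>F n in sequentially. mostly M d (\<lambda>\<omega>. \<bar>Y n \<omega>\<bar> \<le> e)"
    by eventually_elim (erule (1) mostly_halves, linarith)
qed

context prob_space
begin

text \<open>The events that the bound \<open>e\<close> fails at some stage after \<open>n\<close> decrease to a null set.\<close>

lemma AE_uniform_imp_small:
  fixes X :: "nat \<Rightarrow> 'i::countable \<Rightarrow> 'a \<Rightarrow> real"
  assumes [measurable]: "\<And>n i. X n i \<in> borel_measurable M"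
    and ae: "AE \<omega> in M. \<forall>e>0. \<forall>\<^sub>F n in sequentially. \<forall>i. \<bar>X n i \<omega>\<bar> \<le> e"
    and "0 < e" "0 < d"
  shows "\<forall>\<^sub>F n in sequentially. mostly M d (\<lambda>\<omega>. \<forall>i. \<bar>X n i \<omega>\<bar> \<le> e)"
proof -
  define B where "B n = {\<omega>\<in>space M. \<exists>m\<in>{n..}. \<exists>i. e < \<bar>X m i \<omega>\<bar>}" for n
  have [measurable]: "B n \<in> sets M" for n
    unfolding B_def by measurable
  have "(\<lambda>n. measure M (B n)) \<longlonglongrightarrow> measure M (\<Inter>n. B n)"
    by (rule finite_Lim_measure_decseq) (auto simp: decseq_def B_def)
  moreover have "AE \<omega> in M. \<omega> \<notin> (\<Inter>n. B n)"
    using ae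
  proof eventually_elim
    case (elim \<omega>)
    then obtain n where bound: "\<And>m i. n \<le> m \<Longrightarrow> \<bar>X m i \<omega>\<bar> \<le> e"
      using \<open>0 < e\<close> unfolding eventually_sequentially by blast
    have "\<omega> \<notin> B n"
    proof
      assume "\<omega> \<in> B n"
      then obtain m i where "n \<le> m" "e < \<bar>X m i \<omega>\<bar>" by (auto simp: B_def)
      then show False using bound[of m i] by simp
    qed
    then show ?case by blast
  qed
  then have "measure M (\<Inter>n. B n) = 0"
    by (simp add: measure_eq_0_null_sets AE_iff_null_sets)
  ultimately have "\<forall>\<^sub>F n in sequentially. measure M (B n) < d"
    using \<open>0 < d\<close> order_tendstoD(2)[of "\<lambda>n. measure M (B n)" 0 sequentially d] by simp
  then show ?thesis
  proof eventually_elim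
    case (elim n)
    then show ?case by (intro mostlyI[of "B n"]) (auto simp: B_def not_less)
  qed
qed

lemma AE_tendsto_imp_small_in_prob:
  fixes X :: "nat \<Rightarrow> 'a \<Rightarrow> real"
  assumes "\<And>n. X n \<in> borel_measurable M" and ae: "AE \<omega> in M. (\<lambda>n. X n \<omega>) \<longlonglongrightarrow> 0"
  shows "small_in_prob M X"
proof -
  have "AE \<omega> in M. \<forall>e>0. \<forall>\<^sub>F n in sequentially. \<forall>i::unit. \<bar>X n \<omega>\<bar> \<le> e"
    using ae
  proof eventually_elim
    case (elim \<omega>)
    show ?case
    proof (intro allI impI)
      fix e :: real assume "0 < e"
      from tendstoD[OF elim this] show "\<forall>\<^sub>F n in sequentially. \<forall>i::unit. \<bar>X n \<omega>\<bar> \<le> e"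
        by eventually_elim (simp add: dist_real_def)
    qed
  qed
  from AE_uniform_imp_small[of "\<lambda>n i. X n", OF _ this] assms(1) show ?thesis
    by (intro small_in_probI) auto
qed

text \<open>Dividing an almost surely bounded family by \<open>n\<close> gives something that tends to zero uniformly, so
  this is a consequence of the previous lemma.\<close>

lemma AE_bounded_imp_uniformly_bounded:
  fixes X :: "'i::countable \<Rightarrow> 'a \<Rightarrow> real"
  assumes [measurable]: "\<And>i. X i \<in> borel_measurable M"
    and ae: "AE \<omega> in M. \<exists>C. \<forall>i. \<bar>X i \<omega>\<bar> \<le> C" and "0 < d"
  shows "\<exists>C>0. mostly M d (\<lambda>\<omega>. \<forall>i. \<bar>X i \<omega>\<bar> \<le> C)"
proof -
  have "AE \<omega> in M. \<forall>e>0. \<forall>\<^sub>F n in sequentially. \<forall>i. \<bar>X i \<omega> / real (Suc n)\<bar> \<le> e"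
    using ae
  proof eventually_elim
    case (elim \<omega>)
    then obtain C where C: "\<And>i. \<bar>X i \<omega>\<bar> \<le> C" by blast
    show ?case
    proof (intro allI impI)
      fix e :: real assume "0 < e"
      obtain m where m: "C / e < real m" using reals_Archimedean2 by blast
      have "\<bar>X i \<omega> / real (Suc n)\<bar> \<le> e" if "m \<le> n" for i n
      proof -
        have "C < e * real m" using m \<open>0 < e\<close> by (simp add: field_simps)
        also have "\<dots> \<le> e * real (Suc n)" using that \<open>0 < e\<close> by simp
        finally have "\<bar>X i \<omega>\<bar> \<le> e * real (Suc n)" using C[of i] by simp
        then show ?thesis by (simp add: abs_divide divide_le_eq del: of_nat_Suc)
      qed
      then show "\<forall>\<^sub>F n in sequentially. \<forall>i. \<bar>X i \<omega> / real (Suc n)\<bar> \<le> e"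
        unfolding eventually_sequentially by blast
    qed
  qed
  then have "\<forall>\<^sub>F n in sequentially. mostly M d (\<lambda>\<omega>. \<forall>i. \<bar>X i \<omega> / real (Suc n)\<bar> \<le> 1)"
    using \<open>0 < d\<close> by (intro AE_uniform_imp_small) auto
  from eventually_happens'[OF sequentially_bot this]
  obtain n where "mostly M d (\<lambda>\<omega>. \<forall>i. \<bar>X i \<omega> / real (Suc n)\<bar> \<le> 1)" by blast
  then have "mostly M d (\<lambda>\<omega>. \<forall>i. \<bar>X i \<omega>\<bar> \<le> real (Suc n))"
    by (rule mostly_mono) (auto simp: abs_divide divide_le_eq simp del: of_nat_Suc)
  then show ?thesis by (intro exI[of _ "real (Suc n)"]) simp
qed

lemma mostly_markov:
  assumes "integrable M X" "\<And>\<omega>. \<omega> \<in> space M \<Longrightarrow> 0 \<le> X \<omega>" "expectation X \<le> c * d" "0 < c"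
  shows "mostly M d (\<lambda>\<omega>. X \<omega> \<le> (c :: real))"
proof -
  have [measurable]: "X \<in> borel_measurable M" using assms(1) by auto
  have "measure M {\<omega>\<in>space M. c \<le> X \<omega>} \<le> expectation X / c"
    by (rule integral_Markov_inequality_measure[OF assms(1), of "{}"]) (use assms in auto)
  also have "\<dots> \<le> d" using assms(3,4) by (simp add: field_simps)
  finally show ?thesis by (intro mostlyI[of "{\<omega>\<in>space M. c \<le> X \<omega>}"]) auto
qed

lemma small_in_prob_second_moment:
  assumes "\<And>n. integrable M (\<lambda>\<omega>. (X n \<omega>)\<^sup>2)" "\<And>n. expectation (\<lambda>\<omega>. (X n \<omega>)\<^sup>2) \<le> c n" "c \<longlonglongrightarrow> 0"
  shows "small_in_prob M X"
proof (rule small_in_prob_sqrt, rule small_in_probI)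
  fix e d :: real assume "0 < e" "0 < d"
  then have "0 < e * d" by simp
  have "\<forall>\<^sub>F n in sequentially. c n < e * d"
    using assms(3) \<open>0 < e * d\<close> by (rule order_tendstoD)
  then show "\<forall>\<^sub>F n in sequentially. mostly M d (\<lambda>\<omega>. \<bar>(X n \<omega>)\<^sup>2\<bar> \<le> e)"
  proof eventually_elim
    case (elim n)
    then have "expectation (\<lambda>\<omega>. (X n \<omega>)\<^sup>2) \<le> e * d" using assms(2)[of n] by simp
    from mostly_markov[OF assms(1)[of n] _ this \<open>0 < e\<close>] show ?case by simp
  qed
qed

lemma bounded_in_prob_first_moment:
  assumes "\<And>n. integrable M (X n)" "\<And>n \<omega>. \<omega> \<in> space M \<Longrightarrow> 0 \<le> X n \<omega>" "\<And>n. expectation (X n) \<le> c"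
  shows "bounded_in_prob M X"
proof (rule bounded_in_probI)
  fix d :: real assume "0 < d"
  have "0 \<le> c"
    by (rule order_trans[OF integral_nonneg_AE assms(3)[of 0]]) (use assms(2) in auto)
  define C where "C = (c + 1) / d"
  have C: "0 < C" "c \<le> C * d" using \<open>0 < d\<close> \<open>0 \<le> c\<close> by (auto simp: C_def)
  have "mostly M d (\<lambda>\<omega>. \<bar>X n \<omega>\<bar> \<le> C)" for n
    by (rule mostly_mono[OF mostly_markov[OF assms(1,2) order_trans[OF assms(3) C(2)] C(1)]])
      (use assms(2) in auto)
  then show "\<exists>C. \<forall>\<^sub>F n in sequentially. mostly M d (\<lambda>\<omega>. \<bar>X n \<omega>\<bar> \<le> C)"
    by (intro exI[of _ C] always_eventually) blast
qed

lemma small_in_prob_iff_measure_tendsto: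
  assumes "\<And>n. X n \<in> borel_measurable M"
  shows "small_in_prob M X \<longleftrightarrow> (\<forall>e>0. (\<lambda>n. measure M {\<omega>\<in>space M. e < \<bar>X n \<omega>\<bar>}) \<longlonglongrightarrow> 0)"
proof safe
  fix e :: real assume X: "small_in_prob M X" and "0 < e"
  show "(\<lambda>n. measure M {\<omega>\<in>space M. e < \<bar>X n \<omega>\<bar>}) \<longlonglongrightarrow> 0"
  proof (rule tendstoI)
    fix d :: real assume "0 < d"
    then have "0 < d / 2" by simp
    from small_in_probD[OF X \<open>0 < e\<close> this]
    show "\<forall>\<^sub>F n in sequentially. dist (measure M {\<omega>\<in>space M. e < \<bar>X n \<omega>\<bar>}) 0 < d"
    proof eventually_elim
      case (elim n)
      then obtain A where A: "A \<in> sets M" "measure M A \<le> d / 2" "\<forall>\<omega>\<in>space M - A. \<bar>X n \<omega>\<bar> \<le> e"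
        unfolding mostly_def by blast
      have "measure M {\<omega>\<in>space M. e < \<bar>X n \<omega>\<bar>} \<le> measure M A"
        using A(1,3) by (intro finite_measure_mono) (auto simp: not_le[symmetric])
      then show ?case using A(2) \<open>0 < d\<close> by (simp add: dist_real_def)
    qed
  qed
next
  assume lim: "\<forall>e>0. (\<lambda>n. measure M {\<omega>\<in>space M. e < \<bar>X n \<omega>\<bar>}) \<longlonglongrightarrow> 0"
  show "small_in_prob M X"
  proof (rule small_in_probI)
    fix e d :: real assume "0 < e" "0 < d"
    have "\<forall>\<^sub>F n in sequentially. measure M {\<omega>\<in>space M. e < \<bar>X n \<omega>\<bar>} < d"
      using lim \<open>0 < e\<close> \<open>0 < d\<close> by (intro order_tendstoD) auto
    then show "\<forall>\<^sub>F n in sequentially. mostly M d (\<lambda>\<omega>. \<bar>X n \<omega>\<bar> \<le> e)"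
    proof eventually_elim
      case (elim n)
      have "{\<omega>\<in>space M. e < \<bar>X n \<omega>\<bar>} \<in> sets M" using assms by measurable
      then show ?case using elim by (intro mostlyI[of "{\<omega>\<in>space M. e < \<bar>X n \<omega>\<bar>}"]) auto
    qed
  qed
qed

lemma conv_in_prob_iff_small_in_prob:
  assumes Y: "\<And>r. Y r \<in> borel_measurable M" and L: "L \<in> borel_measurable M"
  shows "conv_in_prob M Y L \<longleftrightarrow> small_in_prob M (\<lambda>r \<omega>. norm (Y r \<omega> - L \<omega>))"
proof -
  have "(\<lambda>\<omega>. norm (Y r \<omega> - L \<omega>)) \<in> borel_measurable M" for r
    using Y L by measurable
  from small_in_prob_iff_measure_tendsto[OF this]
  show ?thesis
    unfolding conv_in_prob_def using Y L by auto
qed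

lemma conv_in_prob_imp_small_in_prob:
  assumes "conv_in_prob M Y L"
  shows "small_in_prob M (\<lambda>r \<omega>. norm (Y r \<omega> - L \<omega>))"
proof -
  have "Y r \<in> borel_measurable M" "L \<in> borel_measurable M" for r
    using assms by (auto simp: conv_in_prob_def)
  from conv_in_prob_iff_small_in_prob[OF this] show ?thesis using assms by simp
qed

end

section \<open>Sums of orthogonal increments\<close>

lemma (in prob_space) integrable_mult_of_squares:
  fixes X Y :: "'a \<Rightarrow> real"
  assumes [measurable]: "X \<in> borel_measurable M" "Y \<in> borel_measurable M"
    and "integrable M (\<lambda>\<omega>. (X \<omega>)\<^sup>2)" "integrable M (\<lambda>\<omega>. (Y \<omega>)\<^sup>2)"
  shows "integrable M (\<lambda>\<omega>. X \<omega> * Y \<omega>)"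
proof (rule Bochner_Integration.integrable_bound)
  show "integrable M (\<lambda>\<omega>. (X \<omega>)\<^sup>2 + (Y \<omega>)\<^sup>2)" using assms(3,4) by simp
  have "\<bar>a * b\<bar> \<le> a\<^sup>2 + b\<^sup>2" for a b :: real
  proof -
    have "0 \<le> \<bar>a\<bar> * \<bar>b\<bar>" by simp
    moreover have "2 * (\<bar>a\<bar> * \<bar>b\<bar>) \<le> a\<^sup>2 + b\<^sup>2"
      using sum_squares_bound[of "\<bar>a\<bar>" "\<bar>b\<bar>"] by (simp add: mult.assoc)
    ultimately show ?thesis unfolding abs_mult by linarith
  qed
  then show "AE \<omega> in M. norm (X \<omega> * Y \<omega>) \<le> norm ((X \<omega>)\<^sup>2 + (Y \<omega>)\<^sup>2)"
    by (intro AE_I2) auto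
qed measurable

text \<open>By orthogonality, the mixed terms vanish when the square of the sum is expanded.\<close>

lemma (in prob_space) orthogonal_increments_second_moment:
  fixes X :: "nat \<Rightarrow> 'a \<Rightarrow> real"
  assumes sub: "\<And>q. q < n \<Longrightarrow> subalgebra M (G q)"
    and X: "\<And>q. q < n \<Longrightarrow> X q \<in> borel_measurable M"
    and int: "\<And>q. q < n \<Longrightarrow> integrable M (\<lambda>\<omega>. (X q \<omega>)\<^sup>2)"
    and adapted: "\<And>k q. k < q \<Longrightarrow> q < n \<Longrightarrow> X k \<in> borel_measurable (G q)"
    and orthogonal: "\<And>q Y. q < n \<Longrightarrow> Y \<in> borel_measurable (G q) \<Longrightarrow> integrable M (\<lambda>\<omega>. (Y \<omega>)\<^sup>2) \<Longrightarrow>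
      expectation (\<lambda>\<omega>. Y \<omega> * X q \<omega>) = 0"
  shows "integrable M (\<lambda>\<omega>. (\<Sum>q<n. X q \<omega>)\<^sup>2)"
    and "expectation (\<lambda>\<omega>. (\<Sum>q<n. X q \<omega>)\<^sup>2) = (\<Sum>q<n. expectation (\<lambda>\<omega>. (X q \<omega>)\<^sup>2))"
proof -
  have "integrable M (\<lambda>\<omega>. (\<Sum>q<m. X q \<omega>)\<^sup>2) \<and>
    expectation (\<lambda>\<omega>. (\<Sum>q<m. X q \<omega>)\<^sup>2) = (\<Sum>q<m. expectation (\<lambda>\<omega>. (X q \<omega>)\<^sup>2))" if "m \<le> n" for m
    using that
  proof (induction m)
    case (Suc m)
    then have m: "m < n" and IH: "integrable M (\<lambda>\<omega>. (\<Sum>q<m. X q \<omega>)\<^sup>2)"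
      "expectation (\<lambda>\<omega>. (\<Sum>q<m. X q \<omega>)\<^sup>2) = (\<Sum>q<m. expectation (\<lambda>\<omega>. (X q \<omega>)\<^sup>2))"
      by auto
    let ?S = "\<lambda>\<omega>. \<Sum>q<m. X q \<omega>"
    have SG: "?S \<in> borel_measurable (G m)"
      using adapted m by (intro borel_measurable_sum) auto
    have SM: "?S \<in> borel_measurable M"
      using X m by (intro borel_measurable_sum) auto
    have prod: "integrable M (\<lambda>\<omega>. ?S \<omega> * X m \<omega>)" "expectation (\<lambda>\<omega>. ?S \<omega> * X m \<omega>) = 0"
      using integrable_mult_of_squares[OF SM X[OF m] IH(1) int[OF m]] orthogonal[OF m SG IH(1)] by auto
    have eq: "(\<Sum>q<Suc m. X q \<omega>)\<^sup>2 = (?S \<omega>)\<^sup>2 + 2 * (?S \<omega> * X m \<omega>) + (X m \<omega>)\<^sup>2" for \<omega>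
      by (simp add: power2_sum)
    show ?case
      unfolding eq using prod IH int[OF m] by simp
  qed simp
  then show "integrable M (\<lambda>\<omega>. (\<Sum>q<n. X q \<omega>)\<^sup>2)"
    "expectation (\<lambda>\<omega>. (\<Sum>q<n. X q \<omega>)\<^sup>2) = (\<Sum>q<n. expectation (\<lambda>\<omega>. (X q \<omega>)\<^sup>2))"
    by auto
qed

section \<open>Brownian increments\<close>

lemma measurable_vec_nth_comp [measurable (raw)]:
  fixes f :: "'w \<Rightarrow> 'b::euclidean_space ^ 'd::finite"
  assumes "f \<in> borel_measurable N"
  shows "(\<lambda>\<omega>. f \<omega> $ i) \<in> borel_measurable N"
  by (rule borel_measurable_continuous_on[OF _ assms]) (intro continuous_intros)

lemma continuous_on_matrix_vector_mult [continuous_intros]: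
  fixes A :: "'w::topological_space \<Rightarrow> real^'d::finite^'k::finite"
  assumes "continuous_on S A" "continuous_on S v"
  shows "continuous_on S (\<lambda>w. A w *v v w)"
  unfolding matrix_vector_mult_def by (intro continuous_intros assms)

lemma measurable_matrix_vector_mult [measurable (raw)]:
  fixes A :: "'w \<Rightarrow> real^'d::finite^'k::finite"
  assumes "A \<in> borel_measurable N" "v \<in> borel_measurable N"
  shows "(\<lambda>w. A w *v v w) \<in> borel_measurable N"
  by (rule borel_measurable_continuous_Pair[OF assms]) (intro continuous_intros)

lemma norm_add_square_le: "(norm (a + b))\<^sup>2 \<le> 2 * (norm a)\<^sup>2 + 2 * (norm b)\<^sup>2"
proof -
  have "(norm (a + b))\<^sup>2 \<le> (norm a + norm b)\<^sup>2"
    by (intro power_mono norm_triangle_ineq) simp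
  also have "\<dots> \<le> 2 * (norm a)\<^sup>2 + 2 * (norm b)\<^sup>2"
    using sum_squares_bound[of "norm a" "norm b"] by (simp add: power2_sum)
  finally show ?thesis .
qed

lemma norm_vec_square: "(norm (v :: real^'d::finite))\<^sup>2 = (\<Sum>l\<in>UNIV. (v $ l)\<^sup>2)"
  by (simp add: norm_vec_def L2_set_def sum_nonneg)

lemma norm_matrix_vector_le: "norm ((A :: real^'d::finite^'k::finite) *v v) \<le> norm A * norm v"
proof -
  have "(norm (A *v v))\<^sup>2 = (\<Sum>j\<in>UNIV. (A $ j \<bullet> v)\<^sup>2)"
    by (simp add: norm_vec_square matrix_vector_mul_component)
  also have "\<dots> \<le> (\<Sum>j\<in>UNIV. (norm (A $ j) * norm v)\<^sup>2)"
    by (intro sum_mono power2_le_iff_abs_le[THEN iffD2]) (auto simp: Cauchy_Schwarz_ineq2)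
  also have "\<dots> = (norm A * norm v)\<^sup>2"
    by (simp add: power_mult_distrib norm_vec_def[of A] L2_set_def sum_nonneg sum_distrib_right)
  finally show ?thesis
    by (rule power2_le_imp_le) auto
qed

locale brownian_setting =
  fixes M :: "'w measure" and F :: "real \<Rightarrow> 'w measure" and W :: "real \<Rightarrow> 'w \<Rightarrow> real^'d::finite"
  assumes bm: "brownian_motion M F W"
begin

lemma filtered: "filtered_prob_space M F"
  using bm by (simp add: brownian_motion_def)

end

sublocale brownian_setting \<subseteq> prob_space M
  using filtered by (simp add: filtered_prob_space_def)

context brownian_setting
begin

lemma subalgebra_F: "subalgebra M (F t)"
  using filtered by (simp add: filtered_prob_space_def)

lemma space_F: "space (F t) = space M"
  using subalgebra_F by (simp add: subalgebra_def)

lemma measurable_F_mono: "f \<in> borel_measurable (F s) \<Longrightarrow> s \<le> t \<Longrightarrow> f \<in> borel_measurable (F t)"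
  using filtered filtration.sets_F_mono[of "space M" F s t]
  by (auto intro: measurable_mono[THEN subsetD, of borel borel "F s"]
      simp: filtered_prob_space_def space_F)

lemma measurable_F_M: "f \<in> borel_measurable (F s) \<Longrightarrow> f \<in> borel_measurable M"
  using measurable_from_subalg[OF subalgebra_F] .

lemma W_adapted: "0 \<le> t \<Longrightarrow> W t \<in> borel_measurable (F t)"
  using bm by (simp add: brownian_motion_def)

abbreviation incr :: "real \<Rightarrow> real \<Rightarrow> 'w \<Rightarrow> real^'d" where
  "incr s t \<omega> \<equiv> W t \<omega> - W s \<omega>"

lemma incr_adapted: "0 \<le> s \<Longrightarrow> s \<le> t \<Longrightarrow> incr s t \<in> borel_measurable (F t)"
  using W_adapted measurable_F_mono[OF W_adapted, of s t] by (intro borel_measurable_diff) auto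

lemma incr_measurable: "0 \<le> s \<Longrightarrow> s \<le> t \<Longrightarrow> incr s t \<in> borel_measurable M"
  using measurable_F_M[OF incr_adapted] .

lemma incr_moments:
  assumes "0 \<le> s" "s \<le> t"
  shows "integrable M (\<lambda>\<omega>. (incr s t \<omega> $ l) ^ k)"
    and "expectation (\<lambda>\<omega>. incr s t \<omega> $ l) = 0"
    and "expectation (\<lambda>\<omega>. (incr s t \<omega> $ l)\<^sup>2) = t - s"
    and "expectation (\<lambda>\<omega>. (incr s t \<omega> $ l) ^ 4) = 3 * (t - s)\<^sup>2"
proof -
  have "integrable M (\<lambda>\<omega>. (incr s t \<omega> $ l) ^ k) \<and> expectation (\<lambda>\<omega>. incr s t \<omega> $ l) = 0 \<and>
    expectation (\<lambda>\<omega>. (incr s t \<omega> $ l)\<^sup>2) = t - s \<and> expectation (\<lambda>\<omega>. (incr s t \<omega> $ l) ^ 4) = 3 * (t - s)\<^sup>2"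
  proof (cases "s = t")
    case True
    then show ?thesis by (simp add: zero_power2 power_0_left)
  next
    case False
    then have st: "s < t" using assms by simp
    define v where "v = sqrt (t - s)"
    have v: "0 < v" "v\<^sup>2 = t - s" using st by (auto simp: v_def)
    have D: "distributed M lborel (\<lambda>\<omega>. incr s t \<omega> $ l) (\<lambda>u. ennreal (normal_density 0 v u))"
      using bm assms(1) st by (auto simp: brownian_motion_def v_def)
    have int: "integrable M (\<lambda>\<omega>. (incr s t \<omega> $ l) ^ j)" for j
      using distributed_integrable[OF D, of "\<lambda>x. x ^ j"] integrable_normal_moment[OF v(1), of 0 j] by simp
    have E: "expectation (\<lambda>\<omega>. (incr s t \<omega> $ l) ^ j) = (\<integral>x. normal_density 0 v x * x ^ j \<partial>lborel)" for j
      using distributed_integral[OF D, of "\<lambda>x. x ^ j"] by simp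
    have "expectation (\<lambda>\<omega>. incr s t \<omega> $ l) = 0"
      using E[of 1] integral_normal_moment_odd[OF v(1), of 0 0] by simp
    moreover have "expectation (\<lambda>\<omega>. (incr s t \<omega> $ l)\<^sup>2) = t - s"
      using E[of 2] integral_normal_moment_even[OF v(1), of 0 1] v by simp
    moreover have "expectation (\<lambda>\<omega>. (incr s t \<omega> $ l) ^ 4) = 3 * (t - s)\<^sup>2"
    proof -
      have "expectation (\<lambda>\<omega>. (incr s t \<omega> $ l) ^ 4) = fact 4 / ((2 / v\<^sup>2)\<^sup>2 * fact 2)"
        using E[of 4] integral_normal_moment_even[OF v(1), of 0 2] by simp
      also have "\<dots> = 3 * (t - s)\<^sup>2"
        using v by (simp add: fact_numeral power_divide)
      finally show ?thesis .
    qed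
    ultimately show ?thesis using int by blast
  qed
  then show "integrable M (\<lambda>\<omega>. (incr s t \<omega> $ l) ^ k)"
    and "expectation (\<lambda>\<omega>. incr s t \<omega> $ l) = 0"
    and "expectation (\<lambda>\<omega>. (incr s t \<omega> $ l)\<^sup>2) = t - s"
    and "expectation (\<lambda>\<omega>. (incr s t \<omega> $ l) ^ 4) = 3 * (t - s)\<^sup>2"
    by blast+
qed

lemma incr_integrable_square: "0 \<le> s \<Longrightarrow> s \<le> t \<Longrightarrow> integrable M (\<lambda>\<omega>. (incr s t \<omega> $ l)\<^sup>2)"
  by (rule incr_moments(1))

lemma incr_component_measurable:
  "0 \<le> s \<Longrightarrow> s \<le> t \<Longrightarrow> (\<lambda>\<omega>. incr s t \<omega> $ l) \<in> borel_measurable M"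
  using measurable_vec_nth_comp[OF incr_measurable] .

lemma incr_cross_moment:
  assumes "0 \<le> s" "s \<le> t" "l \<noteq> l'"
  shows "expectation (\<lambda>\<omega>. incr s t \<omega> $ l * incr s t \<omega> $ l') = 0"
proof (cases "s = t")
  case False
  then have "indep_vars (\<lambda>_. borel) (\<lambda>i \<omega>. incr s t \<omega> $ i) UNIV"
    using bm assms unfolding brownian_motion_def by auto
  then have "indep_vars (\<lambda>_. borel) (\<lambda>i \<omega>. incr s t \<omega> $ i) {l, l'}"
    by (rule indep_vars_subset) simp
  then have "expectation (\<lambda>\<omega>. \<Prod>i\<in>{l, l'}. incr s t \<omega> $ i) = (\<Prod>i\<in>{l, l'}. expectation (\<lambda>\<omega>. incr s t \<omega> $ i))"
    using incr_moments(1)[OF assms(1,2), of _ 1] by (intro indep_vars_lebesgue_integral) auto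
  then show ?thesis
    using assms(3) incr_moments(2)[OF assms(1,2)] by simp
qed simp

text \<open>The increment is independent of the past as a vector; \<open>k\<close> may therefore involve several of its
  components at once, as is needed for the quadratic variation.\<close>

lemma expectation_past_times_incr:
  assumes st: "0 \<le> s" "s \<le> t" and Y: "Y \<in> borel_measurable (F s)" "integrable M Y"
    and k: "k \<in> borel_measurable borel" "integrable M (\<lambda>\<omega>. k (incr s t \<omega>))"
  shows "integrable M (\<lambda>\<omega>. Y \<omega> * k (incr s t \<omega>))"
    and "expectation (\<lambda>\<omega>. Y \<omega> * k (incr s t \<omega>)) = expectation Y * expectation (\<lambda>\<omega>. k (incr s t \<omega>) :: real)"
proof -
  have "integrable M (\<lambda>\<omega>. Y \<omega> * k (incr s t \<omega>)) \<and>
    expectation (\<lambda>\<omega>. Y \<omega> * k (incr s t \<omega>)) = expectation Y * expectation (\<lambda>\<omega>. k (incr s t \<omega>))"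
  proof (cases "s = t")
    case True
    then show ?thesis using Y(2) by (simp add: prob_space)
  next
    case False
    then have indep: "indep_set (sets (F s)) (sets (vimage_algebra (space M) (incr s t) borel))"
      using bm st unfolding brownian_motion_def by auto
    have kW: "(\<lambda>\<omega>. k (incr s t \<omega>)) \<in> borel_measurable M"
      using measurable_compose[OF incr_measurable[OF st] k(1)] .
    have 1: "sigma_sets (space M) {Y -` A \<inter> space M | A. A \<in> sets borel} \<subseteq> sets (F s)"
      using measurable_sets[OF Y(1)] sets.sigma_sets_subset[of "{Y -` A \<inter> space M | A. A \<in> sets borel}" "F s"]
      unfolding space_F by blast
    have kV: "(\<lambda>\<omega>. k (incr s t \<omega>)) \<in> borel_measurable (vimage_algebra (space M) (incr s t) borel)"
      by (rule measurable_compose[OF measurable_vimage_algebra1 k(1)]) auto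
    have 2: "sigma_sets (space M) {(\<lambda>\<omega>. k (incr s t \<omega>)) -` A \<inter> space M | A. A \<in> sets borel}
        \<subseteq> sets (vimage_algebra (space M) (incr s t) borel)"
      using measurable_sets[OF kV] sets.sigma_sets_subset[of
          "{(\<lambda>\<omega>. k (incr s t \<omega>)) -` A \<inter> space M | A. A \<in> sets borel}" "vimage_algebra (space M) (incr s t) borel"]
      unfolding space_vimage_algebra by blast
    have "indep_var borel Y borel (\<lambda>\<omega>. k (incr s t \<omega>))"
      unfolding indep_var_eq indep_sets2_eq
      using measurable_F_M[OF Y(1)] kW indep[unfolded indep_sets2_eq] 1 2 by blast
    then show ?thesis
      using indep_var_lebesgue_integral indep_var_integrable Y(2) k(2) by blast
  qed
  then show "integrable M (\<lambda>\<omega>. Y \<omega> * k (incr s t \<omega>))"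
    and "expectation (\<lambda>\<omega>. Y \<omega> * k (incr s t \<omega>)) = expectation Y * expectation (\<lambda>\<omega>. k (incr s t \<omega>))"
    by blast+
qed

lemma integrable_bounded_times:
  assumes "c \<in> borel_measurable M" "bounded (c ` space M)" "integrable M (Z :: 'w \<Rightarrow> real)"
  shows "integrable M (\<lambda>\<omega>. c \<omega> * Z \<omega> :: real)"
proof -
  obtain C where C: "\<And>\<omega>. \<omega> \<in> space M \<Longrightarrow> \<bar>c \<omega>\<bar> \<le> C"
    using assms(2) by (auto simp: bounded_iff)
  show ?thesis
  proof (rule Bochner_Integration.integrable_bound)
    show "integrable M (\<lambda>\<omega>. C * Z \<omega>)" using assms(3) by simp
    show "AE \<omega> in M. norm (c \<omega> * Z \<omega>) \<le> norm (C * Z \<omega>)"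
      using C by (intro AE_I2) (force simp: abs_mult intro!: mult_right_mono)
  qed (use assms in measurable)
qed

lemma integrable_bounded:
  assumes "c \<in> borel_measurable M" "bounded (c ` space M)"
  shows "integrable M (c :: 'w \<Rightarrow> real)"
  using integrable_bounded_times[OF assms, of "\<lambda>_. 1"] by simp

lemma bounded_image_mult:
  "bounded (a ` S) \<Longrightarrow> bounded (b ` S) \<Longrightarrow> bounded ((\<lambda>x. a x * b x :: real) ` S)"
proof -
  assume "bounded (a ` S)" "bounded (b ` S)"
  then obtain A B where AB: "\<And>x. x \<in> S \<Longrightarrow> \<bar>a x\<bar> \<le> A" "\<And>x. x \<in> S \<Longrightarrow> \<bar>b x\<bar> \<le> B"
    unfolding bounded_iff by auto
  have "\<bar>a x * b x\<bar> \<le> \<bar>A\<bar> * \<bar>B\<bar>" if "x \<in> S" for x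
    unfolding abs_mult using AB[OF that] by (intro mult_mono) auto
  then show ?thesis unfolding bounded_iff by (intro exI[of _ "\<bar>A\<bar> * \<bar>B\<bar>"]) auto
qed

text \<open>Given the past, the increment enters only through the mean of \<open>k\<close>, which is zero.\<close>

lemma past_orthogonal_incr:
  assumes st: "0 \<le> s" "s \<le> t" and c: "c \<in> borel_measurable (F s)" "bounded (c ` space M)"
    and k: "k \<in> borel_measurable borel" "integrable M (\<lambda>\<omega>. (k (incr s t \<omega>))\<^sup>2)"
      "expectation (\<lambda>\<omega>. k (incr s t \<omega>) :: real) = 0"
    and Y: "Y \<in> borel_measurable (F s)" "integrable M (\<lambda>\<omega>. (Y \<omega> :: real)\<^sup>2)"
  shows "integrable M (\<lambda>\<omega>. Y \<omega> * (c \<omega> * k (incr s t \<omega>)))"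
    and "expectation (\<lambda>\<omega>. Y \<omega> * (c \<omega> * k (incr s t \<omega>))) = 0"
proof -
  have kW: "(\<lambda>\<omega>. k (incr s t \<omega>)) \<in> borel_measurable M"
    using measurable_compose[OF incr_measurable[OF st] k(1)] .
  have YM: "Y \<in> borel_measurable M" and cM: "c \<in> borel_measurable M"
    using measurable_F_M Y(1) c(1) by auto
  have intY: "integrable M Y"
    using integrable_mult_of_squares[OF YM _ Y(2), of "\<lambda>_. 1"] by simp
  have intk: "integrable M (\<lambda>\<omega>. k (incr s t \<omega>))"
    using integrable_mult_of_squares[OF kW _ k(2), of "\<lambda>_. 1"] by simp
  have "integrable M (\<lambda>\<omega>. c \<omega> * Y \<omega>)"
    by (rule integrable_bounded_times[OF cM c(2) intY])
  moreover have "(\<lambda>\<omega>. c \<omega> * Y \<omega>) \<in> borel_measurable (F s)"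
    using c(1) Y(1) by measurable
  ultimately have "integrable M (\<lambda>\<omega>. c \<omega> * Y \<omega> * k (incr s t \<omega>))"
    "expectation (\<lambda>\<omega>. c \<omega> * Y \<omega> * k (incr s t \<omega>)) = 0"
    using expectation_past_times_incr[OF st _ _ k(1) intk, of "\<lambda>\<omega>. c \<omega> * Y \<omega>"] k(3) by auto
  then show "integrable M (\<lambda>\<omega>. Y \<omega> * (c \<omega> * k (incr s t \<omega>)))"
    "expectation (\<lambda>\<omega>. Y \<omega> * (c \<omega> * k (incr s t \<omega>))) = 0"
    by (simp_all add: ac_simps)
qed

lemma incr_norm_square:
  assumes "0 \<le> s" "s \<le> t"
  shows "integrable M (\<lambda>\<omega>. (norm (incr s t \<omega>))\<^sup>2)"
    and "expectation (\<lambda>\<omega>. (norm (incr s t \<omega>))\<^sup>2) = real CARD('d) * (t - s)"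
  unfolding norm_vec_square using incr_integrable_square[OF assms] incr_moments(3)[OF assms]
  by simp_all

lemma past_norm_times_incr:
  assumes st: "0 \<le> s" "s \<le> t" and c: "c \<in> borel_measurable (F s)" "bounded (c ` space M)"
  shows "integrable M (\<lambda>\<omega>. (norm (c \<omega> :: 'b::euclidean_space))\<^sup>2 * (norm (incr s t \<omega>))\<^sup>2)"
    and "expectation (\<lambda>\<omega>. (norm (c \<omega>))\<^sup>2 * (norm (incr s t \<omega>))\<^sup>2)
      = expectation (\<lambda>\<omega>. (norm (c \<omega>))\<^sup>2) * (real CARD('d) * (t - s))"
proof -
  have n: "(\<lambda>\<omega>. (norm (c \<omega>))\<^sup>2) \<in> borel_measurable (F s)" using c(1) by measurable
  have "bounded ((\<lambda>\<omega>. norm (c \<omega>) * norm (c \<omega>)) ` space M)"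
    using c(2) by (intro bounded_image_mult) (auto simp: bounded_iff)
  then have i: "integrable M (\<lambda>\<omega>. (norm (c \<omega>))\<^sup>2)"
    using measurable_F_M[OF n] by (intro integrable_bounded) (auto simp: power2_eq_square)
  show "integrable M (\<lambda>\<omega>. (norm (c \<omega>))\<^sup>2 * (norm (incr s t \<omega>))\<^sup>2)"
    "expectation (\<lambda>\<omega>. (norm (c \<omega>))\<^sup>2 * (norm (incr s t \<omega>))\<^sup>2)
      = expectation (\<lambda>\<omega>. (norm (c \<omega>))\<^sup>2) * (real CARD('d) * (t - s))"
    using expectation_past_times_incr[OF st n i, of "\<lambda>v. (norm v)\<^sup>2"] incr_norm_square[OF st] by auto
qed

text \<open>The summands are orthogonal.  The dimension enters since \<open>c \<bullet> \<Delta>W\<close> is estimated by the product of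
  the norms, and \<open>\<Delta>W\<close> has second moment \<open>d \<Delta>t\<close>.\<close>

lemma stochastic_sum_second_moment:
  fixes c :: "nat \<Rightarrow> 'w \<Rightarrow> real^'d"
  assumes p: "0 \<le> p 0" "\<And>q. q < n \<Longrightarrow> p q \<le> p (Suc q)"
    and c: "\<And>q. q < n \<Longrightarrow> c q \<in> borel_measurable (F (p q))" "\<And>q. q < n \<Longrightarrow> bounded (c q ` space M)"
  shows "integrable M (\<lambda>\<omega>. (\<Sum>q<n. c q \<omega> \<bullet> incr (p q) (p (Suc q)) \<omega>)\<^sup>2)"
    and "expectation (\<lambda>\<omega>. (\<Sum>q<n. c q \<omega> \<bullet> incr (p q) (p (Suc q)) \<omega>)\<^sup>2)
      \<le> real CARD('d) * expectation (\<lambda>\<omega>. \<Sum>q<n. (norm (c q \<omega>))\<^sup>2 * (p (Suc q) - p q))"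
proof -
  let ?X = "\<lambda>q \<omega>. c q \<omega> \<bullet> incr (p q) (p (Suc q)) \<omega>"
  have mono: "p i \<le> p j" if "i \<le> j" "j \<le> n" for i j
    using that by (intro steps_mono[of n p i j] p(2))
  have pos: "0 \<le> p q" if "q \<le> n" for q using mono[of 0 q] p(1) that by simp
  have XF: "?X q \<in> borel_measurable (F (p (Suc q)))" if "q < n" for q
    using measurable_F_mono[OF c(1)[OF that] p(2)[OF that]] incr_adapted[OF pos p(2)[OF that]] that
    by (intro borel_measurable_inner) auto
  have XM: "?X q \<in> borel_measurable M" if "q < n" for q
    using measurable_F_M[OF XF[OF that]] .
  have Xle: "(?X q \<omega>)\<^sup>2 \<le> (norm (c q \<omega>))\<^sup>2 * (norm (incr (p q) (p (Suc q)) \<omega>))\<^sup>2" for q \<omega>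
    by (metis Cauchy_Schwarz_ineq power2_norm_eq_inner)
  note past = past_norm_times_incr[OF pos p(2) c]
  have Xint: "integrable M (\<lambda>\<omega>. (?X q \<omega>)\<^sup>2)" if "q < n" for q
    using that XM[OF that] Xle
    by (intro Bochner_Integration.integrable_bound[OF past(1)[of q]]) (auto intro!: AE_I2)
  have orth: "expectation (\<lambda>\<omega>. Y \<omega> * ?X q \<omega>) = 0"
    if "q < n" "Y \<in> borel_measurable (F (p q))" "integrable M (\<lambda>\<omega>. (Y \<omega>)\<^sup>2)" for q Y
  proof -
    have cl: "(\<lambda>\<omega>. c q \<omega> $ l) \<in> borel_measurable (F (p q))" "bounded ((\<lambda>\<omega>. c q \<omega> $ l) ` space M)" for l
    proof -
      show "(\<lambda>\<omega>. c q \<omega> $ l) \<in> borel_measurable (F (p q))"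
        using c(1)[OF that(1)] by (rule measurable_vec_nth_comp)
      obtain B where "\<And>\<omega>. \<omega> \<in> space M \<Longrightarrow> norm (c q \<omega>) \<le> B"
        using c(2)[OF \<open>q < n\<close>] unfolding bounded_iff by blast
      then show "bounded ((\<lambda>\<omega>. c q \<omega> $ l) ` space M)"
        unfolding bounded_iff by (intro exI[of _ B]) (auto intro: order_trans[OF component_le_norm_cart])
    qed
    have "integrable M (\<lambda>\<omega>. Y \<omega> * (c q \<omega> $ l * incr (p q) (p (Suc q)) \<omega> $ l)) \<and>
       expectation (\<lambda>\<omega>. Y \<omega> * (c q \<omega> $ l * incr (p q) (p (Suc q)) \<omega> $ l)) = 0" for l
    proof -
      have st: "0 \<le> p q" "p q \<le> p (Suc q)" using pos[of q] p(2) that(1) by auto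
      show ?thesis
        using past_orthogonal_incr[OF st cl, where k = "\<lambda>v. v $ l" and Y = Y] that
          incr_integrable_square[OF st, of l] incr_moments(2)[OF st, of l] by simp
    qed
    then show ?thesis
      unfolding inner_vec_def inner_real_def sum_distrib_left by (subst Bochner_Integration.integral_sum) auto
  qed
  have XF': "?X k \<in> borel_measurable (F (p q))" if "k < q" "q < n" for k q
    by (rule measurable_F_mono[OF XF mono]) (use that in simp_all)
  have 1: "integrable M (\<lambda>\<omega>. (\<Sum>q<n. ?X q \<omega>)\<^sup>2)"
    by (rule orthogonal_increments_second_moment(1)[where G = "\<lambda>q. F (p q)"],
        rule subalgebra_F, erule XM, erule Xint, erule (1) XF', erule (2) orth)
  have 2: "expectation (\<lambda>\<omega>. (\<Sum>q<n. ?X q \<omega>)\<^sup>2) = (\<Sum>q<n. expectation (\<lambda>\<omega>. (?X q \<omega>)\<^sup>2))"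
    by (rule orthogonal_increments_second_moment(2)[where G = "\<lambda>q. F (p q)"],
        rule subalgebra_F, erule XM, erule Xint, erule (1) XF', erule (2) orth)
  show "integrable M (\<lambda>\<omega>. (\<Sum>q<n. ?X q \<omega>)\<^sup>2)" by (rule 1)
  have cint: "integrable M (\<lambda>\<omega>. (norm (c q \<omega>))\<^sup>2)" if "q < n" for q
  proof (rule integrable_bounded)
    show "(\<lambda>\<omega>. (norm (c q \<omega>))\<^sup>2) \<in> borel_measurable M"
      using measurable_F_M[OF c(1)[OF that]] by measurable
    show "bounded ((\<lambda>\<omega>. (norm (c q \<omega>))\<^sup>2) ` space M)"
      using c(2)[OF that] unfolding power2_eq_square by (intro bounded_image_mult) (auto simp: bounded_iff)
  qed
  have "(\<Sum>q<n. expectation (\<lambda>\<omega>. (?X q \<omega>)\<^sup>2))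
      \<le> (\<Sum>q<n. expectation (\<lambda>\<omega>. (norm (c q \<omega>))\<^sup>2) * (real CARD('d) * (p (Suc q) - p q)))"
  proof (rule sum_mono)
    fix q assume "q \<in> {..<n}"
    then have q: "q < n" by simp
    show "expectation (\<lambda>\<omega>. (?X q \<omega>)\<^sup>2)
      \<le> expectation (\<lambda>\<omega>. (norm (c q \<omega>))\<^sup>2) * (real CARD('d) * (p (Suc q) - p q))"
      unfolding past(2)[of q, OF less_imp_le[OF q] q q q, symmetric]
      by (intro integral_mono Xint past(1) Xle q less_imp_le[OF q])
  qed
  also have "\<dots> = real CARD('d) * expectation (\<lambda>\<omega>. \<Sum>q<n. (norm (c q \<omega>))\<^sup>2 * (p (Suc q) - p q))"
    using cint by (subst Bochner_Integration.integral_sum) (auto simp: sum_distrib_left ac_simps)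
  finally show "expectation (\<lambda>\<omega>. (\<Sum>q<n. ?X q \<omega>)\<^sup>2)
      \<le> real CARD('d) * expectation (\<lambda>\<omega>. \<Sum>q<n. (norm (c q \<omega>))\<^sup>2 * (p (Suc q) - p q))"
    unfolding 2 .
qed

text \<open>Gaussian fourth moments bound the second moment of each summand by a multiple of \<open>(\<Delta>t)\<^sup>2\<close>, and
  the summands are orthogonal; over a grid the sum of the \<open>(\<Delta>t)\<^sup>2\<close> is of the order of the mesh.\<close>

lemma quadratic_sum_second_moment:
  fixes a :: "nat \<Rightarrow> 'w \<Rightarrow> real" and l l' :: 'd
  assumes p: "0 \<le> p 0" "\<And>q. q < n \<Longrightarrow> p q \<le> p (Suc q)"
    and a: "\<And>q. q < n \<Longrightarrow> a q \<in> borel_measurable (F (p q))" "\<And>q \<omega>. q < n \<Longrightarrow> \<omega> \<in> space M \<Longrightarrow> \<bar>a q \<omega>\<bar> \<le> C"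
  defines "Z \<equiv> \<lambda>q \<omega>. a q \<omega> * (incr (p q) (p (Suc q)) \<omega> $ l * incr (p q) (p (Suc q)) \<omega> $ l'
     - (if l = l' then p (Suc q) - p q else 0))"
  shows "integrable M (\<lambda>\<omega>. (\<Sum>q<n. Z q \<omega>)\<^sup>2)"
    and "expectation (\<lambda>\<omega>. (\<Sum>q<n. Z q \<omega>)\<^sup>2) \<le> 8 * C\<^sup>2 * (\<Sum>q<n. (p (Suc q) - p q)\<^sup>2)"
proof -
  define k where "k q v = v $ l * v $ l' - (if l = l' then p (Suc q) - p q else 0)" for q and v :: "real^'d"
  have k_meas: "k q \<in> borel_measurable borel" for q
    unfolding k_def by measurable
  have mono: "p i \<le> p j" if "i \<le> j" "j \<le> n" for i j
    using that by (intro steps_mono[of n p i j] p(2))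
  have pos: "0 \<le> p q" if "q \<le> n" for q using mono[of 0 q] p(1) that by simp
  have Z: "Z q \<omega> = a q \<omega> * k q (incr (p q) (p (Suc q)) \<omega>)" for q \<omega>
    by (simp add: Z_def k_def)
  have kW: "(\<lambda>\<omega>. k q (incr (p q) (p (Suc q)) \<omega>)) \<in> borel_measurable (F (p (Suc q)))" if "q < n" for q
    using measurable_compose[OF incr_adapted[OF pos p(2)] k_meas] that by auto
  have ZF: "Z q \<in> borel_measurable (F (p (Suc q)))" if "q < n" for q
    unfolding Z using measurable_F_mono[OF a(1)[OF that] p(2)[OF that]] kW[OF that] by (intro borel_measurable_times)
  have ZM: "Z q \<in> borel_measurable M" if "q < n" for q
    using measurable_F_M[OF ZF[OF that]] .
  have ksq_le: "(k q v)\<^sup>2 \<le> (v $ l) ^ 4 + (v $ l') ^ 4 + 2 * (p (Suc q) - p q)\<^sup>2" for q v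
  proof -
    have ab: "(x - y)\<^sup>2 \<le> 2 * x\<^sup>2 + 2 * y\<^sup>2" for x y :: real
      using sum_squares_bound[of x "-y"] by (simp add: power2_diff)
    have h: "2 * (v $ l * v $ l')\<^sup>2 \<le> (v $ l) ^ 4 + (v $ l') ^ 4"
      using sum_squares_bound[of "(v $ l)\<^sup>2" "(v $ l')\<^sup>2"] by (simp add: power_mult_distrib mult.assoc flip: power_mult)
    show ?thesis
    proof (cases "l = l'")
      case True
      then show ?thesis
        using h ab[of "v $ l * v $ l'" "p (Suc q) - p q"] by (simp add: k_def)
    next
      case False
      then have kv: "k q v = v $ l * v $ l'" by (simp add: k_def)
      show ?thesis
        unfolding kv
        using h zero_le_power2[of "v $ l * v $ l'"] zero_le_power2[of "p (Suc q) - p q"] by linarith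
    qed
  qed
  have k1: "integrable M (\<lambda>\<omega>. (k q (incr (p q) (p (Suc q)) \<omega>))\<^sup>2) \<and>
      expectation (\<lambda>\<omega>. (k q (incr (p q) (p (Suc q)) \<omega>))\<^sup>2) \<le> 8 * (p (Suc q) - p q)\<^sup>2 \<and>
      expectation (\<lambda>\<omega>. k q (incr (p q) (p (Suc q)) \<omega>)) = 0" if "q < n" for q
  proof -
    have st: "0 \<le> p q" "p q \<le> p (Suc q)" using pos[of q] p(2) that by auto
    let ?d = "incr (p q) (p (Suc q))"
    let ?B = "\<lambda>\<omega>. (?d \<omega> $ l) ^ 4 + (?d \<omega> $ l') ^ 4 + 2 * (p (Suc q) - p q)\<^sup>2"
    have B: "integrable M ?B" using incr_moments(1)[OF st] by auto
    have EB: "expectation ?B = 8 * (p (Suc q) - p q)\<^sup>2"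
      using incr_moments(1)[OF st] incr_moments(4)[OF st] by (simp add: prob_space)
    have i: "integrable M (\<lambda>\<omega>. (k q (?d \<omega>))\<^sup>2)"
    proof (rule Bochner_Integration.integrable_bound[OF B])
      show "(\<lambda>\<omega>. (k q (?d \<omega>))\<^sup>2) \<in> borel_measurable M"
        using measurable_F_M[OF kW[OF that]] by measurable
      show "AE \<omega> in M. norm ((k q (?d \<omega>))\<^sup>2) \<le> norm (?B \<omega>)"
        by (rule AE_I2, unfold real_norm_def abs_power2, rule order_trans[OF ksq_le abs_ge_self])
    qed
    have "expectation (\<lambda>\<omega>. (k q (?d \<omega>))\<^sup>2) \<le> expectation ?B"
      by (intro integral_mono i B ksq_le)
    moreover have "expectation (\<lambda>\<omega>. k q (?d \<omega>)) = 0"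
    proof -
      have "integrable M (\<lambda>\<omega>. ?d \<omega> $ l * ?d \<omega> $ l')"
        by (intro integrable_mult_of_squares incr_component_measurable incr_integrable_square st)
      then have "expectation (\<lambda>\<omega>. k q (?d \<omega>)) = expectation (\<lambda>\<omega>. ?d \<omega> $ l * ?d \<omega> $ l')
          - (if l = l' then p (Suc q) - p q else 0)"
        unfolding k_def by (subst Bochner_Integration.integral_diff) (auto simp: prob_space)
      then show ?thesis
        using incr_cross_moment[OF st, of l l'] incr_moments(3)[OF st, of l] by (cases "l = l'") (auto simp: power2_eq_square)
    qed
    ultimately show ?thesis using i EB by simp
  qed
  have bnd: "bounded (a q ` space M)" if "q < n" for q
    using a(2)[OF that] by (auto simp: bounded_iff)
  have Zle: "(Z q \<omega>)\<^sup>2 \<le> C\<^sup>2 * (k q (incr (p q) (p (Suc q)) \<omega>))\<^sup>2" if "q < n" "\<omega> \<in> space M" for q \<omega>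
  proof -
    have "(a q \<omega>)\<^sup>2 \<le> C\<^sup>2" using a(2)[OF that] by (simp add: abs_le_square_iff[symmetric])
    then show ?thesis unfolding Z power_mult_distrib by (intro mult_right_mono) auto
  qed
  have Zint: "integrable M (\<lambda>\<omega>. (Z q \<omega>)\<^sup>2)" if "q < n" for q
  proof (rule Bochner_Integration.integrable_bound)
    show "integrable M (\<lambda>\<omega>. C\<^sup>2 * (k q (incr (p q) (p (Suc q)) \<omega>))\<^sup>2)" using k1[OF that] by simp
  qed (use ZM[OF that] Zle[OF that] in \<open>auto intro!: AE_I2\<close>)
  have ZF': "Z k \<in> borel_measurable (F (p q))" if "k < q" "q < n" for k q
    by (rule measurable_F_mono[OF ZF mono]) (use that in simp_all)
  have orth: "expectation (\<lambda>\<omega>. Y \<omega> * Z q \<omega>) = 0"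
    if "q < n" "Y \<in> borel_measurable (F (p q))" "integrable M (\<lambda>\<omega>. (Y \<omega>)\<^sup>2)" for q Y
  proof -
    have st: "0 \<le> p q" "p q \<le> p (Suc q)" using pos[of q] p(2) that(1) by auto
    show ?thesis
      unfolding Z using k1[OF that(1)]
      by (intro past_orthogonal_incr(2)[OF st a(1)[OF that(1)] bnd[OF that(1)] k_meas _ _ that(2,3)]) auto
  qed
  have 1: "integrable M (\<lambda>\<omega>. (\<Sum>q<n. Z q \<omega>)\<^sup>2)"
    by (rule orthogonal_increments_second_moment(1)[where G = "\<lambda>q. F (p q)"],
        rule subalgebra_F, erule ZM, erule Zint, erule (1) ZF', erule (2) orth)
  have 2: "expectation (\<lambda>\<omega>. (\<Sum>q<n. Z q \<omega>)\<^sup>2) = (\<Sum>q<n. expectation (\<lambda>\<omega>. (Z q \<omega>)\<^sup>2))"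
    by (rule orthogonal_increments_second_moment(2)[where G = "\<lambda>q. F (p q)"],
        rule subalgebra_F, erule ZM, erule Zint, erule (1) ZF', erule (2) orth)
  show "integrable M (\<lambda>\<omega>. (\<Sum>q<n. Z q \<omega>)\<^sup>2)" by (rule 1)
  have "(\<Sum>q<n. expectation (\<lambda>\<omega>. (Z q \<omega>)\<^sup>2)) \<le> (\<Sum>q<n. C\<^sup>2 * (8 * (p (Suc q) - p q)\<^sup>2))"
  proof (rule sum_mono)
    fix q assume "q \<in> {..<n}"
    then have q: "q < n" by simp
    have "expectation (\<lambda>\<omega>. (Z q \<omega>)\<^sup>2) \<le> expectation (\<lambda>\<omega>. C\<^sup>2 * (k q (incr (p q) (p (Suc q)) \<omega>))\<^sup>2)"
      using Zint[OF q] k1[OF q] Zle[OF q] by (intro integral_mono) auto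
    also have "\<dots> \<le> C\<^sup>2 * (8 * (p (Suc q) - p q)\<^sup>2)"
      using k1[OF q] by (auto intro!: mult_left_mono)
    finally show "expectation (\<lambda>\<omega>. (Z q \<omega>)\<^sup>2) \<le> C\<^sup>2 * (8 * (p (Suc q) - p q)\<^sup>2)" .
  qed
  then show "expectation (\<lambda>\<omega>. (\<Sum>q<n. Z q \<omega>)\<^sup>2) \<le> 8 * C\<^sup>2 * (\<Sum>q<n. (p (Suc q) - p q)\<^sup>2)"
    unfolding 2 by (simp add: sum_distrib_left ac_simps)
qed

end

section \<open>Simple processes on refined partitions\<close>

lemma strict_steps:
  fixes p :: "nat \<Rightarrow> real"
  assumes "strict_mono_on {..n} p" "i \<le> n" "j \<le> n"
  shows "p i < p j \<longleftrightarrow> i < j" "p i \<le> p j \<longleftrightarrow> i \<le> j"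
  using strict_mono_onD[OF assms(1), of i j] strict_mono_onD[OF assms(1), of j i] assms(2,3)
  by (cases i j rule: linorder_cases; simp)+

lemma finite_set_strict_enumeration:
  fixes P :: "real set"
  assumes "finite P" "P \<noteq> {}"
  obtains p :: "nat \<Rightarrow> real" and n where "strict_mono_on {..n} p" "p ` {..n} = P"
proof -
  define xs where "xs = sorted_list_of_set P"
  have len: "length xs = card P" "0 < card P" and set: "set xs = P" and sw: "sorted_wrt (<) xs"
    using assms by (auto simp: xs_def card_gt_0_iff)
  have "strict_mono_on {..card P - 1} ((!) xs)"
    using sorted_wrt_nth_less[OF sw] len by (intro strict_mono_onI) auto
  moreover have "{..card P - 1} = {..<length xs}" using len by auto
  then have "(!) xs ` {..card P - 1} = P"
    using set nth_image[of "length xs" xs] by (simp add: lessThan_atLeast0)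
  ultimately show thesis by (rule that)
qed

text \<open>The cells that start in \<open>[a, b)\<close> tile this interval as soon as \<open>a\<close> and \<open>b\<close> are points of the
  partition.\<close>

lemma sum_cells_telescope:
  fixes w :: "real \<Rightarrow> 'b::ab_group_add"
  assumes p: "strict_mono_on {..n::nat} p" and ab: "a \<in> p ` {..n}" "b \<in> p ` {..n}" "a \<le> b"
  shows "(\<Sum>q<n. if a \<le> p q \<and> p q < b then w (p (Suc q)) - w (p q) else 0) = w b - w a"
proof -
  obtain i j where ij: "a = p i" "b = p j" "i \<le> n" "j \<le> n" using ab(1,2) by auto
  have "i \<le> j" using strict_steps(2)[OF p ij(3,4)] ab(3) ij by simp
  have "(\<Sum>q<n. if a \<le> p q \<and> p q < b then w (p (Suc q)) - w (p q) else 0)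
      = (\<Sum>q<n. if q \<in> {i..<j} then w (p (Suc q)) - w (p q) else 0)"
    using strict_steps(1)[OF p, of _ j] strict_steps(2)[OF p, of i] ij by (intro sum.cong) auto
  also have "\<dots> = (\<Sum>q\<in>{i..<j}. w (p (Suc q)) - w (p q))"
    using ij(4) by (subst sum.inter_restrict[symmetric]) (auto intro!: sum.cong)
  also have "\<dots> = w b - w a"
    using sum_Suc_diff'[OF \<open>i \<le> j\<close>, of "\<lambda>q. w (p q)"] ij by simp
  finally show ?thesis .
qed

lemma cell_end_cases:
  assumes p: "strict_mono_on {..n::nat} p" and "s \<in> p ` {..n}" "q < n" "p q < u" "u \<le> p (Suc q)"
  shows "s < u \<longleftrightarrow> s \<le> p q" "u \<le> s \<longleftrightarrow> p q < (s :: real)"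
proof -
  obtain i where i: "s = p i" "i \<le> n" using assms(2) by auto
  have 1: "p i \<le> p q \<longleftrightarrow> i \<le> q" using strict_steps(2)[OF p i(2), of q] assms(3) by simp
  have 2: "p (Suc q) \<le> p i \<longleftrightarrow> Suc q \<le> i" using strict_steps(2)[OF p _ i(2), of "Suc q"] assms(3) by simp
  show "s < u \<longleftrightarrow> s \<le> p q" "u \<le> s \<longleftrightarrow> p q < s"
    using 1 2 assms(4,5) i(1) by linarith+
qed

lemma matrix_sum_vector_mult:
  "(\<Sum>j\<in>S. A j) *v v = (\<Sum>j\<in>S. (A j :: real^'d::finite^'k::finite) *v v)"
  by (induction S rule: infinite_finite_induct) (auto simp: matrix_vector_mult_add_rdistrib)

text \<open>A simple process may be rewritten on any partition \<open>p\<close> that contains its own grid points: it is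
  constant on each cell \<open>(p q, p (q + 1)]\<close>, with a value known at the left end of the cell.  In this
  way two simple processes with different grids become comparable.\<close>

locale refined_partition =
  fixes k :: nat and \<tau> :: "nat \<Rightarrow> real" and \<xi> :: "nat \<Rightarrow> 'w \<Rightarrow> real^'d::finite^'k::finite"
    and n :: nat and p :: "nat \<Rightarrow> real"
  assumes p_less: "strict_mono_on {..n} p"
    and \<tau>_mono: "\<And>j. j < k \<Longrightarrow> \<tau> j \<le> \<tau> (Suc j)"
    and \<tau>_in: "\<And>j. j \<le> k \<Longrightarrow> \<tau> j \<in> p ` {..n}"
begin

definition cell_value :: "nat \<Rightarrow> 'w \<Rightarrow> real^'d^'k" where
  "cell_value q \<omega> = (\<Sum>j<k. if \<tau> j \<le> p q \<and> p q < \<tau> (Suc j) then \<xi> j \<omega> else 0)"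

lemma simple_process_on_cell:
  assumes "q < n" "p q < u" "u \<le> p (Suc q)"
  shows "simple_process k \<tau> \<xi> u \<omega> = cell_value q \<omega>"
proof -
  have "indicator {\<tau> j<..\<tau> (Suc j)} u *\<^sub>R \<xi> j \<omega> = (if \<tau> j \<le> p q \<and> p q < \<tau> (Suc j) then \<xi> j \<omega> else 0)"
    if "j < k" for j
    using cell_end_cases(1)[OF p_less \<tau>_in[of j] assms] cell_end_cases(2)[OF p_less \<tau>_in[of "Suc j"] assms] that
    by (simp add: indicator_def)
  then show ?thesis unfolding simple_process_def cell_value_def by (intro sum.cong) auto
qed

lemma simple_integral_cells:
  assumes "t \<in> p ` {..n}"
  shows "simple_integral W k \<tau> \<xi> t \<omega> =
    (\<Sum>q<n. if p q < t then cell_value q \<omega> *v (W (p (Suc q)) \<omega> - W (p q) \<omega>) else 0)"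
proof -
  let ?dW = "\<lambda>q. W (p (Suc q)) \<omega> - W (p q) \<omega>"
  have "\<xi> j \<omega> *v (W (min t (\<tau> (Suc j))) \<omega> - W (min t (\<tau> j)) \<omega>) =
     (\<Sum>q<n. if p q < t \<and> \<tau> j \<le> p q \<and> p q < \<tau> (Suc j) then \<xi> j \<omega> *v ?dW q else 0)" if "j < k" for j
  proof -
    have "W (min t (\<tau> (Suc j))) \<omega> - W (min t (\<tau> j)) \<omega> =
      (\<Sum>q<n. if min t (\<tau> j) \<le> p q \<and> p q < min t (\<tau> (Suc j)) then ?dW q else 0)"
      using \<tau>_in[of j] \<tau>_in[of "Suc j"] \<tau>_mono[of j] that assms
      by (subst sum_cells_telescope[OF p_less, where w = "\<lambda>s. W s \<omega>"]) (auto simp: min_def)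
    also have "\<dots> = (\<Sum>q<n. if p q < t \<and> \<tau> j \<le> p q \<and> p q < \<tau> (Suc j) then ?dW q else 0)"
      by (intro sum.cong) auto
    finally show ?thesis
      by (simp add: linear_sum[OF matrix_vector_mul_linear] if_distrib[of "\<lambda>v. \<xi> j \<omega> *v v"] cong: if_cong)
  qed
  then have "simple_integral W k \<tau> \<xi> t \<omega> =
     (\<Sum>j<k. \<Sum>q<n. if p q < t \<and> \<tau> j \<le> p q \<and> p q < \<tau> (Suc j) then \<xi> j \<omega> *v ?dW q else 0)"
    unfolding simple_integral_def by (intro sum.cong) auto
  also have "\<dots> = (\<Sum>q<n. \<Sum>j<k. if p q < t \<and> \<tau> j \<le> p q \<and> p q < \<tau> (Suc j) then \<xi> j \<omega> *v ?dW q else 0)"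
    by (rule sum.swap)
  also have "\<dots> = (\<Sum>q<n. if p q < t then cell_value q \<omega> *v ?dW q else 0)"
    unfolding cell_value_def
    by (intro sum.cong refl) (auto simp: matrix_sum_vector_mult intro!: sum.cong)
  finally show ?thesis .
qed

lemma simple_integral_increment_cells:
  assumes "s \<in> p ` {..n}" "t \<in> p ` {..n}" "s \<le> t"
  shows "simple_integral W k \<tau> \<xi> t \<omega> - simple_integral W k \<tau> \<xi> s \<omega> =
    (\<Sum>q<n. if s \<le> p q \<and> p q < t then cell_value q \<omega> *v (W (p (Suc q)) \<omega> - W (p q) \<omega>) else 0)"
  unfolding simple_integral_cells[OF assms(1)] simple_integral_cells[OF assms(2)] sum_subtractf[symmetric]
  using assms(3) by (intro sum.cong) auto

end

lemma simple_process_measurable_time: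
  "(\<lambda>u. simple_process k \<tau> \<xi> u \<omega>) \<in> borel_measurable borel"
  unfolding simple_process_def by measurable

lemma simple_process_norm_le: "norm (simple_process k \<tau> \<xi> u \<omega>) \<le> (\<Sum>j<k. norm (\<xi> j \<omega>))"
  unfolding simple_process_def
  by (rule order_trans[OF norm_sum]) (intro sum_mono, simp add: indicator_def)

lemma set_integrable_bounded:
  fixes g :: "real \<Rightarrow> real"
  assumes "g \<in> borel_measurable borel" "\<And>u. \<bar>g u\<bar> \<le> C"
  shows "set_integrable lborel {a..b} g"
proof (rule set_integrable_bound)
  show "set_integrable lborel {a..b} (\<lambda>u. C)"
    by (intro borel_integrable_atLeastAtMost' continuous_intros)
  show "set_borel_measurable lborel {a..b} g"
    using assms(1) unfolding set_borel_measurable_def by measurable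
  show "AE x in lborel. x \<in> {a..b} \<longrightarrow> norm (g x) \<le> norm C"
    using assms(2) by (intro AE_I2) (auto intro: order_trans[OF _ abs_ge_self])
qed

text \<open>The value at the left end point, which belongs to the preceding cell, does not affect the integral.\<close>

lemma set_integral_cell_const:
  fixes g :: "real \<Rightarrow> real"
  assumes "a \<le> b" "\<And>u. a < u \<Longrightarrow> u \<le> b \<Longrightarrow> g u = c" "set_integrable lborel {a..b} g"
  shows "(LINT u:{a..b}|lborel. g u) = c * (b - a)"
proof -
  have "(LINT u:{a..b}|lborel. g u) = integral {a..b} (\<lambda>u. c)"
  proof -
    have "((\<lambda>u. c) has_integral (b - a) *\<^sub>R c) {a..b}"
      by (rule has_integral_const_real[of c a b, simplified content_real[OF assms(1)]])
    then have h: "(g has_integral (b - a) *\<^sub>R c) {a..b}"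
      by (rule has_integral_spike_finite[of "{a}", rotated 2]) (use assms(2) in auto)
    show ?thesis
      using set_borel_integral_eq_integral(2)[OF assms(3)] integral_unique[OF h] assms(1) by simp
  qed
  also have "\<dots> = c * (b - a)"
    using assms(1) by simp
  finally show ?thesis .
qed

text \<open>Stopping a sum of squares at level \<open>\<delta>\<close>: the decision at step \<open>q\<close> only uses the terms up to
  \<open>q\<close>, so adaptedness is preserved.\<close>

lemma truncated_sum_le:
  fixes c :: "nat \<Rightarrow> 'b::real_normed_vector" and w :: "nat \<Rightarrow> real"
  assumes "0 \<le> \<delta>" "\<And>q. q < n \<Longrightarrow> 0 \<le> w q"
  defines "c' \<equiv> \<lambda>q. if (\<Sum>r<Suc q. (norm (c r))\<^sup>2 * w r) \<le> \<delta> then c q else 0"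
  shows "(\<Sum>q<n. (norm (c' q))\<^sup>2 * w q) \<le> \<delta>"
    and "(\<Sum>q<n. (norm (c q))\<^sup>2 * w q) \<le> \<delta> \<Longrightarrow> q < n \<Longrightarrow> c' q = c q"
proof -
  let ?A = "\<lambda>m. \<Sum>r<m. (norm (c r))\<^sup>2 * w r"
  have mono: "?A i \<le> ?A j" if "i \<le> j" "j \<le> n" for i j
    using that assms(2) by (intro sum_mono2) auto
  have eq: "c' q = c q" if "?A m \<le> \<delta>" "q < m" "m \<le> n" for q m
    using mono[of "Suc q" m] that unfolding c'_def by simp
  show "(\<Sum>q<n. (norm (c q))\<^sup>2 * w q) \<le> \<delta> \<Longrightarrow> q < n \<Longrightarrow> c' q = c q"
    using eq[of n q] by simp
  have "(\<Sum>q<m. (norm (c' q))\<^sup>2 * w q) \<le> \<delta>" if "m \<le> n" for m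
    using that
  proof (induction m)
    case (Suc m)
    show ?case
    proof (cases "?A (Suc m) \<le> \<delta>")
      case True
      then have "(\<Sum>q<Suc m. (norm (c' q))\<^sup>2 * w q) = ?A (Suc m)"
        using eq[OF True _ Suc.prems] by (intro sum.cong refl) simp
      then show ?thesis using True by simp
    next
      case False
      then have "c' m = 0" by (simp add: c'_def)
      then show ?thesis using Suc by simp
    qed
  qed (use assms(1) in simp)
  then show "(\<Sum>q<n. (norm (c' q))\<^sup>2 * w q) \<le> \<delta>" by simp
qed

lemma norm_matrix_square: "(norm (A :: real^'d::finite^'k::finite))\<^sup>2 = (\<Sum>j\<in>UNIV. (norm (A $ j))\<^sup>2)"
  by (simp add: norm_vec_def[of A] L2_set_def sum_nonneg)

lemma inner_matrix_vector: "(g::real^'k::finite) \<bullet> ((A::real^'d::finite^'k) *v v) = (transpose A *v g) \<bullet> v"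
  by (simp add: dot_lmul_matrix[symmetric] inner_commute)

lemma norm_transpose_vector_le: "norm (transpose (A::real^'d::finite^'k::finite) *v g) \<le> norm A * norm g"
proof -
  have "(norm (transpose A))\<^sup>2 = (norm A)\<^sup>2"
    unfolding norm_matrix_square norm_vec_square by (subst sum.swap) (simp add: transpose_def)
  then have "norm (transpose A) = norm A" by simp
  then show ?thesis using norm_matrix_vector_le[of "transpose A" g] by simp
qed

lemma measurable_transpose [measurable (raw)]:
  fixes A :: "'w \<Rightarrow> real^'d::finite^'k::finite"
  assumes "A \<in> borel_measurable N"
  shows "(\<lambda>w. transpose (A w)) \<in> borel_measurable N"
  by (rule borel_measurable_continuous_on[OF _ assms])
    (simp add: transpose_def continuous_intros)

context brownian_setting
begin

text \<open>The heart of the matter: \<open>D i\<close> is the increment over \<open>[t i, t (i + 1)]\<close> of the integral of a simple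
  process (weighted with \<open>\<psi> i\<close>), minus the increment of \<open>W\<close> multiplied with a matrix \<open>\<eta> i\<close> known at
  time \<open>t i\<close>.  On a common refinement of both grids, \<open>D i\<close> is a stochastic sum whose coefficients are
  the differences of the two integrands.  No moments of the time integral of the squared differences
  are available, but only its smallness with large probability.  Hence the sums are stopped at the
  moment when that integral exceeds \<open>\<delta>\<close>: the stopped version \<open>D'\<close> has second moments of order \<open>\<delta>\<close> by
  the isometry, and it coincides with \<open>D\<close> wherever the integral is at most \<open>\<delta>\<close>.\<close>

lemma simple_integral_deviation:
  fixes \<xi> :: "nat \<Rightarrow> 'w \<Rightarrow> real^'d^'k::finite" and \<eta> :: "nat \<Rightarrow> 'w \<Rightarrow> real^'d^'k" and g :: "nat \<Rightarrow> 'w \<Rightarrow> real^'k"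
    and N :: nat
  assumes simple: "simple_process_data M F k \<tau> \<xi>"
    and t: "0 \<le> t 0" "\<And>i. i < N \<Longrightarrow> t i \<le> t (Suc i)"
    and \<psi>: "\<And>i. i < N \<Longrightarrow> \<psi> i \<in> borel_measurable (F (t i))" "\<And>i. i < N \<Longrightarrow> bounded (\<psi> i ` space M)"
    and \<eta>: "\<And>i. i < N \<Longrightarrow> \<eta> i \<in> borel_measurable (F (t i))" "\<And>i. i < N \<Longrightarrow> bounded (\<eta> i ` space M)"
    and g: "\<And>i. i < N \<Longrightarrow> g i \<in> borel_measurable (F (t i))"
      "\<And>i \<omega>. i < N \<Longrightarrow> \<omega> \<in> space M \<Longrightarrow> norm (g i \<omega>) \<le> C"
    and "0 \<le> \<delta>" "0 \<le> C"
  defines "D \<equiv> \<lambda>i \<omega>. \<psi> i \<omega> *\<^sub>R (simple_integral W k \<tau> \<xi> (t (Suc i)) \<omega> - simple_integral W k \<tau> \<xi> (t i) \<omega>)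
      - \<eta> i \<omega> *v incr (t i) (t (Suc i)) \<omega>"
  shows "\<exists>D'. integrable M (\<lambda>\<omega>. (\<Sum>i<N. g i \<omega> \<bullet> D' i \<omega>)\<^sup>2) \<and>
      expectation (\<lambda>\<omega>. (\<Sum>i<N. g i \<omega> \<bullet> D' i \<omega>)\<^sup>2) \<le> real CARD('d) * (C\<^sup>2 * \<delta>) \<and>
      integrable M (\<lambda>\<omega>. \<Sum>i<N. (norm (D' i \<omega>))\<^sup>2) \<and>
      expectation (\<lambda>\<omega>. \<Sum>i<N. (norm (D' i \<omega>))\<^sup>2) \<le> real CARD('d) * \<delta> \<and>
      (\<forall>\<omega>\<in>space M. (\<Sum>i<N. LINT u:{t i..t (Suc i)}|lborel.
          (norm (\<psi> i \<omega> *\<^sub>R simple_process k \<tau> \<xi> u \<omega> - \<eta> i \<omega>))\<^sup>2) \<le> \<delta> \<longrightarrow>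
         (\<forall>i<N. D' i \<omega> = D i \<omega>))"
proof -
  have \<tau>: "0 \<le> \<tau> 0" "\<And>j. j < k \<Longrightarrow> \<tau> j \<le> \<tau> (Suc j)"
    and \<xi>: "\<And>j. j < k \<Longrightarrow> \<xi> j \<in> borel_measurable (F (\<tau> j))" "\<And>j. j < k \<Longrightarrow> bounded (\<xi> j ` space M)"
    using simple by (auto simp: simple_process_data_def)
  have t_le: "t i \<le> t j" if "i \<le> j" "j \<le> N" for i j
    using that by (intro steps_mono[of N t i j] t(2))
  have \<tau>_le: "\<tau> i \<le> \<tau> j" if "i \<le> j" "j \<le> k" for i j
    using that by (intro steps_mono[of k \<tau> i j] \<tau>(2))
  obtain p :: "nat \<Rightarrow> real" and n where p: "strict_mono_on {..n} p" and range: "p ` {..n} = t ` {..N} \<union> \<tau> ` {..k}"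
    by (rule finite_set_strict_enumeration[of "t ` {..N} \<union> \<tau> ` {..k}"]) auto
  have t_in: "t i \<in> p ` {..n}" if "i \<le> N" for i using that range by auto
  interpret refined_partition k \<tau> \<xi> n p
  proof
    show "\<tau> j \<in> p ` {..n}" if "j \<le> k" for j using that range by auto
  qed (use p \<tau>(2) in auto)
  have p_nonneg: "0 \<le> p q" if "q \<le> n" for q
  proof -
    have "p q \<in> t ` {..N} \<union> \<tau> ` {..k}" using that range by blast
    then show ?thesis using t(1) \<tau>(1) t_le[of 0] \<tau>_le[of 0] by (auto intro: order_trans)
  qed
  have p_step: "p q \<le> p (Suc q)" if "q < n" for q
    using strict_steps(2)[OF p, of q "Suc q"] that by simp
  let ?dW = "\<lambda>q. incr (p q) (p (Suc q))"
  \<comment> \<open>each cell lies in at most one block \<open>[t i, t (i + 1))\<close>\<close>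
  define blk where "blk q i \<longleftrightarrow> t i \<le> p q \<and> p q < t (Suc i)" for q i
  have blk_unique: "i = j" if "blk q i" "blk q j" "i < N" "j < N" for q i j
  proof (rule ccontr)
    assume "i \<noteq> j"
    then consider "Suc i \<le> j" | "Suc j \<le> i" by linarith
    then show False
      using that t_le[of "Suc i" j] t_le[of "Suc j" i] by cases (auto simp: blk_def)
  qed
  have blk_sum: "(\<Sum>i<N. if blk q i then f i else 0) = f j" if "blk q j" "j < N" for f :: "nat \<Rightarrow> 'z::comm_monoid_add" and q j
  proof -
    have "(\<Sum>i<N. if blk q i then f i else 0) = (\<Sum>i<N. if i = j then f i else 0)"
    proof (intro sum.cong refl)
      fix i assume "i \<in> {..<N}"
      then show "(if blk q i then f i else 0) = (if i = j then f i else 0)"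
        using blk_unique[of q i j] that by (cases "i = j") auto
    qed
    then show ?thesis using that(2) by simp
  qed
  have blk_sum_none: "(\<Sum>i<N. if blk q i then f i else 0) = 0" if "\<not> (\<exists>j<N. blk q j)"
    for f :: "nat \<Rightarrow> 'z::comm_monoid_add" and q
    using that by (intro sum.neutral) auto
  define b where "b q i \<omega> = \<psi> i \<omega> *\<^sub>R cell_value q \<omega> - \<eta> i \<omega>" for q i \<omega>
  define c where "c q \<omega> = (\<Sum>i<N. if blk q i then b q i \<omega> else 0)" for q \<omega>
  define c' where "c' q \<omega> = (if (\<Sum>r<Suc q. (norm (c r \<omega>))\<^sup>2 * (p (Suc r) - p r)) \<le> \<delta> then c q \<omega> else 0)" for q \<omega>
  define D' where "D' i \<omega> = (\<Sum>q<n. if blk q i then c' q \<omega> *v ?dW q \<omega> else 0)" for i \<omega>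
  have cell_meas: "cell_value q \<in> borel_measurable (F (p q))" for q
  proof -
    have "(\<lambda>\<omega>. if \<tau> j \<le> p q \<and> p q < \<tau> (Suc j) then \<xi> j \<omega> else 0) \<in> borel_measurable (F (p q))" if "j < k" for j
      using measurable_F_mono[OF \<xi>(1)[OF that], of "p q"] by (cases "\<tau> j \<le> p q \<and> p q < \<tau> (Suc j)") auto
    then show ?thesis unfolding cell_value_def[abs_def] by (intro borel_measurable_sum) auto
  qed
  have bounded_norm: "\<exists>B. \<forall>\<omega>\<in>space M. norm (f \<omega>) \<le> B" if "bounded (f ` space M)" for f :: "'w \<Rightarrow> 'z::real_normed_vector"
    using that by (auto simp: bounded_iff)
  have cell_bounded: "\<exists>B. \<forall>\<omega>\<in>space M. norm (cell_value q \<omega>) \<le> B" for q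
  proof -
    obtain B where B: "\<And>j \<omega>. j < k \<Longrightarrow> \<omega> \<in> space M \<Longrightarrow> norm (\<xi> j \<omega>) \<le> B j"
    proof -
      have "\<exists>B. \<forall>j\<in>{..<k}. \<forall>\<omega>\<in>space M. norm (\<xi> j \<omega>) \<le> B j"
        by (intro bchoice ballI bounded_norm \<xi>(2)) simp
      then show thesis using that by auto
    qed
    have "norm (cell_value q \<omega>) \<le> (\<Sum>j<k. \<bar>B j\<bar>)" if "\<omega> \<in> space M" for \<omega>
      unfolding cell_value_def
      by (rule order_trans[OF norm_sum], intro sum_mono) (use B[OF _ that] in \<open>auto intro: order_trans[OF _ abs_ge_self]\<close>)
    then show ?thesis by blast
  qed
  have b_meas: "(\<lambda>\<omega>. if blk q i then b q i \<omega> else 0) \<in> borel_measurable (F (p q))" if "i < N" for q i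
  proof (cases "blk q i")
    case True
    then have "t i \<le> p q" by (simp add: blk_def)
    then have "\<psi> i \<in> borel_measurable (F (p q))" "\<eta> i \<in> borel_measurable (F (p q))"
      using measurable_F_mono \<psi>(1)[OF that] \<eta>(1)[OF that] by blast+
    then show ?thesis using cell_meas[of q] True unfolding b_def by simp
  qed simp
  have c_meas: "c q \<in> borel_measurable (F (p q))" for q
    unfolding c_def[abs_def] using b_meas by (intro borel_measurable_sum) auto
  have b_bounded: "\<exists>B. \<forall>\<omega>\<in>space M. norm (b q i \<omega>) \<le> B" if "i < N" for q i
  proof -
    obtain B1 B2 B3 where "\<And>\<omega>. \<omega> \<in> space M \<Longrightarrow> norm (\<psi> i \<omega>) \<le> B1"
      "\<And>\<omega>. \<omega> \<in> space M \<Longrightarrow> norm (cell_value q \<omega>) \<le> B2" "\<And>\<omega>. \<omega> \<in> space M \<Longrightarrow> norm (\<eta> i \<omega>) \<le> B3"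
      using bounded_norm[OF \<psi>(2)[OF \<open>i < N\<close>]] cell_bounded[of q] bounded_norm[OF \<eta>(2)[OF \<open>i < N\<close>]] by blast
    then have "norm (b q i \<omega>) \<le> \<bar>B1\<bar> * \<bar>B2\<bar> + B3" if "\<omega> \<in> space M" for \<omega>
      unfolding b_def norm_scaleR using that
      by (intro order_trans[OF norm_triangle_ineq4] add_mono)
        (auto intro!: mult_mono intro: order_trans[OF _ abs_ge_self])
    then show ?thesis by blast
  qed
  have c_bounded: "\<exists>B. \<forall>\<omega>\<in>space M. norm (c q \<omega>) \<le> B" for q
  proof (cases "\<exists>j<N. blk q j")
    case True
    then obtain j where j: "j < N" "blk q j" by blast
    show ?thesis using b_bounded[OF j(1), of q] unfolding c_def blk_sum[OF j(2,1)] .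
  next
    case False
    show ?thesis unfolding c_def blk_sum_none[OF False] by (intro exI[of _ 0]) simp
  qed
  have c'_meas: "c' q \<in> borel_measurable (F (p q))" if "q < n" for q
  proof -
    have [measurable]: "c r \<in> borel_measurable (F (p q))" if "r \<le> q" for r
      by (rule measurable_F_mono[OF c_meas]) (use strict_steps(2)[OF p, of r q] that \<open>q < n\<close> in simp)
    have [measurable]: "(\<lambda>\<omega>. \<Sum>r<Suc q. (norm (c r \<omega>))\<^sup>2 * (p (Suc r) - p r)) \<in> borel_measurable (F (p q))"
      by (intro borel_measurable_sum borel_measurable_times borel_measurable_power borel_measurable_norm
          borel_measurable_const) simp
    show ?thesis unfolding c'_def[abs_def] by measurable
  qed
  have c'_bounded: "bounded (c' q ` space M)" for q
  proof -
    obtain B where B: "\<And>\<omega>. \<omega> \<in> space M \<Longrightarrow> norm (c q \<omega>) \<le> B" using c_bounded by blast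
    have "norm (c' q \<omega>) \<le> \<bar>B\<bar>" if "\<omega> \<in> space M" for \<omega>
      using B[OF that] by (auto simp: c'_def)
    then show ?thesis unfolding bounded_iff by blast
  qed
  note trunc = truncated_sum_le[OF \<open>0 \<le> \<delta>\<close>, of n "\<lambda>q. p (Suc q) - p q"]
  have c'_sum: "(\<Sum>q<n. (norm (c' q \<omega>))\<^sup>2 * (p (Suc q) - p q)) \<le> \<delta>" for \<omega>
    unfolding c'_def by (rule trunc(1)) (use p_step in auto)
  have sum_int: "integrable M (\<lambda>\<omega>. (norm (c' q \<omega>))\<^sup>2 * (p (Suc q) - p q))" if "q < n" for q
  proof -
    have "bounded ((\<lambda>\<omega>. norm (c' q \<omega>) * norm (c' q \<omega>)) ` space M)"
      using c'_bounded[of q] by (intro bounded_image_mult) (auto simp: bounded_iff)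
    then have "integrable M (\<lambda>\<omega>. (norm (c' q \<omega>))\<^sup>2)"
      using measurable_F_M[OF c'_meas[OF that]] by (intro integrable_bounded) (auto simp: power2_eq_square)
    then show ?thesis by simp
  qed
  have linear_part: "integrable M (\<lambda>\<omega>. (\<Sum>i<N. g i \<omega> \<bullet> D' i \<omega>)\<^sup>2) \<and>
      expectation (\<lambda>\<omega>. (\<Sum>i<N. g i \<omega> \<bullet> D' i \<omega>)\<^sup>2) \<le> real CARD('d) * (C\<^sup>2 * \<delta>)"
  proof -
    define e where "e q \<omega> = (\<Sum>i<N. if blk q i then transpose (c' q \<omega>) *v g i \<omega> else 0)" for q \<omega>
    have eq: "(\<Sum>i<N. g i \<omega> \<bullet> D' i \<omega>) = (\<Sum>q<n. e q \<omega> \<bullet> ?dW q \<omega>)" for \<omega>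
      unfolding D'_def e_def inner_sum_right inner_sum_left
      by (subst sum.swap) (intro sum.cong refl, simp add: inner_matrix_vector)
    have e_le: "norm (e q \<omega>) \<le> C * norm (c' q \<omega>)" if "\<omega> \<in> space M" for q \<omega>
    proof (cases "\<exists>j<N. blk q j")
      case True
      then obtain j where j: "j < N" "blk q j" by blast
      have "norm (e q \<omega>) \<le> norm (c' q \<omega>) * norm (g j \<omega>)"
        unfolding e_def blk_sum[OF j(2,1)] by (rule norm_transpose_vector_le)
      also have "\<dots> \<le> norm (c' q \<omega>) * C" using g(2)[OF j(1) that] by (intro mult_left_mono) auto
      finally show ?thesis by (simp add: mult.commute)
    next
      case False
      have "e q \<omega> = 0" unfolding e_def blk_sum_none[OF False] ..
      then show ?thesis using \<open>0 \<le> C\<close> by simp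
    qed
    have e_meas: "e q \<in> borel_measurable (F (p q))" if "q < n" for q
    proof -
      have "(\<lambda>\<omega>. if blk q i then transpose (c' q \<omega>) *v g i \<omega> else 0) \<in> borel_measurable (F (p q))" if "i < N" for i
      proof (cases "blk q i")
        case True
        then have "g i \<in> borel_measurable (F (p q))"
          using measurable_F_mono[OF g(1)[OF that]] by (simp add: blk_def)
        then show ?thesis using c'_meas[OF \<open>q < n\<close>] by measurable
      qed simp
      then show ?thesis unfolding e_def[abs_def] by (intro borel_measurable_sum) auto
    qed
    have e_bounded: "bounded (e q ` space M)" for q
    proof -
      obtain B where B: "\<And>\<omega>. \<omega> \<in> space M \<Longrightarrow> norm (c' q \<omega>) \<le> B" using bounded_norm[OF c'_bounded] by blast
      have "norm (e q \<omega>) \<le> C * B" if "\<omega> \<in> space M" for \<omega>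
        using e_le[OF that, of q] mult_left_mono[OF B[OF that] \<open>0 \<le> C\<close>] by linarith
      then show ?thesis unfolding bounded_iff by blast
    qed
    note S = stochastic_sum_second_moment[of p n e, OF p_nonneg[of 0] p_step e_meas e_bounded]
    have "expectation (\<lambda>\<omega>. \<Sum>q<n. (norm (e q \<omega>))\<^sup>2 * (p (Suc q) - p q)) \<le> expectation (\<lambda>\<omega>. C\<^sup>2 * \<delta>)"
    proof (rule integral_mono')
      fix \<omega> assume \<omega>: "\<omega> \<in> space M"
      have "(\<Sum>q<n. (norm (e q \<omega>))\<^sup>2 * (p (Suc q) - p q)) \<le> (\<Sum>q<n. C\<^sup>2 * ((norm (c' q \<omega>))\<^sup>2 * (p (Suc q) - p q)))"
      proof (rule sum_mono)
        fix q assume "q \<in> {..<n}"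
        have "(norm (e q \<omega>))\<^sup>2 \<le> C\<^sup>2 * (norm (c' q \<omega>))\<^sup>2"
          using power_mono[OF e_le[OF \<omega>, of q], of 2] by (simp add: power_mult_distrib)
        then show "(norm (e q \<omega>))\<^sup>2 * (p (Suc q) - p q) \<le> C\<^sup>2 * ((norm (c' q \<omega>))\<^sup>2 * (p (Suc q) - p q))"
          using p_step \<open>q \<in> {..<n}\<close> unfolding mult.assoc[symmetric] by (intro mult_right_mono) auto
      qed
      also have "\<dots> \<le> C\<^sup>2 * \<delta>"
        using c'_sum[of \<omega>] by (simp add: sum_distrib_left[symmetric] mult_left_mono)
      finally show "(\<Sum>q<n. (norm (e q \<omega>))\<^sup>2 * (p (Suc q) - p q)) \<le> C\<^sup>2 * \<delta>" .
      show "0 \<le> C\<^sup>2 * \<delta>" using \<open>0 \<le> \<delta>\<close> by simp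
    qed simp
    then have "expectation (\<lambda>\<omega>. (\<Sum>q<n. e q \<omega> \<bullet> ?dW q \<omega>)\<^sup>2) \<le> real CARD('d) * (C\<^sup>2 * \<delta>)"
      using S(2) by (simp add: prob_space order_trans[OF _ mult_left_mono])
    then show ?thesis unfolding eq using S(1) by simp
  qed
  have square_part: "integrable M (\<lambda>\<omega>. \<Sum>i<N. (norm (D' i \<omega>))\<^sup>2) \<and>
      expectation (\<lambda>\<omega>. \<Sum>i<N. (norm (D' i \<omega>))\<^sup>2) \<le> real CARD('d) * \<delta>"
  proof -
    define e where "e i j q \<omega> = (if blk q i then c' q \<omega> $ j else 0)" for i j q \<omega>
    have eq: "(\<Sum>i<N. (norm (D' i \<omega>))\<^sup>2) = (\<Sum>i<N. \<Sum>j\<in>UNIV. (\<Sum>q<n. e i j q \<omega> \<bullet> ?dW q \<omega>)\<^sup>2)" for \<omega>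
    proof -
      have "D' i \<omega> $ j = (\<Sum>q<n. e i j q \<omega> \<bullet> ?dW q \<omega>)" for i j
        unfolding D'_def e_def sum_component
        by (intro sum.cong refl) (simp add: matrix_vector_mul_component)
      then show ?thesis unfolding norm_vec_square by simp
    qed
    have e_meas: "e i j q \<in> borel_measurable (F (p q))" if "q < n" for i j q
      unfolding e_def[abs_def] using measurable_vec_nth_comp[OF c'_meas[OF that]] by (cases "blk q i") auto
    have e_bounded: "bounded (e i j q ` space M)" for i j q
    proof -
      obtain B where B: "\<And>\<omega>. \<omega> \<in> space M \<Longrightarrow> norm (c' q \<omega>) \<le> B" using bounded_norm[OF c'_bounded] by blast
      have "norm (e i j q \<omega>) \<le> \<bar>B\<bar>" if "\<omega> \<in> space M" for \<omega>
        using order_trans[OF Finite_Cartesian_Product.norm_nth_le B[OF that]] by (auto simp: e_def intro: order_trans[OF _ abs_ge_self])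
      then show ?thesis unfolding bounded_iff by blast
    qed
    have S: "integrable M (\<lambda>\<omega>. (\<Sum>q<n. e i j q \<omega> \<bullet> ?dW q \<omega>)\<^sup>2)"
      "expectation (\<lambda>\<omega>. (\<Sum>q<n. e i j q \<omega> \<bullet> ?dW q \<omega>)\<^sup>2) \<le>
        real CARD('d) * expectation (\<lambda>\<omega>. \<Sum>q<n. (norm (e i j q \<omega>))\<^sup>2 * (p (Suc q) - p q))" for i j
      by (rule stochastic_sum_second_moment[of p n "e i j", OF p_nonneg[of 0] p_step e_meas e_bounded]; simp)+
    have e_int: "integrable M (\<lambda>\<omega>. (norm (e i j q \<omega>))\<^sup>2)" if "q < n" for i j q
    proof -
      have "bounded ((\<lambda>\<omega>. norm (e i j q \<omega>) * norm (e i j q \<omega>)) ` space M)"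
        using e_bounded[of i j q] by (intro bounded_image_mult) (auto simp: bounded_iff)
      then show ?thesis
        using measurable_F_M[OF e_meas[OF that]] by (intro integrable_bounded) (auto simp: power2_eq_square)
    qed
    have "expectation (\<lambda>\<omega>. \<Sum>i<N. (norm (D' i \<omega>))\<^sup>2)
        = (\<Sum>i<N. \<Sum>j\<in>UNIV. expectation (\<lambda>\<omega>. (\<Sum>q<n. e i j q \<omega> \<bullet> ?dW q \<omega>)\<^sup>2))"
      unfolding eq using S(1) by simp
    also have "\<dots> \<le> (\<Sum>i<N. \<Sum>j\<in>UNIV. real CARD('d) * expectation (\<lambda>\<omega>. \<Sum>q<n. (norm (e i j q \<omega>))\<^sup>2 * (p (Suc q) - p q)))"
      by (intro sum_mono S(2))
    also have "\<dots> = real CARD('d) * expectation (\<lambda>\<omega>. \<Sum>i<N. \<Sum>j\<in>UNIV. \<Sum>q<n. (norm (e i j q \<omega>))\<^sup>2 * (p (Suc q) - p q))"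
    proof -
      have i1: "integrable M (\<lambda>\<omega>. \<Sum>q<n. (norm (e i j q \<omega>))\<^sup>2 * (p (Suc q) - p q))" for i j
        using e_int by (intro Bochner_Integration.integrable_sum integrable_mult_left) simp
      have i2: "integrable M (\<lambda>\<omega>. \<Sum>j\<in>UNIV. \<Sum>q<n. (norm (e i j q \<omega>))\<^sup>2 * (p (Suc q) - p q))" for i
        by (intro Bochner_Integration.integrable_sum i1)
      show ?thesis
        by (simp only: Bochner_Integration.integral_sum[OF i1] Bochner_Integration.integral_sum[OF i2] sum_distrib_left)
    qed
    also have "\<dots> \<le> real CARD('d) * expectation (\<lambda>\<omega>. \<delta>)"
    proof (intro mult_left_mono integral_mono')
      fix \<omega> assume \<omega>: "\<omega> \<in> space M"
      have "(\<Sum>i<N. \<Sum>j\<in>UNIV. \<Sum>q<n. (norm (e i j q \<omega>))\<^sup>2 * (p (Suc q) - p q))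
         = (\<Sum>i<N. \<Sum>q<n. \<Sum>j\<in>UNIV. (norm (e i j q \<omega>))\<^sup>2 * (p (Suc q) - p q))"
        by (intro sum.cong refl) (rule sum.swap)
      also have "\<dots> = (\<Sum>i<N. \<Sum>q<n. if blk q i then (norm (c' q \<omega>))\<^sup>2 * (p (Suc q) - p q) else 0)"
        by (intro sum.cong refl) (simp add: e_def norm_matrix_square sum_distrib_right)
      also have "\<dots> = (\<Sum>q<n. \<Sum>i<N. if blk q i then (norm (c' q \<omega>))\<^sup>2 * (p (Suc q) - p q) else 0)"
        by (rule sum.swap)
      also have "\<dots> \<le> (\<Sum>q<n. (norm (c' q \<omega>))\<^sup>2 * (p (Suc q) - p q))"
      proof (rule sum_mono)
        fix q assume q: "q \<in> {..<n}"
        show "(\<Sum>i<N. if blk q i then (norm (c' q \<omega>))\<^sup>2 * (p (Suc q) - p q) else 0)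
          \<le> (norm (c' q \<omega>))\<^sup>2 * (p (Suc q) - p q)"
        proof (cases "\<exists>j<N. blk q j")
          case True
          then obtain j where "j < N" "blk q j" by blast
          then show ?thesis using blk_sum[of q j "\<lambda>_. (norm (c' q \<omega>))\<^sup>2 * (p (Suc q) - p q)"] by simp
        next
          case False
          show ?thesis unfolding blk_sum_none[OF False] using p_step q by simp
        qed
      qed
      also have "\<dots> \<le> \<delta>" by (rule c'_sum)
      finally show "(\<Sum>i<N. \<Sum>j\<in>UNIV. \<Sum>q<n. (norm (e i j q \<omega>))\<^sup>2 * (p (Suc q) - p q)) \<le> \<delta>" .
    qed (use \<open>0 \<le> \<delta>\<close> in auto)
    finally have "expectation (\<lambda>\<omega>. \<Sum>i<N. (norm (D' i \<omega>))\<^sup>2) \<le> real CARD('d) * \<delta>"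
      by (simp add: prob_space)
    moreover have "integrable M (\<lambda>\<omega>. \<Sum>i<N. (norm (D' i \<omega>))\<^sup>2)"
      unfolding eq using S(1) by simp
    ultimately show ?thesis by blast
  qed
  have agree: "D' i \<omega> = D i \<omega>"
    if \<omega>: "\<omega> \<in> space M" and small: "(\<Sum>i<N. LINT u:{t i..t (Suc i)}|lborel.
          (norm (\<psi> i \<omega> *\<^sub>R simple_process k \<tau> \<xi> u \<omega> - \<eta> i \<omega>))\<^sup>2) \<le> \<delta>" and i: "i < N" for \<omega> i
  proof -
    have block_integral: "(\<Sum>q<n. if blk q i then (norm (b q i \<omega>))\<^sup>2 * (p (Suc q) - p q) else 0)
        = (LINT u:{t i..t (Suc i)}|lborel. (norm (\<psi> i \<omega> *\<^sub>R simple_process k \<tau> \<xi> u \<omega> - \<eta> i \<omega>))\<^sup>2)"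
      if "i < N" for i
    proof -
      let ?h = "\<lambda>u. (norm (\<psi> i \<omega> *\<^sub>R simple_process k \<tau> \<xi> u \<omega> - \<eta> i \<omega>))\<^sup>2"
      let ?w = "\<lambda>s. LINT u:{t i..s}|lborel. ?h u"
      have "?h \<in> borel_measurable borel"
        using simple_process_measurable_time[of k \<tau> \<xi> \<omega>] by measurable
      moreover have "\<bar>?h u\<bar> \<le> (\<bar>\<psi> i \<omega>\<bar> * (\<Sum>j<k. norm (\<xi> j \<omega>)) + norm (\<eta> i \<omega>))\<^sup>2" for u
        unfolding abs_power2
        by (intro power_mono order_trans[OF norm_triangle_ineq4] add_mono)
          (auto intro!: mult_left_mono simple_process_norm_le)
      ultimately have int: "set_integrable lborel {x..y} ?h" for x y
        by (rule set_integrable_bounded)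
      have ti: "t i \<le> t (Suc i)" "t i \<in> p ` {..n}" "t (Suc i) \<in> p ` {..n}"
        using t(2)[OF that] t_in[of i] t_in[of "Suc i"] that by auto
      have "?w (p (Suc q)) - ?w (p q) = (norm (b q i \<omega>))\<^sup>2 * (p (Suc q) - p q)" if "q < n" "blk q i" for q
      proof -
        have "?w (p (Suc q)) = ?w (p q) + (LINT u:{p q..p (Suc q)}|lborel. ?h u)"
          using that(2) p_step[OF that(1)] by (intro set_integral_combine int) (auto simp: blk_def)
        also have "(LINT u:{p q..p (Suc q)}|lborel. ?h u) = (norm (b q i \<omega>))\<^sup>2 * (p (Suc q) - p q)"
          by (intro set_integral_cell_const p_step that(1) int) (simp add: simple_process_on_cell[OF that(1)] b_def)
        finally show ?thesis by simp
      qed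
      then have "(\<Sum>q<n. if blk q i then (norm (b q i \<omega>))\<^sup>2 * (p (Suc q) - p q) else 0)
          = (\<Sum>q<n. if t i \<le> p q \<and> p q < t (Suc i) then ?w (p (Suc q)) - ?w (p q) else 0)"
        by (intro sum.cong refl) (simp add: blk_def)
      also have "\<dots> = ?w (t (Suc i)) - ?w (t i)"
        by (rule sum_cells_telescope[OF p ti(2,3,1)])
      also have "?w (t i) = 0"
        using set_integral_cell_const[of "t i" "t i" ?h 0] int by simp
      finally show ?thesis by simp
    qed
    have "(\<Sum>q<n. (norm (c q \<omega>))\<^sup>2 * (p (Suc q) - p q))
        = (\<Sum>q<n. \<Sum>i<N. if blk q i then (norm (b q i \<omega>))\<^sup>2 * (p (Suc q) - p q) else 0)"
    proof (intro sum.cong refl)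
      fix q
      show "(norm (c q \<omega>))\<^sup>2 * (p (Suc q) - p q) = (\<Sum>i<N. if blk q i then (norm (b q i \<omega>))\<^sup>2 * (p (Suc q) - p q) else 0)"
      proof (cases "\<exists>j<N. blk q j")
        case True
        then obtain j where j: "j < N" "blk q j" by blast
        show ?thesis unfolding c_def blk_sum[OF j(2,1)] ..
      next
        case False
        show ?thesis unfolding c_def blk_sum_none[OF False] by simp
      qed
    qed
    also have "\<dots> = (\<Sum>i<N. \<Sum>q<n. if blk q i then (norm (b q i \<omega>))\<^sup>2 * (p (Suc q) - p q) else 0)"
      by (rule sum.swap)
    also have "\<dots> \<le> \<delta>" using small block_integral by simp
    finally have le: "(\<Sum>q<n. (norm (c q \<omega>))\<^sup>2 * (p (Suc q) - p q)) \<le> \<delta>" .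
    have c'_eq: "c' q \<omega> = c q \<omega>" if "q < n" for q
      unfolding c'_def by (rule trunc(2)[OF _ le that]) (use p_step in auto)
    have ti: "t i \<in> p ` {..n}" "t (Suc i) \<in> p ` {..n}" "t i \<le> t (Suc i)"
      using t_in[of i] t_in[of "Suc i"] i t(2) by auto
    have "D' i \<omega> = (\<Sum>q<n. if blk q i then b q i \<omega> *v ?dW q \<omega> else 0)"
      unfolding D'_def
    proof (intro sum.cong refl)
      fix q assume "q \<in> {..<n}"
      then show "(if blk q i then c' q \<omega> *v ?dW q \<omega> else 0) = (if blk q i then b q i \<omega> *v ?dW q \<omega> else 0)"
        using c'_eq[of q] by (auto simp: c_def blk_sum[OF _ i])
    qed
    also have "\<dots> = \<psi> i \<omega> *\<^sub>R (\<Sum>q<n. if blk q i then cell_value q \<omega> *v ?dW q \<omega> else 0)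
        - \<eta> i \<omega> *v (\<Sum>q<n. if blk q i then ?dW q \<omega> else 0)"
      unfolding linear_sum[OF matrix_vector_mul_linear] scaleR_sum_right sum_subtractf[symmetric]
      by (intro sum.cong refl) (simp add: b_def matrix_vector_mult_diff_rdistrib scaleR_matrix_vector_assoc)
    also have "\<dots> = D i \<omega>"
      using simple_integral_increment_cells[OF ti, of W \<omega>] sum_cells_telescope[OF p ti, of "\<lambda>s. W s \<omega>"]
      by (simp add: D_def blk_def)
    finally show ?thesis .
  qed
  show ?thesis
    using linear_part square_part agree by blast
qed

end

section \<open>Progressively measurable processes\<close>

lemma prog_measurableD:
  "prog_measurable F Z \<Longrightarrow> 0 \<le> T \<Longrightarrow>
    (\<lambda>(t, \<omega>). Z t \<omega>) \<in> borel_measurable (restrict_space borel {0..T} \<Otimes>\<^sub>M F T)"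
  by (simp add: prog_measurable_def)

lemma prog_measurable_adapted:
  assumes "prog_measurable F Z" "0 \<le> t"
  shows "Z t \<in> borel_measurable (F t)"
proof -
  have "(\<lambda>\<omega>. (t, \<omega>)) \<in> F t \<rightarrow>\<^sub>M restrict_space borel {0..t} \<Otimes>\<^sub>M F t"
    using assms(2) by (intro measurable_Pair measurable_const measurable_ident_sets) (auto simp: space_restrict_space)
  from measurable_compose[OF this prog_measurableD[OF assms]] show ?thesis by simp
qed

text \<open>Composing with the retraction of the real line onto \<open>[0, T]\<close> gives an integrand that is measurable
  on the whole product space, to which Fubini's theorem applies.\<close>

lemma time_integral_measurable:
  fixes Z :: "real \<Rightarrow> 'w \<Rightarrow> 'b::euclidean_space"
  assumes Z: "(\<lambda>(u, \<omega>). Z u \<omega>) \<in> borel_measurable (restrict_space borel {0..T} \<Otimes>\<^sub>M N)"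
    and "0 \<le> T" "0 \<le> a" "b \<le> T"
  shows "(\<lambda>\<omega>. LINT u:{a..b}|lborel. Z u \<omega>) \<in> borel_measurable N"
proof -
  have "(\<lambda>u. max 0 (min T u)) \<in> borel \<rightarrow>\<^sub>M restrict_space borel {0..T}"
    using assms(2) by (intro measurable_restrict_space2) auto
  then have "(\<lambda>p. (max 0 (min T (snd p)), fst p)) \<in> N \<Otimes>\<^sub>M lborel \<rightarrow>\<^sub>M restrict_space borel {0..T} \<Otimes>\<^sub>M N"
    by (intro measurable_Pair measurable_fst measurable_compose[OF measurable_snd]) auto
  from measurable_compose[OF this Z]
  have [measurable]: "(\<lambda>p. Z (max 0 (min T (snd p))) (fst p)) \<in> borel_measurable (N \<Otimes>\<^sub>M lborel)"
    by simp
  have "(\<lambda>\<omega>. \<integral>u. indicator {a..b} u *\<^sub>R Z (max 0 (min T u)) \<omega> \<partial>lborel) \<in> borel_measurable N"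
    by (rule lborel.borel_measurable_lebesgue_integral) (simp add: case_prod_beta, measurable)
  also have "(\<lambda>\<omega>. \<integral>u. indicator {a..b} u *\<^sub>R Z (max 0 (min T u)) \<omega> \<partial>lborel) = (\<lambda>\<omega>. LINT u:{a..b}|lborel. Z u \<omega>)"
    unfolding set_lebesgue_integral_def
    using assms(3,4) by (intro ext Bochner_Integration.integral_cong) (auto simp: indicator_def)
  finally show ?thesis .
qed

context brownian_setting
begin

lemma prog_measurable_jointly:
  assumes "prog_measurable F Z" "0 \<le> T"
  shows "(\<lambda>(u, \<omega>). Z u \<omega>) \<in> borel_measurable (restrict_space borel {0..T} \<Otimes>\<^sub>M M)"
proof -
  have "(\<lambda>\<omega>. \<omega>) \<in> M \<rightarrow>\<^sub>M F T"
    by (rule measurable_from_subalg[OF subalgebra_F measurable_ident_sets[OF refl]])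
  then have "(\<lambda>p. (fst p, snd p)) \<in> restrict_space borel {0..T} \<Otimes>\<^sub>M M \<rightarrow>\<^sub>M restrict_space borel {0..T} \<Otimes>\<^sub>M F T"
    by (intro measurable_Pair measurable_fst measurable_compose[OF measurable_snd])
  from measurable_compose[OF this prog_measurableD[OF assms]] show ?thesis
    by (simp add: case_prod_beta)
qed

lemma prog_measurable_at: "prog_measurable F Z \<Longrightarrow> 0 \<le> t \<Longrightarrow> Z t \<in> borel_measurable M"
  by (rule measurable_F_M[OF prog_measurable_adapted])

lemma simple_process_jointly:
  assumes "simple_process_data M F k \<tau> \<xi>"
  shows "(\<lambda>(u, \<omega>). simple_process k \<tau> \<xi> u \<omega>) \<in> borel_measurable (restrict_space borel {0..T} \<Otimes>\<^sub>M M)"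
proof -
  have [measurable]: "\<xi> j \<in> borel_measurable M" if "j < k" for j
    using assms that measurable_F_M by (auto simp: simple_process_data_def)
  have [measurable]: "(\<lambda>u. u) \<in> borel_measurable (restrict_space borel {0..T} :: real measure)"
    by (intro measurable_restrict_space1) simp
  have [measurable]: "(\<lambda>p. fst p) \<in> borel_measurable (restrict_space borel {0..T} \<Otimes>\<^sub>M M :: (real \<times> 'w) measure)"
    by (rule measurable_compose[OF measurable_fst]) measurable
  have "(\<lambda>p. indicator {\<tau> j<..\<tau> (Suc j)} (fst p) *\<^sub>R \<xi> j (snd p))
      \<in> borel_measurable (restrict_space borel {0..T} \<Otimes>\<^sub>M M)" if "j < k" for j
    using \<open>j < k\<close> by measurable
  then show ?thesis
    unfolding simple_process_def case_prod_beta by (intro borel_measurable_sum) auto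
qed

lemma simple_integral_measurable:
  assumes "simple_process_data M F k \<tau> \<xi>" "0 \<le> T"
  shows "simple_integral W k \<tau> \<xi> T \<in> borel_measurable M"
proof -
  have \<tau>: "0 \<le> \<tau> j" if "j \<le> k" for j
    using assms(1) that steps_mono[of k \<tau> 0 j] by (auto simp: simple_process_data_def intro: order_trans)
  have "\<xi> j \<in> borel_measurable M" if "j < k" for j
    using assms that measurable_F_M by (auto simp: simple_process_data_def)
  moreover have "W (min T (\<tau> j)) \<in> borel_measurable M" if "j \<le> k" for j
    using measurable_F_M[OF W_adapted] assms(2) \<tau>[OF that] by simp
  ultimately show ?thesis
    unfolding simple_integral_def[abs_def]
    by (intro borel_measurable_sum measurable_matrix_vector_mult borel_measurable_diff) auto
qed

end

lemma set_integrable_square_difference: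
  fixes S H :: "real \<Rightarrow> 'b::euclidean_space"
  assumes S: "S \<in> borel_measurable borel" "\<And>u. norm (S u) \<le> C" and H: "continuous_on {a..b} H"
  shows "set_integrable lborel {a..b} (\<lambda>u. (norm (S u - H u))\<^sup>2)"
proof -
  have "bounded (H ` {a..b})"
    by (rule compact_imp_bounded[OF compact_continuous_image[OF H]]) simp
  then obtain B where "\<forall>x\<in>H ` {a..b}. norm x \<le> B"
    unfolding bounded_iff by blast
  then have B: "\<And>u. u \<in> {a..b} \<Longrightarrow> norm (H u) \<le> B" by blast
  have [measurable]: "(\<lambda>u. indicator {a..b} u *\<^sub>R H u) \<in> borel_measurable borel"
    by (rule borel_measurable_continuous_on_indicator[OF _ H]) simp
  have [measurable]: "S \<in> borel_measurable borel" by fact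
  have "(\<lambda>u. indicator {a..b} u *\<^sub>R (norm (S u - H u))\<^sup>2) =
    (\<lambda>u. indicator {a..b} u * (norm (S u - indicator {a..b} u *\<^sub>R H u))\<^sup>2)"
    by (auto simp: indicator_def)
  then have meas: "set_borel_measurable lborel {a..b} (\<lambda>u. (norm (S u - H u))\<^sup>2)"
    unfolding set_borel_measurable_def by simp
  show ?thesis
  proof (rule set_integrable_bound)
    show "set_integrable lborel {a..b} (\<lambda>u. (C + B)\<^sup>2)"
      by (intro borel_integrable_atLeastAtMost' continuous_intros)
    have "(norm (S u - H u))\<^sup>2 \<le> (C + B)\<^sup>2" if "u \<in> {a..b}" for u
      using S(2)[of u] B[OF that] norm_triangle_ineq4[of "S u" "H u"] by (intro power_mono) auto
    then show "AE u in lborel. u \<in> {a..b} \<longrightarrow> norm ((norm (S u - H u))\<^sup>2) \<le> norm ((C + B)\<^sup>2)"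
      unfolding real_norm_def abs_power2 by (intro AE_I2 impI)
  qed (rule meas)
qed

section \<open>Ito processes on fine grids\<close>

locale ito_process = brownian_setting M F W
  for M :: "'w measure" and F :: "real \<Rightarrow> 'w measure" and W :: "real \<Rightarrow> 'w \<Rightarrow> real^'d::finite" +
  fixes y b N :: "real \<Rightarrow> 'w \<Rightarrow> real^'m::finite" and H :: "real \<Rightarrow> 'w \<Rightarrow> real^'d^'m"
  assumes y_prog: "prog_measurable F y" and y_continuous: "continuous_paths M y"
    and b_prog: "prog_measurable F b" and b_continuous: "continuous_paths M b"
    and H_continuous: "continuous_paths M H"
    and N_integral: "is_ito_integral M F W H N"
    and increment: "AE \<omega> in M. \<forall>s t. 0 \<le> s \<and> s \<le> t \<longrightarrow>
      y t \<omega> - y s \<omega> = (LINT u:{s..t}|lborel. b u \<omega>) + (N t \<omega> - N s \<omega>)"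
begin

lemma H_prog: "prog_measurable F H"
  using N_integral by (simp add: is_ito_integral_def)

lemma AE_continuous_H: "AE \<omega> in M. continuous_on {0..} (\<lambda>t. H t \<omega>)"
  using H_continuous by (simp add: continuous_paths_def)

text \<open>The paths of \<open>H\<close> are continuous, so this is a left-point sum whose limit is the integral of \<open>0\<close>.\<close>

lemma H_oscillation_small:
  assumes "0 \<le> T"
  shows "small_in_prob M (\<lambda>n \<omega>. \<Sum>i<grid_size n.
    LINT u:{grid T n i..grid T n (Suc i)}|lborel. (norm (H u \<omega> - H (grid T n i) \<omega>))\<^sup>2)"
proof (rule AE_tendsto_imp_small_in_prob)
  fix n
  have [measurable]: "H s \<in> borel_measurable M" if "0 \<le> s" for s
    by (rule prog_measurable_at[OF H_prog that])
  have [measurable]: "(\<lambda>(u, \<omega>). H u \<omega>) \<in> borel_measurable (restrict_space borel {0..T} \<Otimes>\<^sub>M M)"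
    by (rule prog_measurable_jointly[OF H_prog assms])
  show "(\<lambda>\<omega>. \<Sum>i<grid_size n.
    LINT u:{grid T n i..grid T n (Suc i)}|lborel. (norm (H u \<omega> - H (grid T n i) \<omega>))\<^sup>2) \<in> borel_measurable M"
    using grid_nonneg[OF assms, of n]
    by (intro borel_measurable_sum time_integral_measurable[of _ T] assms grid_le) measurable
next
  show "AE \<omega> in M. (\<lambda>n. \<Sum>i<grid_size n.
    LINT u:{grid T n i..grid T n (Suc i)}|lborel. (norm (H u \<omega> - H (grid T n i) \<omega>))\<^sup>2) \<longlonglongrightarrow> 0"
    using AE_continuous_H
  proof eventually_elim
    case (elim \<omega>)
    have "continuous_on ({0..T} \<times> {0..T}) (\<lambda>(s, u). (norm (H u \<omega> - H s \<omega>))\<^sup>2)"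
      unfolding case_prod_beta
      by (intro continuous_intros continuous_on_compose2[OF elim]) auto
    from left_point_sums_converge[OF assms this] show ?case by simp
  qed
qed

text \<open>The stochastic integral is a limit of integrals of simple processes \<open>S\<close>, and on a fine grid \<open>S\<close> is
  close to \<open>H\<close>, which is close to its value at the left end point.  So the differences of integrands
  in the estimate for simple processes are small, and the errors are negligible, both in the sum of
  their squares and when summed against bounded coefficients known at the left end points.  For a
  fixed grid, \<open>S\<close> is chosen late in the approximating sequence.  The weights \<open>\<psi>\<close> select the left end
  points where \<open>H\<close> is bounded.\<close>

lemma integral_increment_deviation:
  fixes \<psi> :: "nat \<Rightarrow> nat \<Rightarrow> 'w \<Rightarrow> real" and g :: "nat \<Rightarrow> nat \<Rightarrow> 'w \<Rightarrow> real^'m"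
  assumes T: "0 \<le> T"
    and \<psi>: "\<And>n i. \<psi> n i \<in> borel_measurable (F (grid T n i))" "\<And>n i \<omega>. \<psi> n i \<omega> = 0 \<or> \<psi> n i \<omega> = 1"
    and L: "\<And>n i \<omega>. \<psi> n i \<omega> = 1 \<Longrightarrow> norm (H (grid T n i) \<omega>) \<le> L"
    and g: "\<And>n i. g n i \<in> borel_measurable (F (grid T n i))" "\<And>n i \<omega>. \<omega> \<in> space M \<Longrightarrow> norm (g n i \<omega>) \<le> C"
    and "0 \<le> C"
  defines "E \<equiv> \<lambda>n i \<omega>. \<psi> n i \<omega> *\<^sub>R (N (grid T n (Suc i)) \<omega> - N (grid T n i) \<omega>
      - H (grid T n i) \<omega> *v incr (grid T n i) (grid T n (Suc i)) \<omega>)"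
  shows "small_in_prob M (\<lambda>n \<omega>. \<Sum>i<grid_size n. g n i \<omega> \<bullet> E n i \<omega>)"
    and "small_in_prob M (\<lambda>n \<omega>. \<Sum>i<grid_size n. (norm (E n i \<omega>))\<^sup>2)"
proof -
  obtain k \<tau> \<xi> where simple: "\<And>r. simple_process_data M F (k r) (\<tau> r) (\<xi> r)"
    and conv_square: "conv_in_prob M (\<lambda>r \<omega>. LINT t:{0..T}|lborel.
                (norm (simple_process (k r) (\<tau> r) (\<xi> r) t \<omega> - H t \<omega>))\<^sup>2) (\<lambda>\<omega>. 0)"
    and conv_int: "\<And>s. 0 \<le> s \<Longrightarrow> conv_in_prob M (\<lambda>r. simple_integral W (k r) (\<tau> r) (\<xi> r) s) (N s)"
    using N_integral T unfolding is_ito_integral_def by blast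
  let ?I = "\<lambda>r. simple_integral W (k r) (\<tau> r) (\<xi> r)" and ?S = "\<lambda>r. simple_process (k r) (\<tau> r) (\<xi> r)"
  have square_small: "small_in_prob M (\<lambda>r \<omega>. norm ((LINT t:{0..T}|lborel. (norm (?S r t \<omega> - H t \<omega>))\<^sup>2) - 0))"
    by (rule conv_in_prob_imp_small_in_prob[OF conv_square])
  have int_small: "small_in_prob M (\<lambda>r \<omega>. norm (?I r s \<omega> - N s \<omega>))" if "0 \<le> s" for s
    by (rule conv_in_prob_imp_small_in_prob[OF conv_int[OF that]])
  have bound: "\<forall>\<^sub>F n in sequentially. mostly M d (\<lambda>\<omega>.
      \<bar>\<Sum>i<grid_size n. g n i \<omega> \<bullet> E n i \<omega>\<bar> \<le> e \<and> \<bar>\<Sum>i<grid_size n. (norm (E n i \<omega>))\<^sup>2\<bar> \<le> e)"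
    if "0 < e" "0 < d" for e d
  proof -
    \<comment> \<open>Markov's inequality at level \<open>c\<close> controls both sums; \<open>\<delta>\<close> makes their second moments at most
      \<open>c d / 8\<close>, one eighth of \<open>d\<close> being spent on each exceptional event\<close>
    define c where "c = min ((e / 2)\<^sup>2) (e / 4)"
    have c: "0 < c" "c \<le> (e / 2)\<^sup>2" "c \<le> e / 4" using \<open>0 < e\<close> by (auto simp: c_def)
    define D where "D = real CARD('d) * (C\<^sup>2 + 1)"
    have D: "0 < D" by (simp add: D_def add_nonneg_pos)
    define \<delta> where "\<delta> = c * (d / 8) / D"
    have \<delta>: "0 < \<delta>" using c(1) D \<open>0 < d\<close> by (simp add: \<delta>_def)
    have D\<delta>: "real CARD('d) * (C\<^sup>2 * \<delta>) \<le> c * (d / 8)" "real CARD('d) * \<delta> \<le> c * (d / 8)"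
    proof -
      have eq: "D * \<delta> = c * (d / 8)" using D by (simp add: \<delta>_def)
      have "real CARD('d) * (C\<^sup>2 * \<delta>) + real CARD('d) * \<delta> = D * \<delta>" by (simp add: D_def algebra_simps)
      moreover have "0 \<le> real CARD('d) * (C\<^sup>2 * \<delta>)" "0 \<le> real CARD('d) * \<delta>" using \<delta> by simp_all
      ultimately show "real CARD('d) * (C\<^sup>2 * \<delta>) \<le> c * (d / 8)" "real CARD('d) * \<delta> \<le> c * (d / 8)"
        using eq by linarith+
    qed
    have "0 < \<delta> / 4" "0 < d / 8" using \<delta> \<open>0 < d\<close> by auto
    obtain n0 where n0: "T < real n0" using reals_Archimedean2 by blast
    have "\<forall>\<^sub>F n in sequentially. n0 \<le> n" by (rule eventually_ge_at_top)
    with small_in_probD[OF H_oscillation_small[OF T] \<open>0 < \<delta> / 4\<close> \<open>0 < d / 8\<close>]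
    show ?thesis
    proof eventually_elim
      case (elim n)
      let ?t = "grid T n" and ?N = "grid_size n"
      have tN: "?t ?N = T" using elim(2) n0 by (intro grid_end) auto
      have t0: "?t 0 = 0" by (rule grid_0[OF T])
      have t_step: "?t i \<le> ?t (Suc i)" for i by (rule grid_mono) simp
      have t_nonneg: "0 \<le> ?t i" for i by (rule grid_nonneg[OF T])
      \<comment> \<open>the tolerance for replacing the integral by its approximation at all grid points at once\<close>
      define e' where "e' = min 1 (e / (16 * (real ?N + 1) * (C + 1)))"
      have e': "0 < e'" "e' \<le> 1" "e' * (16 * (real ?N + 1) * (C + 1)) \<le> e"
      proof -
        have pos: "0 < 16 * (real ?N + 1) * (C + 1)" using \<open>0 \<le> C\<close> by (intro mult_pos_pos add_nonneg_pos) auto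
        then show "0 < e'" "e' \<le> 1" using \<open>0 < e\<close> by (auto simp: e'_def)
        have "e' \<le> e / (16 * (real ?N + 1) * (C + 1))" by (simp add: e'_def)
        then show "e' * (16 * (real ?N + 1) * (C + 1)) \<le> e" using pos by (simp add: pos_le_divide_eq)
      qed
      have sum_small: "small_in_prob M (\<lambda>r \<omega>. \<Sum>i\<le>?N. norm (?I r (?t i) \<omega> - N (?t i) \<omega>))"
        by (intro small_in_prob_sum int_small t_nonneg)
      from eventually_happens'[OF sequentially_bot eventually_conj[OF
          small_in_probD[OF square_small \<open>0 < \<delta> / 4\<close> \<open>0 < d / 8\<close>] small_in_probD[OF sum_small e'(1) \<open>0 < d / 8\<close>]]]
      obtain r where r: "mostly M (d / 8) (\<lambda>\<omega>.
            \<bar>norm ((LINT t:{0..T}|lborel. (norm (?S r t \<omega> - H t \<omega>))\<^sup>2) - 0)\<bar> \<le> \<delta> / 4)"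
        "mostly M (d / 8) (\<lambda>\<omega>. \<bar>\<Sum>i\<le>?N. norm (?I r (?t i) \<omega> - N (?t i) \<omega>)\<bar> \<le> e')"
        by blast
      define \<eta> where "\<eta> i \<omega> = \<psi> n i \<omega> *\<^sub>R H (?t i) \<omega>" for i \<omega>
      have \<eta>_meas: "\<eta> i \<in> borel_measurable (F (?t i))" for i
        unfolding \<eta>_def[abs_def] using \<psi>(1)[of n i] prog_measurable_adapted[OF H_prog t_nonneg[of i]]
        by (intro borel_measurable_scaleR)
      have \<eta>_bounded: "bounded (\<eta> i ` space M)" for i
      proof -
        have "norm (\<eta> i \<omega>) \<le> \<bar>L\<bar>" for \<omega>
          using \<psi>(2)[of n i \<omega>] L[of n i \<omega>] by (auto simp: \<eta>_def)
        then show ?thesis by (auto simp: bounded_iff)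
      qed
      have \<psi>_bounded: "bounded (\<psi> n i ` space M)" for i
      proof -
        have "norm (\<psi> n i \<omega>) \<le> 1" for \<omega> using \<psi>(2)[of n i \<omega>] by auto
        then show ?thesis by (auto simp: bounded_iff)
      qed
      let ?D = "\<lambda>i \<omega>. \<psi> n i \<omega> *\<^sub>R (?I r (?t (Suc i)) \<omega> - ?I r (?t i) \<omega>) - \<eta> i \<omega> *v incr (?t i) (?t (Suc i)) \<omega>"
      have "\<exists>D'. integrable M (\<lambda>\<omega>. (\<Sum>i<?N. g n i \<omega> \<bullet> D' i \<omega>)\<^sup>2) \<and>
        expectation (\<lambda>\<omega>. (\<Sum>i<?N. g n i \<omega> \<bullet> D' i \<omega>)\<^sup>2) \<le> real CARD('d) * (C\<^sup>2 * \<delta>) \<and>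
        integrable M (\<lambda>\<omega>. \<Sum>i<?N. (norm (D' i \<omega>))\<^sup>2) \<and>
        expectation (\<lambda>\<omega>. \<Sum>i<?N. (norm (D' i \<omega>))\<^sup>2) \<le> real CARD('d) * \<delta> \<and>
        (\<forall>\<omega>\<in>space M. (\<Sum>i<?N. LINT u:{?t i..?t (Suc i)}|lborel.
            (norm (\<psi> n i \<omega> *\<^sub>R ?S r u \<omega> - \<eta> i \<omega>))\<^sup>2) \<le> \<delta> \<longrightarrow> (\<forall>i<?N. D' i \<omega> = ?D i \<omega>))"
        by (rule simple_integral_deviation[OF simple[of r]])
          (use t_nonneg t_step \<psi>(1) \<psi>_bounded \<eta>_meas \<eta>_bounded g \<open>0 \<le> C\<close> \<delta> in auto)
      then obtain D' where D': "integrable M (\<lambda>\<omega>. (\<Sum>i<?N. g n i \<omega> \<bullet> D' i \<omega>)\<^sup>2)"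
        "expectation (\<lambda>\<omega>. (\<Sum>i<?N. g n i \<omega> \<bullet> D' i \<omega>)\<^sup>2) \<le> real CARD('d) * (C\<^sup>2 * \<delta>)"
        "integrable M (\<lambda>\<omega>. \<Sum>i<?N. (norm (D' i \<omega>))\<^sup>2)"
        "expectation (\<lambda>\<omega>. \<Sum>i<?N. (norm (D' i \<omega>))\<^sup>2) \<le> real CARD('d) * \<delta>"
        "\<And>\<omega>. \<omega> \<in> space M \<Longrightarrow> (\<Sum>i<?N. LINT u:{?t i..?t (Suc i)}|lborel.
            (norm (\<psi> n i \<omega> *\<^sub>R ?S r u \<omega> - \<eta> i \<omega>))\<^sup>2) \<le> \<delta> \<Longrightarrow> (\<forall>i<?N. D' i \<omega> = ?D i \<omega>)"
        by blast
      have A5: "mostly M (d / 8) (\<lambda>\<omega>. (\<Sum>i<?N. g n i \<omega> \<bullet> D' i \<omega>)\<^sup>2 \<le> c)"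
        by (rule mostly_markov[OF D'(1) _ order_trans[OF D'(2) D\<delta>(1)] c(1)]) simp
      have A6: "mostly M (d / 8) (\<lambda>\<omega>. (\<Sum>i<?N. (norm (D' i \<omega>))\<^sup>2) \<le> c)"
        by (rule mostly_markov[OF D'(3) _ order_trans[OF D'(4) D\<delta>(2)] c(1)]) (simp add: sum_nonneg)
      note good = mostly_conj[OF elim(1) mostly_conj[OF r(1) mostly_conj[OF r(2) mostly_conj[OF
            mostly_AE[OF AE_continuous_H] mostly_conj[OF A5 A6]]]]]
      show ?case
      proof (rule mostly_mono[OF good])
        fix \<omega> assume \<omega>M: "\<omega> \<in> space M"
          and "\<bar>\<Sum>i<?N. LINT u:{?t i..?t (Suc i)}|lborel. (norm (H u \<omega> - H (?t i) \<omega>))\<^sup>2\<bar> \<le> \<delta> / 4 \<and>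
            \<bar>norm ((LINT t:{0..T}|lborel. (norm (?S r t \<omega> - H t \<omega>))\<^sup>2) - 0)\<bar> \<le> \<delta> / 4 \<and>
            \<bar>\<Sum>i\<le>?N. norm (?I r (?t i) \<omega> - N (?t i) \<omega>)\<bar> \<le> e' \<and> continuous_on {0..} (\<lambda>t. H t \<omega>) \<and>
            (\<Sum>i<?N. g n i \<omega> \<bullet> D' i \<omega>)\<^sup>2 \<le> c \<and> (\<Sum>i<?N. (norm (D' i \<omega>))\<^sup>2) \<le> c"
        then have osc: "\<bar>\<Sum>i<?N. LINT u:{?t i..?t (Suc i)}|lborel. (norm (H u \<omega> - H (?t i) \<omega>))\<^sup>2\<bar> \<le> \<delta> / 4"
          and approx: "\<bar>norm ((LINT t:{0..T}|lborel. (norm (?S r t \<omega> - H t \<omega>))\<^sup>2) - 0)\<bar> \<le> \<delta> / 4"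
          and grid_approx: "\<bar>\<Sum>i\<le>?N. norm (?I r (?t i) \<omega> - N (?t i) \<omega>)\<bar> \<le> e'"
          and H: "continuous_on {0..} (\<lambda>t. H t \<omega>)"
          and linear_le: "(\<Sum>i<?N. g n i \<omega> \<bullet> D' i \<omega>)\<^sup>2 \<le> c" and square_le: "(\<Sum>i<?N. (norm (D' i \<omega>))\<^sup>2) \<le> c"
          by blast+
        have H_sub: "continuous_on {x..z} (\<lambda>t. H t \<omega>)" if "0 \<le> x" for x z
          using that by (intro continuous_on_subset[OF H]) auto
        have S_int: "set_integrable lborel {x..z} (\<lambda>u. (norm (?S r u \<omega> - G u))\<^sup>2)"
          if "continuous_on {x..z} G" for G x z
          by (rule set_integrable_square_difference[OF simple_process_measurable_time simple_process_norm_le that])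
        have H_int: "set_integrable lborel {?t i..?t (Suc i)} (\<lambda>u. (norm (H u \<omega> - H (?t i) \<omega>))\<^sup>2)" for i
          by (intro borel_integrable_atLeastAtMost' continuous_intros H_sub t_nonneg)
        have "(\<Sum>i<?N. LINT u:{?t i..?t (Suc i)}|lborel. (norm (\<psi> n i \<omega> *\<^sub>R ?S r u \<omega> - \<eta> i \<omega>))\<^sup>2)
          \<le> (\<Sum>i<?N. LINT u:{?t i..?t (Suc i)}|lborel. 2 * (norm (?S r u \<omega> - H u \<omega>))\<^sup>2
               + 2 * (norm (H u \<omega> - H (?t i) \<omega>))\<^sup>2)"
        proof (intro sum_mono set_integral_mono)
          fix i
          have "(\<lambda>u. (norm (\<psi> n i \<omega> *\<^sub>R ?S r u \<omega> - \<eta> i \<omega>))\<^sup>2)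
            = (\<lambda>u. (\<psi> n i \<omega>)\<^sup>2 * (norm (?S r u \<omega> - H (?t i) \<omega>))\<^sup>2)"
            by (simp add: \<eta>_def scaleR_diff_right[symmetric] power_mult_distrib)
          then show "set_integrable lborel {?t i..?t (Suc i)} (\<lambda>u. (norm (\<psi> n i \<omega> *\<^sub>R ?S r u \<omega> - \<eta> i \<omega>))\<^sup>2)"
            using S_int[of "?t i" "?t (Suc i)" "\<lambda>_. H (?t i) \<omega>"] by simp
          show "set_integrable lborel {?t i..?t (Suc i)} (\<lambda>u. 2 * (norm (?S r u \<omega> - H u \<omega>))\<^sup>2
               + 2 * (norm (H u \<omega> - H (?t i) \<omega>))\<^sup>2)"
            by (intro set_integral_add set_integrable_mult_right S_int H_int H_sub t_nonneg)
          fix u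
          have "(norm (\<psi> n i \<omega> *\<^sub>R ?S r u \<omega> - \<eta> i \<omega>))\<^sup>2 \<le> (norm (?S r u \<omega> - H (?t i) \<omega>))\<^sup>2"
            using \<psi>(2)[of n i \<omega>] by (auto simp: \<eta>_def)
          also have "\<dots> \<le> 2 * (norm (?S r u \<omega> - H u \<omega>))\<^sup>2 + 2 * (norm (H u \<omega> - H (?t i) \<omega>))\<^sup>2"
            using norm_add_square_le[of "?S r u \<omega> - H u \<omega>" "H u \<omega> - H (?t i) \<omega>"] by simp
          finally show "(norm (\<psi> n i \<omega> *\<^sub>R ?S r u \<omega> - \<eta> i \<omega>))\<^sup>2
            \<le> 2 * (norm (?S r u \<omega> - H u \<omega>))\<^sup>2 + 2 * (norm (H u \<omega> - H (?t i) \<omega>))\<^sup>2" .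
        qed
        also have "\<dots> = 2 * (\<Sum>i<?N. LINT u:{?t i..?t (Suc i)}|lborel. (norm (?S r u \<omega> - H u \<omega>))\<^sup>2)
            + 2 * (\<Sum>i<?N. LINT u:{?t i..?t (Suc i)}|lborel. (norm (H u \<omega> - H (?t i) \<omega>))\<^sup>2)"
          unfolding sum_distrib_left sum.distrib[symmetric]
        proof (intro sum.cong refl)
          fix i
          show "(LINT u:{?t i..?t (Suc i)}|lborel. 2 * (norm (?S r u \<omega> - H u \<omega>))\<^sup>2 + 2 * (norm (H u \<omega> - H (?t i) \<omega>))\<^sup>2)
            = 2 * (LINT u:{?t i..?t (Suc i)}|lborel. (norm (?S r u \<omega> - H u \<omega>))\<^sup>2)
              + 2 * (LINT u:{?t i..?t (Suc i)}|lborel. (norm (H u \<omega> - H (?t i) \<omega>))\<^sup>2)"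
            by (subst set_integral_add(2))
              (auto intro!: set_integrable_mult_right S_int H_int H_sub t_nonneg)
        qed
        also have "(\<Sum>i<?N. LINT u:{?t i..?t (Suc i)}|lborel. (norm (?S r u \<omega> - H u \<omega>))\<^sup>2)
            = (LINT u:{0..T}|lborel. (norm (?S r u \<omega> - H u \<omega>))\<^sup>2)"
          using set_integral_combine_sum[of ?N ?t "\<lambda>u. (norm (?S r u \<omega> - H u \<omega>))\<^sup>2", OF t_step]
            S_int[OF H_sub] unfolding t0 tN by simp
        also have "2 * (LINT u:{0..T}|lborel. (norm (?S r u \<omega> - H u \<omega>))\<^sup>2)
            + 2 * (\<Sum>i<?N. LINT u:{?t i..?t (Suc i)}|lborel. (norm (H u \<omega> - H (?t i) \<omega>))\<^sup>2)
          \<le> 2 * (\<delta> / 4) + 2 * (\<delta> / 4)"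
          using osc approx by (intro add_mono mult_left_mono) auto
        finally have D'_eq: "D' i \<omega> = ?D i \<omega>" if "i < ?N" for i
          using D'(5)[OF \<omega>M] that by simp
        have dist: "norm (E n i \<omega> - D' i \<omega>) \<le> 2 * e'" if "i < ?N" for i
        proof -
          have near: "norm (?I r (?t j) \<omega> - N (?t j) \<omega>) \<le> e'" if "j \<le> ?N" for j
          proof -
            have "norm (?I r (?t j) \<omega> - N (?t j) \<omega>) \<le> (\<Sum>i\<le>?N. norm (?I r (?t i) \<omega> - N (?t i) \<omega>))"
              using that by (intro member_le_sum) auto
            then show ?thesis using grid_approx by simp
          qed
          have "E n i \<omega> - D' i \<omega> = \<psi> n i \<omega> *\<^sub>R ((?I r (?t i) \<omega> - N (?t i) \<omega>) - (?I r (?t (Suc i)) \<omega> - N (?t (Suc i)) \<omega>))"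
            unfolding D'_eq[OF that] E_def \<eta>_def
            by (simp add: algebra_simps scaleR_matrix_vector_assoc)
          also have "norm \<dots> \<le> norm ((?I r (?t i) \<omega> - N (?t i) \<omega>) - (?I r (?t (Suc i)) \<omega> - N (?t (Suc i)) \<omega>))"
            using \<psi>(2)[of n i \<omega>] by auto
          also have "\<dots> \<le> e' + e'"
            using that by (intro order_trans[OF norm_triangle_ineq4] add_mono near) auto
          finally show ?thesis by simp
        qed
        have N_e': "real ?N * e' * (C + 1) * 16 \<le> e"
        proof -
          have "real ?N * e' * (C + 1) * 16 \<le> (real ?N + 1) * e' * (C + 1) * 16"
            using e'(1) \<open>0 \<le> C\<close> by (intro mult_right_mono) auto
          also have "\<dots> \<le> e" using e'(3) by (simp add: ac_simps)
          finally show ?thesis .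
        qed
        have N_e'2: "real ?N * e' * 16 \<le> e" "real ?N * e' * C * 16 \<le> e"
        proof -
          have "0 \<le> real ?N * e' * 16" "0 \<le> real ?N * e' * C * 16" using e'(1) \<open>0 \<le> C\<close> by auto
          moreover have "real ?N * e' * (C + 1) * 16 = real ?N * e' * 16 + real ?N * e' * C * 16"
            by (simp add: algebra_simps)
          ultimately show "real ?N * e' * 16 \<le> e" "real ?N * e' * C * 16 \<le> e" using N_e' by linarith+
        qed
        have "\<bar>\<Sum>i<?N. g n i \<omega> \<bullet> E n i \<omega>\<bar> \<le> \<bar>\<Sum>i<?N. g n i \<omega> \<bullet> D' i \<omega>\<bar> + \<bar>\<Sum>i<?N. g n i \<omega> \<bullet> (E n i \<omega> - D' i \<omega>)\<bar>"
          unfolding inner_diff_right sum_subtractf by linarith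
        also have "\<bar>\<Sum>i<?N. g n i \<omega> \<bullet> D' i \<omega>\<bar> \<le> e / 2"
        proof -
          have "(\<Sum>i<?N. g n i \<omega> \<bullet> D' i \<omega>)\<^sup>2 \<le> (e / 2)\<^sup>2" using linear_le c(2) by linarith
          then show ?thesis using \<open>0 < e\<close> by (simp add: abs_le_square_iff[symmetric])
        qed
        also have "\<bar>\<Sum>i<?N. g n i \<omega> \<bullet> (E n i \<omega> - D' i \<omega>)\<bar> \<le> (\<Sum>i<?N. C * (2 * e'))"
        proof (intro order_trans[OF sum_abs] sum_mono)
          fix i assume "i \<in> {..<?N}"
          then have "norm (g n i \<omega>) * norm (E n i \<omega> - D' i \<omega>) \<le> C * (2 * e')"
            using g(2)[OF \<omega>M] dist \<open>0 \<le> C\<close> by (intro mult_mono) auto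
          then show "\<bar>g n i \<omega> \<bullet> (E n i \<omega> - D' i \<omega>)\<bar> \<le> C * (2 * e')"
            using Cauchy_Schwarz_ineq2 order_trans by blast
        qed
        also have "(\<Sum>i<?N. C * (2 * e')) = 2 * (real ?N * e' * C)" by simp
        also have "e / 2 + 2 * (real ?N * e' * C) \<le> e" using N_e'2(2) \<open>0 < e\<close> by linarith
        finally have first: "\<bar>\<Sum>i<?N. g n i \<omega> \<bullet> E n i \<omega>\<bar> \<le> e" by simp
        have "(\<Sum>i<?N. (norm (E n i \<omega>))\<^sup>2) \<le> (\<Sum>i<?N. 2 * (norm (D' i \<omega>))\<^sup>2 + 8 * e')"
        proof (rule sum_mono)
          fix i assume i: "i \<in> {..<?N}"
          have "(norm (E n i \<omega>))\<^sup>2 \<le> 2 * (norm (D' i \<omega>))\<^sup>2 + 2 * (norm (E n i \<omega> - D' i \<omega>))\<^sup>2"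
            using norm_add_square_le[of "D' i \<omega>" "E n i \<omega> - D' i \<omega>"] by simp
          also have "(norm (E n i \<omega> - D' i \<omega>))\<^sup>2 \<le> (2 * e')\<^sup>2"
            using dist[of i] i by (intro power_mono) auto
          also have "2 * (2 * e')\<^sup>2 \<le> 8 * e'"
            using e'(1,2) by (simp add: power2_eq_square mult_le_one mult_left_le)
          finally show "(norm (E n i \<omega>))\<^sup>2 \<le> 2 * (norm (D' i \<omega>))\<^sup>2 + 8 * e'" by simp
        qed
        also have "\<dots> = 2 * (\<Sum>i<?N. (norm (D' i \<omega>))\<^sup>2) + 8 * (real ?N * e')"
          by (simp add: sum.distrib sum_distrib_left)
        also have "\<dots> \<le> e"
          using square_le c(3) N_e'2(1) by linarith
        finally have "(\<Sum>i<?N. (norm (E n i \<omega>))\<^sup>2) \<le> e" .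
        moreover have "0 \<le> (\<Sum>i<?N. (norm (E n i \<omega>))\<^sup>2)" by (intro sum_nonneg) simp
        ultimately show "\<bar>\<Sum>i<?N. g n i \<omega> \<bullet> E n i \<omega>\<bar> \<le> e \<and> \<bar>\<Sum>i<?N. (norm (E n i \<omega>))\<^sup>2\<bar> \<le> e"
          using first by simp
      qed (use \<open>0 < d\<close> in simp)
    qed
  qed
  show "small_in_prob M (\<lambda>n \<omega>. \<Sum>i<grid_size n. g n i \<omega> \<bullet> E n i \<omega>)"
    by (rule small_in_probI) (drule (1) bound, erule eventually_mono, erule mostly_mono; simp)
  show "small_in_prob M (\<lambda>n \<omega>. \<Sum>i<grid_size n. (norm (E n i \<omega>))\<^sup>2)"
    by (rule small_in_probI) (drule (1) bound, erule eventually_mono, erule mostly_mono; simp)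
qed

end

section \<open>The Ito formula as a limit of left-point sums\<close>

text \<open>From now on \<open>y\<close> has drift \<open>b\<close> and diffusion \<open>H\<close>, and \<open>N\<close> is the stochastic integral of \<open>H\<close>.  Over
  a cell, the increment \<open>dy\<close> of \<open>y\<close> consists of \<open>drift\<close> and \<open>dN\<close>, and \<open>leading\<close> is the approximation
  of \<open>dN\<close> by \<open>H\<close> at the left end point times the increment of \<open>W\<close>.\<close>

locale ito_C2 = ito_process M F W y b N H + C2_function \<phi> \<phi>1 \<phi>2
  for M :: "'w measure" and F :: "real \<Rightarrow> 'w measure" and W :: "real \<Rightarrow> 'w \<Rightarrow> real^'d::finite"
    and y b N :: "real \<Rightarrow> 'w \<Rightarrow> real^'m::finite" and H :: "real \<Rightarrow> 'w \<Rightarrow> real^'d^'m"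
    and \<phi> :: "real^'m \<Rightarrow> real" and \<phi>1 :: "real^'m \<Rightarrow> real^'m \<Rightarrow> real"
    and \<phi>2 :: "real^'m \<Rightarrow> real^'m \<Rightarrow> real^'m \<Rightarrow> real" +
  fixes T :: real
  assumes T: "0 \<le> T"
begin

abbreviation "t \<equiv> grid T"

abbreviation "dW n i \<equiv> incr (t n i) (t n (Suc i))"

abbreviation "dy n i \<omega> \<equiv> y (t n (Suc i)) \<omega> - y (t n i) \<omega>"

abbreviation "leading n i \<omega> \<equiv> H (t n i) \<omega> *v dW n i \<omega>"

abbreviation "drift n i \<omega> \<equiv> LINT u:{t n i..t n (Suc i)}|lborel. b u \<omega>"

abbreviation "dN n i \<omega> \<equiv> N (t n (Suc i)) \<omega> - N (t n i) \<omega>"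

text \<open>The trace of \<open>H\<^sup>T D\<^sup>2\<phi>(y) H\<close>.\<close>

definition trace2 :: "real \<Rightarrow> 'w \<Rightarrow> real" where
  "trace2 u \<omega> = (\<Sum>l\<in>UNIV. \<phi>2 (y u \<omega>) (H u \<omega> *v axis l 1) (H u \<omega> *v axis l 1))"

lemma t_nonneg: "0 \<le> t n i" by (rule grid_nonneg[OF T])

lemma t_step: "t n i \<le> t n (Suc i)" by (rule grid_mono) simp

lemma AE_paths: "AE \<omega> in M. continuous_on {0..} (\<lambda>s. y s \<omega>) \<and> continuous_on {0..} (\<lambda>s. b s \<omega>)
    \<and> continuous_on {0..} (\<lambda>s. H s \<omega>)"
  using y_continuous b_continuous H_continuous by (simp add: continuous_paths_def)

lemma adapted [measurable]:
  "y (t n i) \<in> borel_measurable (F (t n i))" "H (t n i) \<in> borel_measurable (F (t n i))"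
  using prog_measurable_adapted[OF y_prog t_nonneg] prog_measurable_adapted[OF H_prog t_nonneg] by auto

lemma jointly [measurable]:
  "(\<lambda>(u, \<omega>). y u \<omega>) \<in> borel_measurable (restrict_space borel {0..T} \<Otimes>\<^sub>M M)"
  "(\<lambda>(u, \<omega>). b u \<omega>) \<in> borel_measurable (restrict_space borel {0..T} \<Otimes>\<^sub>M M)"
  "(\<lambda>(u, \<omega>). H u \<omega>) \<in> borel_measurable (restrict_space borel {0..T} \<Otimes>\<^sub>M M)"
  using prog_measurable_jointly[OF _ T] y_prog b_prog H_prog by blast+

lemma y_at: "y (t n i) \<in> borel_measurable M"
  by (rule prog_measurable_at[OF y_prog t_nonneg])

lemma trace2_jointly: "(\<lambda>(u, \<omega>). trace2 u \<omega>) \<in> borel_measurable (restrict_space borel {0..T} \<Otimes>\<^sub>M M)"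
  unfolding trace2_def case_prod_beta
  using jointly unfolding case_prod_beta
  by (intro borel_measurable_sum measurable_deriv2_comp measurable_matrix_vector_mult) auto

lemma drift_left_point_sums:
  "small_in_prob M (\<lambda>n \<omega>. (\<Sum>i<grid_size n. LINT u:{t n i..t n (Suc i)}|lborel. \<phi>1 (y (t n i) \<omega>) (b u \<omega>))
     - (LINT u:{0..T}|lborel. \<phi>1 (y u \<omega>) (b u \<omega>)))"
proof (rule AE_tendsto_imp_small_in_prob)
  fix n
  have 1: "(\<lambda>(u, \<omega>). \<phi>1 (y (t n i) \<omega>) (b u \<omega>)) \<in> borel_measurable (restrict_space borel {0..T} \<Otimes>\<^sub>M M)" for i
    using jointly(2) measurable_compose[OF measurable_snd y_at[of n i]] unfolding case_prod_beta
    by (intro measurable_deriv1_comp) auto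
  have 2: "(\<lambda>(u, \<omega>). \<phi>1 (y u \<omega>) (b u \<omega>)) \<in> borel_measurable (restrict_space borel {0..T} \<Otimes>\<^sub>M M)"
    using jointly(1,2) unfolding case_prod_beta by (intro measurable_deriv1_comp) auto
  show "(\<lambda>\<omega>. (\<Sum>i<grid_size n. LINT u:{t n i..t n (Suc i)}|lborel. \<phi>1 (y (t n i) \<omega>) (b u \<omega>))
     - (LINT u:{0..T}|lborel. \<phi>1 (y u \<omega>) (b u \<omega>))) \<in> borel_measurable M"
    by (intro borel_measurable_diff borel_measurable_sum time_integral_measurable[of _ T] 1 2 T t_nonneg grid_le order_refl)
next
  show "AE \<omega> in M. (\<lambda>n. (\<Sum>i<grid_size n. LINT u:{t n i..t n (Suc i)}|lborel. \<phi>1 (y (t n i) \<omega>) (b u \<omega>))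
     - (LINT u:{0..T}|lborel. \<phi>1 (y u \<omega>) (b u \<omega>))) \<longlonglongrightarrow> 0"
    using AE_paths
  proof eventually_elim
    case (elim \<omega>)
    then have "continuous_on ({0..T} \<times> {0..T}) (\<lambda>(s, u). \<phi>1 (y s \<omega>) (b u \<omega>))"
      unfolding case_prod_beta
      by (intro continuous_on_deriv1_comp continuous_on_compose2[of "{0..}" "\<lambda>s. y s \<omega>" _ fst]
          continuous_on_compose2[of "{0..}" "\<lambda>s. b s \<omega>" _ snd] continuous_intros) auto
    then show ?case by (rule left_point_sums_converge[OF T])
  qed
qed

lemma continuous_trace2:
  assumes "continuous_on {0..} (\<lambda>s. y s \<omega>)" "continuous_on {0..} (\<lambda>s. H s \<omega>)"
  shows "continuous_on {0..} (\<lambda>s. trace2 s \<omega>)"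
  unfolding trace2_def by (intro continuous_intros assms)

lemma trace_left_point_sums:
  "small_in_prob M (\<lambda>n \<omega>. (\<Sum>i<grid_size n. LINT u:{t n i..t n (Suc i)}|lborel. trace2 (t n i) \<omega>)
     - (LINT u:{0..T}|lborel. trace2 u \<omega>))"
proof (rule AE_tendsto_imp_small_in_prob)
  fix n
  have "trace2 (t n i) \<in> borel_measurable M" for i
    unfolding trace2_def[abs_def] using y_at[of n i] prog_measurable_at[OF H_prog t_nonneg, of n i]
    by (intro borel_measurable_sum measurable_deriv2_comp measurable_matrix_vector_mult) auto
  then have 1: "(\<lambda>(u, \<omega>). trace2 (t n i) \<omega>) \<in> borel_measurable (restrict_space borel {0..T} \<Otimes>\<^sub>M M)" for i
    unfolding case_prod_beta by (rule measurable_compose[OF measurable_snd])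
  show "(\<lambda>\<omega>. (\<Sum>i<grid_size n. LINT u:{t n i..t n (Suc i)}|lborel. trace2 (t n i) \<omega>)
     - (LINT u:{0..T}|lborel. trace2 u \<omega>)) \<in> borel_measurable M"
    by (intro borel_measurable_diff borel_measurable_sum time_integral_measurable[of _ T] 1 trace2_jointly
        T t_nonneg grid_le order_refl)
next
  show "AE \<omega> in M. (\<lambda>n. (\<Sum>i<grid_size n. LINT u:{t n i..t n (Suc i)}|lborel. trace2 (t n i) \<omega>)
     - (LINT u:{0..T}|lborel. trace2 u \<omega>)) \<longlonglongrightarrow> 0"
    using AE_paths
  proof eventually_elim
    case (elim \<omega>)
    then have "continuous_on ({0..T} \<times> {0..T}) (\<lambda>(s, u). trace2 s \<omega>)"
      unfolding case_prod_beta
      by (intro continuous_on_compose2[OF continuous_trace2, of \<omega> _ fst] continuous_intros) auto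
    then show ?case by (rule left_point_sums_converge[OF T])
  qed
qed

text \<open>A continuous drift contributes \<open>O(\<Delta>t)\<close> to each increment, hence has no quadratic variation.\<close>

lemma drift_squares_small: "small_in_prob M (\<lambda>n \<omega>. \<Sum>i<grid_size n. (norm (drift n i \<omega>))\<^sup>2)"
proof (rule AE_tendsto_imp_small_in_prob)
  fix n
  show "(\<lambda>\<omega>. \<Sum>i<grid_size n. (norm (drift n i \<omega>))\<^sup>2) \<in> borel_measurable M"
  proof -
    have [measurable]: "drift n i \<in> borel_measurable M" for i
      by (rule time_integral_measurable[OF jointly(2) T t_nonneg grid_le])
    show ?thesis by measurable
  qed
next
  show "AE \<omega> in M. (\<lambda>n. \<Sum>i<grid_size n. (norm (drift n i \<omega>))\<^sup>2) \<longlonglongrightarrow> 0"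
    using AE_paths
  proof eventually_elim
    case (elim \<omega>)
    have cont: "continuous_on {0..T} (\<lambda>s. b s \<omega>)"
      by (rule continuous_on_subset[of "{0..}"]) (use elim in auto)
    have "bounded ((\<lambda>s. b s \<omega>) ` {0..T})"
      by (rule compact_imp_bounded[OF compact_continuous_image[OF cont]]) simp
    then obtain B where B: "0 < B" "\<And>s. s \<in> {0..T} \<Longrightarrow> norm (b s \<omega>) \<le> B"
      unfolding bounded_pos by blast
    have drift_le: "norm (drift n i \<omega>) \<le> B * (t n (Suc i) - t n i)" for n i
    proof -
      have sub: "{t n i..t n (Suc i)} \<subseteq> {0..T}"
        using t_nonneg[of n i] grid_le[of T n "Suc i"] by auto
      have int: "set_integrable lborel {t n i..t n (Suc i)} (\<lambda>u. b u \<omega>)"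
        by (intro borel_integrable_atLeastAtMost' continuous_on_subset[OF cont] sub)
      have "norm (drift n i \<omega>) \<le> (LINT u:{t n i..t n (Suc i)}|lborel. norm (b u \<omega>))"
        by (rule set_integral_norm_bound[OF int])
      also have "\<dots> \<le> (LINT u:{t n i..t n (Suc i)}|lborel. B)"
        using B(2) sub by (intro set_integral_mono set_integrable_norm[OF int] borel_integrable_atLeastAtMost' continuous_intros) auto
      also have "\<dots> = B * (t n (Suc i) - t n i)"
        by (intro set_integral_cell_const t_step refl borel_integrable_atLeastAtMost' continuous_intros)
      finally show ?thesis .
    qed
    have sum_le: "(\<Sum>i<grid_size n. (norm (drift n i \<omega>))\<^sup>2) \<le> B\<^sup>2 * T * (1 / real (Suc n))" for n
    proof -
      have "(\<Sum>i<grid_size n. (norm (drift n i \<omega>))\<^sup>2) \<le> (\<Sum>i<grid_size n. B\<^sup>2 * (1 / real (Suc n)) * (t n (Suc i) - t n i))"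
      proof (rule sum_mono)
        fix i
        have "(norm (drift n i \<omega>))\<^sup>2 \<le> (B * (t n (Suc i) - t n i))\<^sup>2"
          by (intro power_mono drift_le) simp
        also have "\<dots> = B\<^sup>2 * (t n (Suc i) - t n i) * (t n (Suc i) - t n i)"
          by (simp add: power2_eq_square)
        also have "\<dots> \<le> B\<^sup>2 * (1 / real (Suc n)) * (t n (Suc i) - t n i)"
          using t_step[of n i] grid_mesh[of T n i] by (intro mult_right_mono mult_left_mono) auto
        finally show "(norm (drift n i \<omega>))\<^sup>2 \<le> B\<^sup>2 * (1 / real (Suc n)) * (t n (Suc i) - t n i)" .
      qed
      also have "\<dots> \<le> B\<^sup>2 * (1 / real (Suc n)) * T"
        unfolding sum_distrib_left[symmetric] by (intro mult_left_mono sum_grid_le T) simp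
      finally show ?thesis by (simp add: ac_simps)
    qed
    have "(\<lambda>n. B\<^sup>2 * T * (1 / real (Suc n))) \<longlonglongrightarrow> B\<^sup>2 * T * 0"
      by (intro tendsto_mult_left LIMSEQ_Suc[OF lim_1_over_n])
    then have lim: "(\<lambda>n. B\<^sup>2 * T * (1 / real (Suc n))) \<longlonglongrightarrow> 0" by simp
    show ?case
    proof (rule tendsto_sandwich[OF always_eventually always_eventually tendsto_const lim]; intro allI)
      show "0 \<le> (\<Sum>i<grid_size n. (norm (drift n i \<omega>))\<^sup>2)" for n by (intro sum_nonneg) simp
    qed (rule sum_le)
  qed
qed

definition relative_remainder :: "nat \<Rightarrow> nat \<Rightarrow> 'w \<Rightarrow> real" where
  "relative_remainder n i \<omega> = taylor_remainder (y (t n i) \<omega>) (y (t n (Suc i)) \<omega>) / (norm (dy n i \<omega>))\<^sup>2"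

text \<open>Paths are uniformly continuous on \<open>[0, T]\<close> and stay in a bounded set there, where the Taylor
  remainder is uniformly \<open>o(|\<Delta>y|\<^sup>2)\<close>.\<close>

lemma relative_remainder_small:
  "small_in_prob M (\<lambda>n \<omega>. Max ((\<lambda>i. \<bar>relative_remainder n i \<omega>\<bar>) ` {..<grid_size n}))"
proof (rule small_in_probI)
  fix e d :: real assume "0 < e" "0 < d"
  have "relative_remainder n i \<in> borel_measurable M" for n i
  proof -
    note [measurable] = y_at[of n i] y_at[of n "Suc i"]
    show ?thesis unfolding relative_remainder_def[abs_def] taylor_remainder_def by measurable
  qed
  moreover have "AE \<omega> in M. \<forall>e>0. \<forall>\<^sub>F n in sequentially. \<forall>i. \<bar>relative_remainder n i \<omega>\<bar> \<le> e"
    using AE_paths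
  proof eventually_elim
    case (elim \<omega>)
    have cont: "continuous_on {0..T} (\<lambda>s. y s \<omega>)"
      by (rule continuous_on_subset[of "{0..}"]) (use elim in auto)
    have "bounded ((\<lambda>s. y s \<omega>) ` {0..T})"
      by (rule compact_imp_bounded[OF compact_continuous_image[OF cont]]) simp
    then obtain R where R: "\<And>s. s \<in> {0..T} \<Longrightarrow> norm (y s \<omega>) \<le> R"
      unfolding bounded_pos by blast
    have t_mem: "t n i \<in> {0..T}" for n i using t_nonneg grid_le by simp
    show ?case
    proof (intro allI impI)
      fix e :: real assume "0 < e"
      then obtain \<rho> where \<rho>: "0 < \<rho>" "\<And>v w. norm v \<le> R \<Longrightarrow> norm w \<le> R \<Longrightarrow> norm (w - v) < \<rho> \<Longrightarrow>
          \<bar>taylor_remainder v w\<bar> \<le> e * (norm (w - v))\<^sup>2"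
        using taylor_remainder_uniform[of e R] by blast
      have uc: "uniformly_continuous_on {0..T} (\<lambda>s. y s \<omega>)"
        by (rule compact_uniformly_continuous[OF cont]) simp
      from uc[unfolded uniformly_continuous_on_def, rule_format, OF \<rho>(1)] obtain h where h: "0 < h" "\<And>s s'. s \<in> {0..T} \<Longrightarrow> s' \<in> {0..T} \<Longrightarrow> dist s' s < h \<Longrightarrow> dist (y s' \<omega>) (y s \<omega>) < \<rho>"
        by blast
      obtain m where m: "1 / h < real m" using reals_Archimedean2 by blast
      have "\<bar>relative_remainder n i \<omega>\<bar> \<le> e" if "m \<le> n" for n i
      proof -
        have "1 / h < real (Suc n)" using m that by linarith
        then have "1 / real (Suc n) < h" using h(1) by (simp add: field_simps)
        then have "dist (t n (Suc i)) (t n i) < h"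
          using grid_mesh[of T n i] t_step[of n i] by (simp add: dist_real_def)
        then have "norm (dy n i \<omega>) < \<rho>"
          using h(2)[OF t_mem t_mem] by (simp add: dist_norm)
        then have le: "\<bar>taylor_remainder (y (t n i) \<omega>) (y (t n (Suc i)) \<omega>)\<bar> \<le> e * (norm (dy n i \<omega>))\<^sup>2"
          by (intro \<rho>(2) R t_mem)
        show ?thesis
        proof (cases "dy n i \<omega> = 0")
          case True
          then show ?thesis using \<open>0 < e\<close> by (simp add: relative_remainder_def)
        next
          case False
          then have "0 < (norm (dy n i \<omega>))\<^sup>2" by simp
          then show ?thesis using le unfolding relative_remainder_def abs_divide abs_power2
            by (simp only: pos_divide_le_eq)
        qed
      qed
      then show "\<forall>\<^sub>F n in sequentially. \<forall>i. \<bar>relative_remainder n i \<omega>\<bar> \<le> e"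
        unfolding eventually_sequentially by blast
    qed
  qed
  ultimately have "\<forall>\<^sub>F n in sequentially. mostly M d (\<lambda>\<omega>. \<forall>i. \<bar>relative_remainder n i \<omega>\<bar> \<le> e)"
    using \<open>0 < e\<close> \<open>0 < d\<close> by (rule AE_uniform_imp_small)
  then show "\<forall>\<^sub>F n in sequentially.
      mostly M d (\<lambda>\<omega>. \<bar>Max ((\<lambda>i. \<bar>relative_remainder n i \<omega>\<bar>) ` {..<grid_size n})\<bar> \<le> e)"
  proof (rule eventually_mono, elim mostly_mono)
    fix n \<omega> assume le: "\<forall>i. \<bar>relative_remainder n i \<omega>\<bar> \<le> e"
    have ne: "(\<lambda>i. \<bar>relative_remainder n i \<omega>\<bar>) ` {..<grid_size n} \<noteq> {}" by (simp add: lessThan_empty_iff)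
    have "Max ((\<lambda>i. \<bar>relative_remainder n i \<omega>\<bar>) ` {..<grid_size n}) \<le> e"
      using le ne by (intro Max.boundedI) auto
    moreover have "0 \<le> Max ((\<lambda>i. \<bar>relative_remainder n i \<omega>\<bar>) ` {..<grid_size n})"
      using Max_in[OF _ ne] by fastforce
    ultimately show "\<bar>Max ((\<lambda>i. \<bar>relative_remainder n i \<omega>\<bar>) ` {..<grid_size n})\<bar> \<le> e" by simp
  qed simp
qed

text \<open>Restricting to cells with bounded data at their left end point keeps all coefficients bounded and
  adapted.  For large \<open>L\<close> all cells of all grids are active with probability close to \<open>1\<close>, because
  paths are bounded on \<open>[0, T]\<close>.\<close>

definition size_at :: "real \<Rightarrow> 'w \<Rightarrow> real" where
  "size_at s \<omega> = norm (H s \<omega>) + bound1 (y s \<omega>) + bound2 (y s \<omega>)"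

definition active :: "real \<Rightarrow> nat \<Rightarrow> nat \<Rightarrow> 'w \<Rightarrow> real" where
  "active L n i \<omega> = (if size_at (t n i) \<omega> \<le> L then 1 else 0)"

lemma size_at_adapted: "size_at (t n i) \<in> borel_measurable (F (t n i))"
  unfolding size_at_def[abs_def] by measurable

lemma active_adapted [measurable]: "active L n i \<in> borel_measurable (F (t n i))"
  using size_at_adapted[of n i] unfolding active_def[abs_def] by measurable

lemma active_cases: "active L n i \<omega> = 0 \<or> active L n i \<omega> = 1"
  by (simp add: active_def)

lemma active_bounds:
  assumes "active L n i \<omega> = 1"
  shows "norm (H (t n i) \<omega>) \<le> L" "bound1 (y (t n i) \<omega>) \<le> L" "bound2 (y (t n i) \<omega>) \<le> L"
proof -
  have "norm (H (t n i) \<omega>) + bound1 (y (t n i) \<omega>) + bound2 (y (t n i) \<omega>) \<le> L"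
    using assms by (simp add: active_def size_at_def split: if_splits)
  then show "norm (H (t n i) \<omega>) \<le> L" "bound1 (y (t n i) \<omega>) \<le> L" "bound2 (y (t n i) \<omega>) \<le> L"
    using bound_nonneg[of "y (t n i) \<omega>"] norm_ge_zero[of "H (t n i) \<omega>"] by linarith+
qed

lemma size_at_uniformly_bounded:
  assumes "0 < d"
  shows "\<exists>L>0. mostly M d (\<lambda>\<omega>. \<forall>n i. active L n i \<omega> = 1)"
proof -
  have "AE \<omega> in M. \<exists>C. \<forall>p :: nat \<times> nat. \<bar>size_at (t (fst p) (snd p)) \<omega>\<bar> \<le> C"
    using AE_paths
  proof eventually_elim
    case (elim \<omega>)
    then have "continuous_on {0..} (\<lambda>s. size_at s \<omega>)"
      unfolding size_at_def by (intro continuous_intros) auto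
    then have cont: "continuous_on {0..T} (\<lambda>s. size_at s \<omega>)"
      by (rule continuous_on_subset) auto
    have "bounded ((\<lambda>s. size_at s \<omega>) ` {0..T})"
      by (rule compact_imp_bounded[OF compact_continuous_image[OF cont]]) simp
    then obtain C where "\<forall>x\<in>(\<lambda>s. size_at s \<omega>) ` {0..T}. norm x \<le> C" unfolding bounded_iff by blast
    then have "\<And>s. s \<in> {0..T} \<Longrightarrow> \<bar>size_at s \<omega>\<bar> \<le> C" by auto
    then show ?case using t_nonneg grid_le by (intro exI[of _ C]) auto
  qed
  from AE_bounded_imp_uniformly_bounded[OF measurable_F_M[OF size_at_adapted] this assms]
  obtain L where "0 < L" and L: "mostly M d (\<lambda>\<omega>. \<forall>p. \<bar>size_at (t (fst p) (snd p)) \<omega>\<bar> \<le> L)" by blast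
  from L have "mostly M d (\<lambda>\<omega>. \<forall>n i. active L n i \<omega> = 1)"
  proof (rule mostly_mono)
    fix \<omega> assume le: "\<forall>p. \<bar>size_at (t (fst p) (snd p)) \<omega>\<bar> \<le> L"
    show "\<forall>n i. active L n i \<omega> = 1"
    proof (intro allI)
      fix n i
      show "active L n i \<omega> = 1" using le[rule_format, of "(n, i)"] by (simp add: active_def)
    qed
  qed simp
  then show ?thesis using \<open>0 < L\<close> by blast
qed

definition active_sum :: "real \<Rightarrow> (nat \<Rightarrow> nat \<Rightarrow> 'w \<Rightarrow> real) \<Rightarrow> nat \<Rightarrow> 'w \<Rightarrow> real" where
  "active_sum L X n \<omega> = (\<Sum>i<grid_size n. active L n i \<omega> * X n i \<omega>)"

lemma active_sum_le:
  assumes "\<And>i. active L n i \<omega> = 1 \<Longrightarrow> X n i \<omega> \<le> c i" "\<And>i. 0 \<le> c i"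
  shows "active_sum L X n \<omega> \<le> (\<Sum>i<grid_size n. c i)"
  unfolding active_sum_def
proof (rule sum_mono)
  fix i
  show "active L n i \<omega> * X n i \<omega> \<le> c i"
    using assms[of i] active_cases[of L n i \<omega>] by auto
qed

lemma active_sum_mono:
  assumes "\<And>i. active L n i \<omega> = 1 \<Longrightarrow> X n i \<omega> \<le> Y n i \<omega>"
  shows "active_sum L X n \<omega> \<le> active_sum L Y n \<omega>"
  unfolding active_sum_def
proof (rule sum_mono)
  fix i
  show "active L n i \<omega> * X n i \<omega> \<le> active L n i \<omega> * Y n i \<omega>"
    using assms[of i] active_cases[of L n i \<omega>] by auto
qed

lemma active_sum_nonneg: "(\<And>i. 0 \<le> X n i \<omega>) \<Longrightarrow> 0 \<le> active_sum L X n \<omega>"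
  unfolding active_sum_def by (intro sum_nonneg mult_nonneg_nonneg) (simp_all add: active_def)

lemma active_sum_abs_le: "\<bar>active_sum L X n \<omega>\<bar> \<le> active_sum L (\<lambda>n i \<omega>. \<bar>X n i \<omega>\<bar>) n \<omega>"
  unfolding active_sum_def
  by (rule order_trans[OF sum_abs]) (simp add: abs_mult active_def)

lemma active_sum_linear:
  "active_sum L (\<lambda>n i \<omega>. X n i \<omega> * a + Y n i \<omega> * e) n \<omega> = active_sum L X n \<omega> * a + active_sum L Y n \<omega> * e"
  unfolding active_sum_def sum_distrib_right sum.distrib[symmetric]
  by (intro sum.cong refl) (simp add: algebra_simps)

text \<open>On active cells the expected square is at most \<open>L\<^sup>2 d \<Delta>t\<close>, and these bounds sum to \<open>L\<^sup>2 d T\<close>.\<close>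

lemma leading_squares_bounded:
  "bounded_in_prob M (active_sum L (\<lambda>n i \<omega>. (norm (leading n i \<omega>))\<^sup>2))"
proof (rule bounded_in_prob_mono)
  note sq = incr_norm_square[OF t_nonneg t_step]
  show "bounded_in_prob M (\<lambda>n \<omega>. \<Sum>i<grid_size n. L\<^sup>2 * (norm (dW n i \<omega>))\<^sup>2)"
  proof (rule bounded_in_prob_first_moment)
    show "integrable M (\<lambda>\<omega>. \<Sum>i<grid_size n. L\<^sup>2 * (norm (dW n i \<omega>))\<^sup>2)" for n
      by (intro Bochner_Integration.integrable_sum integrable_mult_right sq)
    show "0 \<le> (\<Sum>i<grid_size n. L\<^sup>2 * (norm (dW n i \<omega>))\<^sup>2)" for n \<omega> by (intro sum_nonneg) simp
    fix n
    have "expectation (\<lambda>\<omega>. \<Sum>i<grid_size n. L\<^sup>2 * (norm (dW n i \<omega>))\<^sup>2)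
        = L\<^sup>2 * (real CARD('d) * (\<Sum>i<grid_size n. t n (Suc i) - t n i))"
      using sq by (simp only: sum_distrib_left) simp
    also have "\<dots> \<le> L\<^sup>2 * (real CARD('d) * T)"
      by (intro mult_left_mono sum_grid_le T) auto
    finally show "expectation (\<lambda>\<omega>. \<Sum>i<grid_size n. L\<^sup>2 * (norm (dW n i \<omega>))\<^sup>2) \<le> L\<^sup>2 * (real CARD('d) * T)" .
  qed
  fix n \<omega>
  have "(norm (leading n i \<omega>))\<^sup>2 \<le> L\<^sup>2 * (norm (dW n i \<omega>))\<^sup>2" if "active L n i \<omega> = 1" for i
  proof -
    have "norm (leading n i \<omega>) \<le> L * norm (dW n i \<omega>)"
      using active_bounds(1)[OF that] by (intro order_trans[OF norm_matrix_vector_le] mult_right_mono) auto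
    then have "(norm (leading n i \<omega>))\<^sup>2 \<le> (L * norm (dW n i \<omega>))\<^sup>2" by (intro power_mono) auto
    then show ?thesis by (simp add: power_mult_distrib)
  qed
  then have "active_sum L (\<lambda>n i \<omega>. (norm (leading n i \<omega>))\<^sup>2) n \<omega> \<le> (\<Sum>i<grid_size n. L\<^sup>2 * (norm (dW n i \<omega>))\<^sup>2)"
    by (intro active_sum_le mult_nonneg_nonneg zero_le_power2)
  then show "\<bar>active_sum L (\<lambda>n i \<omega>. (norm (leading n i \<omega>))\<^sup>2) n \<omega>\<bar>
      \<le> (\<Sum>i<grid_size n. L\<^sup>2 * (norm (dW n i \<omega>))\<^sup>2)"
    by (simp add: active_sum_nonneg)
qed

text \<open>The deviation estimate expects its coefficients as vectors.\<close>

definition gradient :: "real^'m \<Rightarrow> real^'m" where "gradient v = (\<Sum>e\<in>Basis. \<phi>1 v e *\<^sub>R e)"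

lemma gradient_inner: "gradient v \<bullet> a = \<phi>1 v a"
  unfolding gradient_def inner_sum_left by (subst (2) deriv1_basis) (simp add: inner_commute mult.commute)

lemma norm_gradient_le: "norm (gradient v) \<le> bound1 v"
  unfolding gradient_def bound1_def by (rule order_trans[OF norm_sum]) simp

lemma integral_deviation:
  assumes "0 < L"
  shows "small_in_prob M (active_sum L (\<lambda>n i \<omega>. \<phi>1 (y (t n i) \<omega>) (dN n i \<omega> - leading n i \<omega>)))"
    and "small_in_prob M (active_sum L (\<lambda>n i \<omega>. (norm (dN n i \<omega> - leading n i \<omega>))\<^sup>2))"
proof -
  have grad_meas: "(\<lambda>\<omega>. active L n i \<omega> *\<^sub>R gradient (y (t n i) \<omega>)) \<in> borel_measurable (F (t n i))" for n i
    unfolding gradient_def using adapted[of n i]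
    by (intro borel_measurable_scaleR active_adapted borel_measurable_sum measurable_deriv1_comp) auto
  have grad_le: "norm (active L n i \<omega> *\<^sub>R gradient (y (t n i) \<omega>)) \<le> L" for n i \<omega>
    using active_cases[of L n i \<omega>] active_bounds(2)[of L n i \<omega>] norm_gradient_le[of "y (t n i) \<omega>"] assms
    by auto
  have 1: "active L n i \<omega> *\<^sub>R gradient (y (t n i) \<omega>) \<bullet> active L n i \<omega> *\<^sub>R (dN n i \<omega> - leading n i \<omega>)
      = active L n i \<omega> * \<phi>1 (y (t n i) \<omega>) (dN n i \<omega> - leading n i \<omega>)" for n i \<omega>
    using active_cases[of L n i \<omega>] by (auto simp: gradient_inner)
  have 2: "(norm (active L n i \<omega> *\<^sub>R (dN n i \<omega> - leading n i \<omega>)))\<^sup>2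
      = active L n i \<omega> * (norm (dN n i \<omega> - leading n i \<omega>))\<^sup>2" for n i \<omega>
    using active_cases[of L n i \<omega>] by auto
  show "small_in_prob M (active_sum L (\<lambda>n i \<omega>. \<phi>1 (y (t n i) \<omega>) (dN n i \<omega> - leading n i \<omega>)))"
    unfolding active_sum_def[abs_def] 1[symmetric]
    by (rule integral_increment_deviation(1)[OF T active_adapted active_cases _ grad_meas grad_le less_imp_le[OF assms]])
      (rule active_bounds(1))
  show "small_in_prob M (active_sum L (\<lambda>n i \<omega>. (norm (dN n i \<omega> - leading n i \<omega>))\<^sup>2))"
    unfolding active_sum_def[abs_def] 2[symmetric]
    by (rule integral_increment_deviation(2)[OF T active_adapted active_cases _ grad_meas grad_le less_imp_le[OF assms]])
      (rule active_bounds(1))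
qed

lemma increment_on_grid: "AE \<omega> in M. \<forall>n i. dy n i \<omega> = drift n i \<omega> + dN n i \<omega>"
  using increment t_nonneg t_step by (auto elim!: eventually_mono)

lemma increment_deviation_squares:
  assumes "0 < L"
  shows "small_in_prob M (active_sum L (\<lambda>n i \<omega>. (norm (dy n i \<omega> - leading n i \<omega>))\<^sup>2))"
proof (rule small_in_prob_mono)
  let ?E = "active_sum L (\<lambda>n i \<omega>. (norm (dy n i \<omega> - leading n i \<omega>))\<^sup>2)"
  let ?A = "active_sum L (\<lambda>n i \<omega>. (norm (drift n i \<omega>))\<^sup>2)"
  let ?I = "active_sum L (\<lambda>n i \<omega>. (norm (dN n i \<omega> - leading n i \<omega>))\<^sup>2)"
  have "small_in_prob M ?A"
    by (rule small_in_prob_mono_pointwise[OF drift_squares_small])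
      (simp add: active_sum_le active_sum_nonneg)
  then show "small_in_prob M (\<lambda>n \<omega>. ?A n \<omega> * 2 + ?I n \<omega> * 2)"
    by (intro small_in_prob_add small_in_prob_cmult integral_deviation(2) assms)
  show "\<forall>\<^sub>F n in sequentially. AE \<omega> in M. \<bar>?E n \<omega>\<bar> \<le> \<bar>?A n \<omega> * 2 + ?I n \<omega> * 2\<bar>"
  proof (rule always_eventually, rule allI, rule eventually_mono[OF increment_on_grid])
    fix n \<omega> assume inc: "\<forall>n i. dy n i \<omega> = drift n i \<omega> + dN n i \<omega>"
    have "(norm (dy n i \<omega> - leading n i \<omega>))\<^sup>2 \<le> (norm (drift n i \<omega>))\<^sup>2 * 2 + (norm (dN n i \<omega> - leading n i \<omega>))\<^sup>2 * 2" for i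
      using norm_add_square_le[of "drift n i \<omega>" "dN n i \<omega> - leading n i \<omega>"] inc by (simp add: add_diff_eq mult.commute)
    then have "?E n \<omega> \<le> ?A n \<omega> * 2 + ?I n \<omega> * 2"
      unfolding active_sum_linear[symmetric] by (intro active_sum_mono)
    then show "\<bar>?E n \<omega>\<bar> \<le> \<bar>?A n \<omega> * 2 + ?I n \<omega> * 2\<bar>"
      using active_sum_nonneg[of "\<lambda>n i \<omega>. (norm (dy n i \<omega> - leading n i \<omega>))\<^sup>2" n \<omega> L] by simp
  qed
qed

lemma increment_squares_bounded:
  assumes "0 < L"
  shows "bounded_in_prob M (active_sum L (\<lambda>n i \<omega>. (norm (dy n i \<omega>))\<^sup>2))"
proof (rule bounded_in_prob_mono)
  let ?G = "active_sum L (\<lambda>n i \<omega>. (norm (leading n i \<omega>))\<^sup>2)"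
  let ?E = "active_sum L (\<lambda>n i \<omega>. (norm (dy n i \<omega> - leading n i \<omega>))\<^sup>2)"
  note E = small_imp_bounded_in_prob[OF increment_deviation_squares[OF assms]]
  show "bounded_in_prob M (\<lambda>n \<omega>. (?G n \<omega> + ?G n \<omega>) + (?E n \<omega> + ?E n \<omega>))"
    by (intro bounded_in_prob_add leading_squares_bounded E)
  fix n \<omega>
  have "(norm (dy n i \<omega>))\<^sup>2 \<le> (norm (leading n i \<omega>))\<^sup>2 * 2 + (norm (dy n i \<omega> - leading n i \<omega>))\<^sup>2 * 2" for i
    using norm_add_square_le[of "leading n i \<omega>" "dy n i \<omega> - leading n i \<omega>"] by (simp add: mult.commute)
  then have "active_sum L (\<lambda>n i \<omega>. (norm (dy n i \<omega>))\<^sup>2) n \<omega> \<le> ?G n \<omega> * 2 + ?E n \<omega> * 2"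
    unfolding active_sum_linear[symmetric] by (intro active_sum_mono)
  then show "\<bar>active_sum L (\<lambda>n i \<omega>. (norm (dy n i \<omega>))\<^sup>2) n \<omega>\<bar> \<le> (?G n \<omega> + ?G n \<omega>) + (?E n \<omega> + ?E n \<omega>)"
    by (simp add: active_sum_nonneg)
qed

text \<open>After expansion of the square, the mixed terms are controlled by the Cauchy-Schwarz inequality: the
  sum of the squared deviations is small, and that of the squared leading parts is bounded in
  probability.\<close>

lemma quadratic_term_deviation:
  assumes "0 < L"
  shows "small_in_prob M (active_sum L (\<lambda>n i \<omega>. \<phi>2 (y (t n i) \<omega>) (dy n i \<omega>) (dy n i \<omega>)
      - \<phi>2 (y (t n i) \<omega>) (leading n i \<omega>) (leading n i \<omega>)))"
proof (rule small_in_prob_mono_pointwise)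
  let ?e = "\<lambda>n i \<omega>. dy n i \<omega> - leading n i \<omega>"
  let ?G = "active_sum L (\<lambda>n i \<omega>. (norm (leading n i \<omega>))\<^sup>2)"
  let ?E = "active_sum L (\<lambda>n i \<omega>. (norm (?e n i \<omega>))\<^sup>2)"
  let ?P = "active_sum L (\<lambda>n i \<omega>. norm (?e n i \<omega>) * norm (leading n i \<omega>))"
  note E = increment_deviation_squares[OF assms]
  have "(?P n \<omega>)\<^sup>2 \<le> ?E n \<omega> * ?G n \<omega>" for n \<omega>
  proof -
    have act_sq: "(active L n i \<omega>)\<^sup>2 = active L n i \<omega>" for i
      using active_cases[of L n i \<omega>] by auto
    have P_eq: "?P n \<omega> = (\<Sum>i<grid_size n. (active L n i \<omega> * norm (?e n i \<omega>)) * (active L n i \<omega> * norm (leading n i \<omega>)))"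
      unfolding active_sum_def by (intro sum.cong refl) (simp add: active_def)
    show ?thesis
      using Cauchy_Schwarz_ineq_sum[of "\<lambda>i. active L n i \<omega> * norm (?e n i \<omega>)"
          "\<lambda>i. active L n i \<omega> * norm (leading n i \<omega>)" "{..<grid_size n}"]
      unfolding P_eq[symmetric] power_mult_distrib act_sq active_sum_def .
  qed
  then have "small_in_prob M (\<lambda>n \<omega>. (?P n \<omega>)\<^sup>2)"
    using small_in_prob_mono_pointwise[OF small_in_prob_mult[OF E leading_squares_bounded], of "\<lambda>n \<omega>. (?P n \<omega>)\<^sup>2"]
    unfolding abs_power2 by blast
  then have P: "small_in_prob M ?P" by (rule small_in_prob_sqrt)
  show "small_in_prob M (\<lambda>n \<omega>. ?P n \<omega> * (2 * L) + ?E n \<omega> * L)"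
    by (intro small_in_prob_cmult small_in_prob_add P E)
  fix n \<omega>
  have le: "\<bar>\<phi>2 (y (t n i) \<omega>) (dy n i \<omega>) (dy n i \<omega>) - \<phi>2 (y (t n i) \<omega>) (leading n i \<omega>) (leading n i \<omega>)\<bar>
      \<le> norm (?e n i \<omega>) * norm (leading n i \<omega>) * (2 * L) + (norm (?e n i \<omega>))\<^sup>2 * L"
    if act: "active L n i \<omega> = 1" for i
  proof -
    let ?v = "y (t n i) \<omega>" and ?D = "leading n i \<omega>"
    have "\<phi>2 ?v (dy n i \<omega>) (dy n i \<omega>) = \<phi>2 ?v (?D + ?e n i \<omega>) (?D + ?e n i \<omega>)" by simp
    also have "\<dots> = \<phi>2 ?v ?D ?D + \<phi>2 ?v ?D (?e n i \<omega>) + \<phi>2 ?v (?e n i \<omega>) ?D + \<phi>2 ?v (?e n i \<omega>) (?e n i \<omega>)"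
      by (simp only: linear_add[OF linear_deriv2_left] linear_add[OF linear_deriv2_right])
    finally have "\<bar>\<phi>2 ?v (dy n i \<omega>) (dy n i \<omega>) - \<phi>2 ?v ?D ?D\<bar>
        \<le> \<bar>\<phi>2 ?v ?D (?e n i \<omega>)\<bar> + \<bar>\<phi>2 ?v (?e n i \<omega>) ?D\<bar> + \<bar>\<phi>2 ?v (?e n i \<omega>) (?e n i \<omega>)\<bar>" by linarith
    also have "\<dots> \<le> L * norm ?D * norm (?e n i \<omega>) + L * norm (?e n i \<omega>) * norm ?D + L * norm (?e n i \<omega>) * norm (?e n i \<omega>)"
      using active_bounds(3)[OF act]
      by (intro add_mono order_trans[OF deriv2_le] mult_right_mono) auto
    also have "\<dots> = norm (?e n i \<omega>) * norm ?D * (2 * L) + (norm (?e n i \<omega>))\<^sup>2 * L"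
      by (simp add: power2_eq_square algebra_simps)
    finally show ?thesis .
  qed
  have "active_sum L (\<lambda>n i \<omega>. \<bar>\<phi>2 (y (t n i) \<omega>) (dy n i \<omega>) (dy n i \<omega>)
      - \<phi>2 (y (t n i) \<omega>) (leading n i \<omega>) (leading n i \<omega>)\<bar>) n \<omega> \<le> ?P n \<omega> * (2 * L) + ?E n \<omega> * L"
    unfolding active_sum_linear[symmetric] by (rule active_sum_mono, rule le)
  then show "\<bar>active_sum L (\<lambda>n i \<omega>. \<phi>2 (y (t n i) \<omega>) (dy n i \<omega>) (dy n i \<omega>)
      - \<phi>2 (y (t n i) \<omega>) (leading n i \<omega>) (leading n i \<omega>)) n \<omega>\<bar> \<le> ?P n \<omega> * (2 * L) + ?E n \<omega> * L"
    by (rule order_trans[OF active_sum_abs_le])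
qed

text \<open>In coordinates the summands are \<open>\<Delta>W(l) \<Delta>W(l') - \<delta>(l, l') \<Delta>t\<close> with bounded coefficients known at the left end
  point; their orthogonality makes the second moment of the sum as small as the mesh.\<close>

lemma quadratic_variation:
  assumes "0 < L"
  shows "small_in_prob M (active_sum L (\<lambda>n i \<omega>.
    \<phi>2 (y (t n i) \<omega>) (leading n i \<omega>) (leading n i \<omega>) - trace2 (t n i) \<omega> * (t n (Suc i) - t n i)))"
proof -
  let ?h = "\<lambda>n i l \<omega>. H (t n i) \<omega> *v axis l 1"
  define a where "a n i l l' \<omega> = active L n i \<omega> * \<phi>2 (y (t n i) \<omega>) (?h n i l \<omega>) (?h n i l' \<omega>)" for n i l l' \<omega>
  define Z where "Z l l' n \<omega> = (\<Sum>i<grid_size n. a n i l l' \<omega> *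
      (dW n i \<omega> $ l * dW n i \<omega> $ l' - (if l = l' then t n (Suc i) - t n i else 0)))" for l l' n \<omega>
  have a_meas: "a n i l l' \<in> borel_measurable (F (t n i))" for n i l l'
    unfolding a_def[abs_def] using adapted[of n i]
    by (intro borel_measurable_times active_adapted measurable_deriv2_comp measurable_matrix_vector_mult) auto
  have a_le: "\<bar>a n i l l' \<omega>\<bar> \<le> L ^ 3" for n i l l' \<omega>
  proof (cases "active L n i \<omega> = 1")
    case True
    have h: "norm (?h n i l \<omega>) \<le> L" for l
      using norm_matrix_vector_le[of "H (t n i) \<omega>" "axis l 1"] active_bounds(1)[OF True] by simp
    have "\<bar>\<phi>2 (y (t n i) \<omega>) (?h n i l \<omega>) (?h n i l' \<omega>)\<bar> \<le> L * L * L"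
      using active_bounds(3)[OF True] assms bound_nonneg
      by (intro order_trans[OF deriv2_le] mult_mono h) auto
    then show ?thesis using True by (simp add: a_def power3_eq_cube)
  next
    case False
    then show ?thesis using active_cases[of L n i \<omega>] assms by (simp add: a_def)
  qed
  have "small_in_prob M (Z l l')" for l l'
  proof (rule small_in_prob_second_moment)
    fix n
    note q = quadratic_sum_second_moment[of "t n" "grid_size n" "\<lambda>i. a n i l l'" "L ^ 3" l l',
        OF t_nonneg t_step a_meas a_le]
    show "integrable M (\<lambda>\<omega>. (Z l l' n \<omega>)\<^sup>2)" unfolding Z_def by (rule q(1))
    have "expectation (\<lambda>\<omega>. (Z l l' n \<omega>)\<^sup>2) \<le> 8 * (L ^ 3)\<^sup>2 * (\<Sum>i<grid_size n. (t n (Suc i) - t n i)\<^sup>2)"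
      unfolding Z_def by (rule q(2))
    also have "(\<Sum>i<grid_size n. (t n (Suc i) - t n i)\<^sup>2) \<le> (\<Sum>i<grid_size n. 1 / real (Suc n) * (t n (Suc i) - t n i))"
      unfolding power2_eq_square using t_step[of n] grid_mesh[of T n] by (intro sum_mono mult_right_mono) auto
    also have "\<dots> \<le> 1 / real (Suc n) * T"
      unfolding sum_distrib_left[symmetric] by (intro mult_left_mono sum_grid_le T) simp
    finally show "expectation (\<lambda>\<omega>. (Z l l' n \<omega>)\<^sup>2) \<le> 8 * (L ^ 3)\<^sup>2 * (1 / real (Suc n) * T)"
      by (simp add: mult_left_mono)
  next
    have "(\<lambda>n. 8 * (L ^ 3)\<^sup>2 * (1 / real (Suc n) * T)) \<longlonglongrightarrow> 8 * (L ^ 3)\<^sup>2 * (0 * T)"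
      by (intro tendsto_mult_left tendsto_mult_right LIMSEQ_Suc[OF lim_1_over_n])
    then show "(\<lambda>n. 8 * (L ^ 3)\<^sup>2 * (1 / real (Suc n) * T)) \<longlonglongrightarrow> 0" by simp
  qed
  then have "small_in_prob M (\<lambda>n \<omega>. \<Sum>l\<in>UNIV. \<Sum>l'\<in>UNIV. Z l l' n \<omega>)"
    by (intro small_in_prob_sum)
  moreover have "(\<Sum>l\<in>UNIV. \<Sum>l'\<in>UNIV. Z l l' n \<omega>) = active_sum L (\<lambda>n i \<omega>.
    \<phi>2 (y (t n i) \<omega>) (leading n i \<omega>) (leading n i \<omega>) - trace2 (t n i) \<omega> * (t n (Suc i) - t n i)) n \<omega>" for n \<omega>
  proof -
    have cell: "(\<Sum>l\<in>UNIV. \<Sum>l'\<in>UNIV. a n i l l' \<omega> *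
        (dW n i \<omega> $ l * dW n i \<omega> $ l' - (if l = l' then t n (Suc i) - t n i else 0)))
      = active L n i \<omega> * (\<phi>2 (y (t n i) \<omega>) (leading n i \<omega>) (leading n i \<omega>) - trace2 (t n i) \<omega> * (t n (Suc i) - t n i))" for i
    proof -
      let ?f = "\<phi>2 (y (t n i) \<omega>)" and ?w = "dW n i \<omega>" and ?dt = "t n (Suc i) - t n i"
      have lead: "leading n i \<omega> = (\<Sum>l\<in>UNIV. ?w $ l *\<^sub>R ?h n i l \<omega>)"
        by (simp add: matrix_mult_sum[of "H (t n i) \<omega>"] matrix_vector_mult_basis scalar_mult_eq_scaleR)
      have "?f (leading n i \<omega>) (leading n i \<omega>) = (\<Sum>l\<in>UNIV. \<Sum>l'\<in>UNIV. ?w $ l * ?w $ l' * ?f (?h n i l \<omega>) (?h n i l' \<omega>))"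
      proof -
        have left: "?f (leading n i \<omega>) v = (\<Sum>l\<in>UNIV. ?w $ l * ?f (?h n i l \<omega>) v)" for v
          by (subst lead) (simp only: linear_sum[OF linear_deriv2_left] linear_scale[OF linear_deriv2_left] real_scaleR_def)
        have right: "?f v (leading n i \<omega>) = (\<Sum>l\<in>UNIV. ?w $ l * ?f v (?h n i l \<omega>))" for v
          by (subst lead) (simp only: linear_sum[OF linear_deriv2_right] linear_scale[OF linear_deriv2_right] real_scaleR_def)
        show ?thesis
          by (subst left, subst right) (simp only: sum_distrib_left mult.assoc)
      qed
      moreover have "trace2 (t n i) \<omega> * ?dt
          = (\<Sum>l\<in>UNIV. \<Sum>l'\<in>UNIV. (if l = l' then ?dt else 0) * ?f (?h n i l \<omega>) (?h n i l' \<omega>))"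
        unfolding trace2_def sum_distrib_right by (intro sum.cong refl) (simp add: if_distrib if_distribR mult.commute cong: if_cong)
      ultimately have "active L n i \<omega> * (?f (leading n i \<omega>) (leading n i \<omega>) - trace2 (t n i) \<omega> * ?dt)
         = (\<Sum>l\<in>UNIV. \<Sum>l'\<in>UNIV. active L n i \<omega> * (?w $ l * ?w $ l' * ?f (?h n i l \<omega>) (?h n i l' \<omega>)
            - (if l = l' then ?dt else 0) * ?f (?h n i l \<omega>) (?h n i l' \<omega>)))"
        by (simp only: sum_subtractf[symmetric] sum_distrib_left)
      then show ?thesis unfolding a_def by (simp only: algebra_simps)
    qed
    have "(\<Sum>l\<in>UNIV. \<Sum>l'\<in>UNIV. Z l l' n \<omega>) = (\<Sum>i<grid_size n. \<Sum>l\<in>UNIV. \<Sum>l'\<in>UNIV. a n i l l' \<omega> *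
        (dW n i \<omega> $ l * dW n i \<omega> $ l' - (if l = l' then t n (Suc i) - t n i else 0)))"
      unfolding Z_def by (rule trans[OF sum.cong[OF refl sum.swap] sum.swap])
    then show ?thesis unfolding cell active_sum_def .
  qed
  ultimately show ?thesis by simp
qed

text \<open>The largest relative remainder tends to zero, and it multiplies a sum that is bounded in
  probability.\<close>

lemma remainder_small:
  assumes "0 < L"
  shows "small_in_prob M (active_sum L (\<lambda>n i \<omega>. taylor_remainder (y (t n i) \<omega>) (y (t n (Suc i)) \<omega>)))"
proof (rule small_in_prob_mono_pointwise)
  let ?\<rho> = "\<lambda>n \<omega>. Max ((\<lambda>i. \<bar>relative_remainder n i \<omega>\<bar>) ` {..<grid_size n})"
  let ?V = "active_sum L (\<lambda>n i \<omega>. (norm (dy n i \<omega>))\<^sup>2)"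
  show "small_in_prob M (\<lambda>n \<omega>. ?\<rho> n \<omega> * ?V n \<omega>)"
    by (rule small_in_prob_mult[OF relative_remainder_small increment_squares_bounded[OF assms]])
  fix n \<omega>
  show "\<bar>active_sum L (\<lambda>n i \<omega>. taylor_remainder (y (t n i) \<omega>) (y (t n (Suc i)) \<omega>)) n \<omega>\<bar> \<le> ?\<rho> n \<omega> * ?V n \<omega>"
    unfolding active_sum_def sum_distrib_left
  proof (intro order_trans[OF sum_abs] sum_mono)
    fix i assume i: "i \<in> {..<grid_size n}"
    have eq: "taylor_remainder (y (t n i) \<omega>) (y (t n (Suc i)) \<omega>) = relative_remainder n i \<omega> * (norm (dy n i \<omega>))\<^sup>2"
    proof (cases "dy n i \<omega> = 0")
      case True
      then show ?thesis using linear_0[OF linear_deriv1] linear_0[OF linear_deriv2_right] by (simp add: taylor_remainder_def)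
    qed (simp add: relative_remainder_def)
    have "\<bar>active L n i \<omega> * taylor_remainder (y (t n i) \<omega>) (y (t n (Suc i)) \<omega>)\<bar>
        = \<bar>relative_remainder n i \<omega>\<bar> * (active L n i \<omega> * (norm (dy n i \<omega>))\<^sup>2)"
      unfolding eq using active_cases[of L n i \<omega>] by (auto simp: abs_mult)
    also have "\<dots> \<le> ?\<rho> n \<omega> * (active L n i \<omega> * (norm (dy n i \<omega>))\<^sup>2)"
      using i by (intro mult_right_mono mult_nonneg_nonneg Max_ge) (simp_all add: active_def)
    finally show "\<bar>active L n i \<omega> * taylor_remainder (y (t n i) \<omega>) (y (t n (Suc i)) \<omega>)\<bar>
        \<le> ?\<rho> n \<omega> * (active L n i \<omega> * (norm (dy n i \<omega>))\<^sup>2)" .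
  qed
qed

definition ito_drift :: "real \<Rightarrow> 'w \<Rightarrow> real" where
  "ito_drift u \<omega> = \<phi>1 (y u \<omega>) (b u \<omega>) + trace2 u \<omega> / 2"

text \<open>Outside an event of small probability all left end points are active; there the Taylor
  expansions over the cells of the grid add up to the claim, each error term being small.\<close>

lemma ito_left_point_sums:
  "small_in_prob M (\<lambda>n \<omega>. (\<Sum>i<grid_size n. \<phi>1 (y (t n i) \<omega>) (leading n i \<omega>))
     - (\<phi> (y T \<omega>) - \<phi> (y 0 \<omega>) - (LINT u:{0..T}|lborel. ito_drift u \<omega>)))"
proof (rule small_in_prob_localize)
  fix d :: real assume "0 < d"
  from size_at_uniformly_bounded[OF this] obtain L where L: "0 < L"
    and all_active: "mostly M d (\<lambda>\<omega>. \<forall>n i. active L n i \<omega> = 1)" by blast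
  let ?X1 = "\<lambda>n \<omega>. (\<Sum>i<grid_size n. LINT u:{t n i..t n (Suc i)}|lborel. \<phi>1 (y (t n i) \<omega>) (b u \<omega>))
     - (LINT u:{0..T}|lborel. \<phi>1 (y u \<omega>) (b u \<omega>))"
  let ?X2 = "active_sum L (\<lambda>n i \<omega>. \<phi>1 (y (t n i) \<omega>) (dN n i \<omega> - leading n i \<omega>))"
  let ?X3 = "active_sum L (\<lambda>n i \<omega>. \<phi>2 (y (t n i) \<omega>) (dy n i \<omega>) (dy n i \<omega>)
      - \<phi>2 (y (t n i) \<omega>) (leading n i \<omega>) (leading n i \<omega>))"
  let ?X4 = "active_sum L (\<lambda>n i \<omega>. \<phi>2 (y (t n i) \<omega>) (leading n i \<omega>) (leading n i \<omega>)
      - trace2 (t n i) \<omega> * (t n (Suc i) - t n i))"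
  let ?X5 = "\<lambda>n \<omega>. (\<Sum>i<grid_size n. LINT u:{t n i..t n (Suc i)}|lborel. trace2 (t n i) \<omega>)
     - (LINT u:{0..T}|lborel. trace2 u \<omega>)"
  let ?X6 = "active_sum L (\<lambda>n i \<omega>. taylor_remainder (y (t n i) \<omega>) (y (t n (Suc i)) \<omega>))"
  let ?X = "\<lambda>n \<omega>. ?X1 n \<omega> + (?X2 n \<omega> + (?X3 n \<omega> * (1/2) + (?X4 n \<omega> * (1/2) + (?X5 n \<omega> * (1/2) + ?X6 n \<omega>))))"
  have small: "small_in_prob M ?X"
    by (intro small_in_prob_add small_in_prob_cmult drift_left_point_sums integral_deviation(1)[OF L]
        quadratic_term_deviation[OF L] quadratic_variation[OF L] trace_left_point_sums remainder_small[OF L])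
  obtain n0 where n0: "T < real n0" using reals_Archimedean2 by blast
  have eq: "(\<Sum>i<grid_size n. \<phi>1 (y (t n i) \<omega>) (leading n i \<omega>))
     - (\<phi> (y T \<omega>) - \<phi> (y 0 \<omega>) - (LINT u:{0..T}|lborel. ito_drift u \<omega>)) = - ?X n \<omega>"
    if "n0 \<le> n" and act: "\<forall>n i. active L n i \<omega> = 1"
      and "(continuous_on {0..} (\<lambda>s. y s \<omega>) \<and> continuous_on {0..} (\<lambda>s. b s \<omega>) \<and> continuous_on {0..} (\<lambda>s. H s \<omega>))
        \<and> (\<forall>n i. dy n i \<omega> = drift n i \<omega> + dN n i \<omega>)" for n \<omega>
  proof -
    have paths: "continuous_on {0..} (\<lambda>s. y s \<omega>)" "continuous_on {0..} (\<lambda>s. b s \<omega>)"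
      "continuous_on {0..} (\<lambda>s. H s \<omega>)" and inc: "\<And>i. dy n i \<omega> = drift n i \<omega> + dN n i \<omega>"
      using that(3) by blast+
    have sub: "continuous_on {x..z} f" if "continuous_on {0..} f" "0 \<le> x" for f :: "real \<Rightarrow> 'z::topological_space" and x z
      by (rule continuous_on_subset[OF that(1)]) (use that(2) in simp)
    have tN: "t n (grid_size n) = T" using n0 that(1) by (intro grid_end) auto
    have t0: "t n 0 = 0" by (rule grid_0[OF T])
    have drift_eq: "\<phi>1 (y (t n i) \<omega>) (drift n i \<omega>) = (LINT u:{t n i..t n (Suc i)}|lborel. \<phi>1 (y (t n i) \<omega>) (b u \<omega>))" for i
    proof -
      have bl: "bounded_linear (\<phi>1 (y (t n i) \<omega>))"
        using linear_deriv1 by (simp add: linear_conv_bounded_linear)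
      have "set_integrable lborel {t n i..t n (Suc i)} (\<lambda>u. b u \<omega>)"
        by (intro borel_integrable_atLeastAtMost' sub[OF paths(2)] t_nonneg)
      then show ?thesis
        unfolding set_lebesgue_integral_def set_integrable_def
        by (simp add: integral_bounded_linear[OF bl, symmetric] linear_scale[OF linear_deriv1])
    qed
    have trace_eq: "(LINT u:{t n i..t n (Suc i)}|lborel. trace2 (t n i) \<omega>) = trace2 (t n i) \<omega> * (t n (Suc i) - t n i)" for i
      by (intro set_integral_cell_const t_step refl borel_integrable_atLeastAtMost' continuous_intros)
    have "(LINT u:{0..T}|lborel. ito_drift u \<omega>)
        = (LINT u:{0..T}|lborel. \<phi>1 (y u \<omega>) (b u \<omega>)) + (LINT u:{0..T}|lborel. trace2 u \<omega>) / 2"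
    proof -
      have "set_integrable lborel {0..T} (\<lambda>u. \<phi>1 (y u \<omega>) (b u \<omega>))"
        by (intro borel_integrable_atLeastAtMost' continuous_intros sub[OF paths(1)] sub[OF paths(2)] order_refl)
      moreover have "set_integrable lborel {0..T} (\<lambda>u. trace2 u \<omega>)"
        by (intro borel_integrable_atLeastAtMost' sub[OF continuous_trace2[OF paths(1,3)]] order_refl)
      ultimately show ?thesis
        unfolding ito_drift_def by (subst set_integral_add(2)) auto
    qed
    moreover have "\<phi> (y T \<omega>) - \<phi> (y 0 \<omega>) = (\<Sum>i<grid_size n. \<phi> (y (t n (Suc i)) \<omega>) - \<phi> (y (t n i) \<omega>))"
      by (rule sum_lessThan_telescope[of "\<lambda>i. \<phi> (y (t n i) \<omega>)" "grid_size n", unfolded tN t0, symmetric])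
    moreover have "\<phi> (y (t n (Suc i)) \<omega>) - \<phi> (y (t n i) \<omega>)
      = (LINT u:{t n i..t n (Suc i)}|lborel. \<phi>1 (y (t n i) \<omega>) (b u \<omega>))
        + \<phi>1 (y (t n i) \<omega>) (dN n i \<omega> - leading n i \<omega>) + \<phi>1 (y (t n i) \<omega>) (leading n i \<omega>)
        + (\<phi>2 (y (t n i) \<omega>) (dy n i \<omega>) (dy n i \<omega>) - \<phi>2 (y (t n i) \<omega>) (leading n i \<omega>) (leading n i \<omega>)) * (1/2)
        + (\<phi>2 (y (t n i) \<omega>) (leading n i \<omega>) (leading n i \<omega>) - trace2 (t n i) \<omega> * (t n (Suc i) - t n i)) * (1/2)
        + (LINT u:{t n i..t n (Suc i)}|lborel. trace2 (t n i) \<omega>) * (1/2)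
        + taylor_remainder (y (t n i) \<omega>) (y (t n (Suc i)) \<omega>)" for i
    proof -
      have "\<phi>1 (y (t n i) \<omega>) (dy n i \<omega>) = \<phi>1 (y (t n i) \<omega>) (drift n i \<omega> + ((dN n i \<omega> - leading n i \<omega>) + leading n i \<omega>))"
        unfolding inc by (simp only: diff_add_cancel)
      also have "\<dots> = \<phi>1 (y (t n i) \<omega>) (drift n i \<omega>)
          + (\<phi>1 (y (t n i) \<omega>) (dN n i \<omega> - leading n i \<omega>) + \<phi>1 (y (t n i) \<omega>) (leading n i \<omega>))"
        by (simp only: linear_add[OF linear_deriv1])
      finally show ?thesis
        unfolding taylor_remainder_def trace_eq drift_eq[symmetric] by (simp add: field_simps)
    qed
    ultimately show ?thesis
      by (simp only: active_sum_def act mult_1_left sum.distrib sum_distrib_right[symmetric] sum_divide_distrib) argo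
  qed
  have good: "mostly M d (\<lambda>\<omega>. (\<forall>n i. active L n i \<omega> = 1) \<and>
      (continuous_on {0..} (\<lambda>s. y s \<omega>) \<and> continuous_on {0..} (\<lambda>s. b s \<omega>) \<and> continuous_on {0..} (\<lambda>s. H s \<omega>))
        \<and> (\<forall>n i. dy n i \<omega> = drift n i \<omega> + dN n i \<omega>))"
    by (rule mostly_mono[OF mostly_conj[OF all_active mostly_conj[OF mostly_AE[OF AE_paths] mostly_AE[OF increment_on_grid]]]])
      simp_all
  show "\<exists>X. small_in_prob M X \<and> (\<forall>\<^sub>F n in sequentially. mostly M d (\<lambda>\<omega>.
      \<bar>(\<Sum>i<grid_size n. \<phi>1 (y (t n i) \<omega>) (leading n i \<omega>))
       - (\<phi> (y T \<omega>) - \<phi> (y 0 \<omega>) - (LINT u:{0..T}|lborel. ito_drift u \<omega>))\<bar> \<le> \<bar>X n \<omega>\<bar>))"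
  proof (intro exI[of _ ?X] conjI small eventually_mono[OF eventually_ge_at_top[of n0]])
    fix n assume "n0 \<le> n"
    show "mostly M d (\<lambda>\<omega>. \<bar>(\<Sum>i<grid_size n. \<phi>1 (y (t n i) \<omega>) (leading n i \<omega>))
       - (\<phi> (y T \<omega>) - \<phi> (y 0 \<omega>) - (LINT u:{0..T}|lborel. ito_drift u \<omega>))\<bar> \<le> \<bar>?X n \<omega>\<bar>)"
    proof (rule mostly_mono[OF good order_refl], elim conjE)
      fix \<omega> assume "\<forall>n i. active L n i \<omega> = 1" "continuous_on {0..} (\<lambda>s. y s \<omega>)" "continuous_on {0..} (\<lambda>s. b s \<omega>)"
        "continuous_on {0..} (\<lambda>s. H s \<omega>)" "\<forall>n i. dy n i \<omega> = drift n i \<omega> + dN n i \<omega>"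
      from eq[OF \<open>n0 \<le> n\<close> this(1) conjI[OF conjI[OF this(2) conjI[OF this(3,4)]] this(5)]]
      show "\<bar>(\<Sum>i<grid_size n. \<phi>1 (y (t n i) \<omega>) (leading n i \<omega>))
       - (\<phi> (y T \<omega>) - \<phi> (y 0 \<omega>) - (LINT u:{0..T}|lborel. ito_drift u \<omega>))\<bar> \<le> \<bar>?X n \<omega>\<bar>"
        by (simp only: abs_minus_cancel order_refl)
    qed
  qed
qed

end

section \<open>The Ito formula\<close>

lemma continuous_on_indefinite_integral:
  fixes g :: "real \<Rightarrow> 'b::euclidean_space"
  assumes "continuous_on {0..} g"
  shows "continuous_on {0..} (\<lambda>t. LINT u:{0..t}|lborel. g u)"
  unfolding continuous_on_eq_continuous_within
proof
  fix t :: real assume t: "t \<in> {0..}"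
  have sub: "continuous_on {0..s} g" for s
    by (rule continuous_on_subset[OF assms]) auto
  have eq: "(LINT u:{0..s}|lborel. g u) = integral {0..s} g" for s
    by (rule set_borel_integral_eq_integral(2)[OF borel_integrable_atLeastAtMost'[OF sub]])
  have "continuous_on {0..t + 1} (\<lambda>s. integral {0..s} g)"
    by (rule indefinite_integral_continuous_1[OF integrable_continuous_real[OF sub]])
  then have "continuous (at t within {0..t + 1}) (\<lambda>s. integral {0..s} g)"
    using t by (simp add: continuous_on_eq_continuous_within)
  moreover have "at t within {0..t + 1} = at t within {0..}"
    by (rule at_within_nhd[of _ "{..<t + 1}"]) (use t in auto)
  ultimately show "continuous (at t within {0..}) (\<lambda>t. LINT u:{0..t}|lborel. g u)"
    unfolding eq by simp
qed

lemma set_integral_cong_left_open: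
  fixes g h :: "real \<Rightarrow> 'b::euclidean_space"
  assumes "\<And>u. a < u \<Longrightarrow> u \<le> b \<Longrightarrow> g u = h u"
    and "set_integrable lborel {a..b} g" "set_integrable lborel {a..b} h"
  shows "(LINT u:{a..b}|lborel. g u) = (LINT u:{a..b}|lborel. h u)"
  unfolding set_borel_integral_eq_integral(2)[OF assms(2)] set_borel_integral_eq_integral(2)[OF assms(3)]
  by (rule integral_spike[of "{a}"]) (use assms(1) in auto)

lemma borel_measurable_vec_lambda:
  fixes f :: "'w \<Rightarrow> 'i::finite \<Rightarrow> 'b::euclidean_space"
  assumes "\<And>i. (\<lambda>w. f w i) \<in> borel_measurable N"
  shows "(\<lambda>w. \<chi> i. f w i) \<in> borel_measurable N"
  unfolding borel_measurable_euclidean_space[where 'c = "'b ^ 'i"]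
  using assms by (auto simp: Basis_vec_def inner_axis)

context ito_process
begin

text \<open>The stochastic part is read off from the formula as what remains of \<open>\<psi>(y)\<close> when the drift is
  subtracted; in this way its continuity comes for free and no stochastic integral has to be
  constructed.  It remains to exhibit simple processes that approximate \<open>D\<psi>(y) H\<close> and whose integrals
  converge to it: the integrand frozen at the left end points of the grids will do.  The boundedness
  assumption is there because simple processes have bounded values.\<close>

lemma ito_formula:
  fixes \<psi> :: "'n::finite \<Rightarrow> real^'m \<Rightarrow> real"
  assumes C2: "\<And>c. C2_function (\<psi> c) (\<psi>1 c) (\<psi>2 c)"
  defines "J \<equiv> \<lambda>t \<omega>. (\<chi> c l. \<psi>1 c (y t \<omega>) (H t \<omega> *v axis l 1)) :: real^'d^'n"
    and "\<beta> \<equiv> \<lambda>c u \<omega>. \<psi>1 c (y u \<omega>) (b u \<omega>) + (\<Sum>l\<in>UNIV. \<psi>2 c (y u \<omega>) (H u \<omega> *v axis l 1) (H u \<omega> *v axis l 1)) / 2"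
  assumes J_bounded: "\<And>t. 0 \<le> t \<Longrightarrow> bounded (J t ` space M)"
  shows "is_ito_integral M F W J (\<lambda>t \<omega>. \<chi> c. \<psi> c (y t \<omega>) - \<psi> c (y 0 \<omega>) - (LINT u:{0..t}|lborel. \<beta> c u \<omega>))"
proof -
  interpret C2: C2_function "\<psi> c" "\<psi>1 c" "\<psi>2 c" for c by (rule C2)
  let ?N = "\<lambda>t \<omega>. (\<chi> c. \<psi> c (y t \<omega>) - \<psi> c (y 0 \<omega>) - (LINT u:{0..t}|lborel. \<beta> c u \<omega>)) :: real^'n"
  have AE_paths: "AE \<omega> in M. continuous_on {0..} (\<lambda>s. y s \<omega>) \<and> continuous_on {0..} (\<lambda>s. b s \<omega>)
    \<and> continuous_on {0..} (\<lambda>s. H s \<omega>)"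
    using y_continuous b_continuous H_continuous by (simp add: continuous_paths_def)
  have J_path: "continuous_on {0..} (\<lambda>s. J s \<omega>)" and \<beta>_path: "continuous_on {0..} (\<lambda>s. \<beta> c s \<omega>)"
    if "continuous_on {0..} (\<lambda>s. y s \<omega>)" "continuous_on {0..} (\<lambda>s. b s \<omega>)" "continuous_on {0..} (\<lambda>s. H s \<omega>)" for \<omega> c
    unfolding J_def \<beta>_def using that
    by (intro continuous_on_vec_lambda C2.continuous_on_deriv1_comp C2.continuous_on_deriv2_comp continuous_intros; simp)+
  have J_prog: "prog_measurable F J"
    unfolding prog_measurable_def
  proof (intro allI impI)
    fix T :: real assume "0 \<le> T"
    note m = prog_measurableD[OF y_prog this] prog_measurableD[OF H_prog this]
    have "(\<lambda>p. \<psi>1 c (y (fst p) (snd p)) (H (fst p) (snd p) *v axis l 1))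
        \<in> borel_measurable (restrict_space borel {0..T} \<Otimes>\<^sub>M F T)" for c l
      using m unfolding case_prod_beta by (intro C2.measurable_deriv1_comp measurable_matrix_vector_mult) auto
    then show "(\<lambda>(t, \<omega>). J t \<omega>) \<in> borel_measurable (restrict_space borel {0..T} \<Otimes>\<^sub>M F T)"
      unfolding J_def case_prod_beta by (intro borel_measurable_vec_lambda)
  qed
  have J_apply: "(J t \<omega> *v v) $ c = \<psi>1 c (y t \<omega>) (H t \<omega> *v v)" for t \<omega> v c
  proof -
    have "\<psi>1 c (y t \<omega>) (H t \<omega> *v v) = \<psi>1 c (y t \<omega>) (\<Sum>l\<in>UNIV. v $ l *\<^sub>R (H t \<omega> *v axis l 1))"
      by (simp add: matrix_mult_sum[of "H t \<omega>"] matrix_vector_mult_basis scalar_mult_eq_scaleR)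
    also have "\<dots> = (\<Sum>l\<in>UNIV. v $ l * \<psi>1 c (y t \<omega>) (H t \<omega> *v axis l 1))"
      by (simp add: linear_sum[OF C2.linear_deriv1] linear_scale[OF C2.linear_deriv1])
    finally show ?thesis by (simp add: J_def matrix_vector_mult_def mult.commute)
  qed
  \<comment> \<open>the approximating simple processes: \<open>J\<close> frozen at the left end points of the grid\<close>
  define \<tau> where "\<tau> r i = real i / real (Suc r)" for r i :: nat
  define \<xi> where "\<xi> r i = J (\<tau> r i)" for r i :: nat
  have \<tau>: "0 \<le> \<tau> r i" "\<tau> r i < \<tau> r j \<longleftrightarrow> i < j" for r i j
    by (auto simp: \<tau>_def divide_less_cancel)
  have grid: "grid T r i = min T (\<tau> r i)" for T r i by (simp add: grid_def \<tau>_def)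
  have simple: "simple_process_data M F (grid_size r) (\<tau> r) (\<xi> r)" for r
    unfolding simple_process_data_def \<xi>_def
    using \<tau>(1) \<tau>(2)[of r] prog_measurable_adapted[OF J_prog \<tau>(1)] J_bounded[OF \<tau>(1)]
    by (auto intro: less_imp_le)
  have simple_value: "simple_process (grid_size r) (\<tau> r) (\<xi> r) u \<omega> = \<xi> r i \<omega>"
    if "i < grid_size r" "\<tau> r i < u" "u \<le> \<tau> r (Suc i)" for r i u \<omega>
  proof -
    have "indicator {\<tau> r j<..\<tau> r (Suc j)} u *\<^sub>R \<xi> r j \<omega> = (if j = i then \<xi> r i \<omega> else 0)" for j
    proof (cases "j = i")
      case False
      then consider "Suc j \<le> i" | "Suc i \<le> j" by linarith
      then have "u \<notin> {\<tau> r j<..\<tau> r (Suc j)}"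
        using that(2,3) \<tau>(2)[of r i "Suc j"] \<tau>(2)[of r j "Suc i"] by cases auto
      then show ?thesis using False by simp
    qed (use that in simp)
    then show ?thesis unfolding simple_process_def using that(1) by simp
  qed
  have square_conv: "conv_in_prob M (\<lambda>r \<omega>. LINT u:{0..T}|lborel.
      (norm (simple_process (grid_size r) (\<tau> r) (\<xi> r) u \<omega> - J u \<omega>))\<^sup>2) (\<lambda>\<omega>. 0)" if T: "0 \<le> T" for T
  proof -
    let ?X = "\<lambda>r \<omega>. LINT u:{0..T}|lborel. (norm (simple_process (grid_size r) (\<tau> r) (\<xi> r) u \<omega> - J u \<omega>))\<^sup>2"
    have X_meas: "?X r \<in> borel_measurable M" for r
    proof (rule time_integral_measurable[OF _ T order_refl order_refl])
      note [measurable] = simple_process_jointly[OF simple[of r], of T] prog_measurable_jointly[OF J_prog T]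
      show "(\<lambda>(u, \<omega>). (norm (simple_process (grid_size r) (\<tau> r) (\<xi> r) u \<omega> - J u \<omega>))\<^sup>2)
          \<in> borel_measurable (restrict_space borel {0..T} \<Otimes>\<^sub>M M)"
        by measurable
    qed
    have "small_in_prob M ?X"
    proof (rule AE_tendsto_imp_small_in_prob[OF X_meas])
      show "AE \<omega> in M. (\<lambda>r. ?X r \<omega>) \<longlonglongrightarrow> 0"
        using AE_paths
      proof eventually_elim
        case (elim \<omega>)
        then have path: "continuous_on {0..} (\<lambda>s. J s \<omega>)" using J_path by blast
        have sub: "continuous_on {p..q} (\<lambda>s. J s \<omega>)" if "0 \<le> p" for p q
          by (rule continuous_on_subset[OF path]) (use that in auto)
        have "continuous_on ({0..T} \<times> {0..T}) (\<lambda>(s, u). (norm (J s \<omega> - J u \<omega>))\<^sup>2)"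
          unfolding case_prod_beta by (intro continuous_intros continuous_on_compose2[OF path]) auto
        from left_point_sums_converge[OF T this]
        have lim: "(\<lambda>n. \<Sum>i<grid_size n. LINT u:{grid T n i..grid T n (Suc i)}|lborel.
            (norm (J (grid T n i) \<omega> - J u \<omega>))\<^sup>2) \<longlonglongrightarrow> 0" by simp
        obtain n0 where n0: "T < real n0" using reals_Archimedean2 by blast
        have "(\<Sum>i<grid_size n. LINT u:{grid T n i..grid T n (Suc i)}|lborel. (norm (J (grid T n i) \<omega> - J u \<omega>))\<^sup>2)
            = ?X n \<omega>" if "n0 \<le> n" for n
        proof -
          let ?S = "simple_process (grid_size n) (\<tau> n) (\<xi> n)"
          have S_int: "set_integrable lborel {p..q} (\<lambda>u. (norm (?S u \<omega> - J u \<omega>))\<^sup>2)" if "0 \<le> p" for p q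
            by (rule set_integrable_square_difference[OF simple_process_measurable_time simple_process_norm_le sub[OF that]])
          have "(LINT u:{grid T n i..grid T n (Suc i)}|lborel. (norm (J (grid T n i) \<omega> - J u \<omega>))\<^sup>2)
              = (LINT u:{grid T n i..grid T n (Suc i)}|lborel. (norm (?S u \<omega> - J u \<omega>))\<^sup>2)" if i: "i < grid_size n" for i
          proof (rule set_integral_cong_left_open)
            fix u assume "grid T n i < u" "u \<le> grid T n (Suc i)"
            then have "grid T n i = \<tau> n i" "\<tau> n i < u" "u \<le> \<tau> n (Suc i)" unfolding grid by auto
            then show "(norm (J (grid T n i) \<omega> - J u \<omega>))\<^sup>2 = (norm (?S u \<omega> - J u \<omega>))\<^sup>2"
              using simple_value[OF i] by (simp add: \<xi>_def)
          next
            show "set_integrable lborel {grid T n i..grid T n (Suc i)} (\<lambda>u. (norm (J (grid T n i) \<omega> - J u \<omega>))\<^sup>2)"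
              by (intro borel_integrable_atLeastAtMost' continuous_intros sub grid_nonneg[OF T])
          qed (rule S_int[OF grid_nonneg[OF T]])
          then have "(\<Sum>i<grid_size n. LINT u:{grid T n i..grid T n (Suc i)}|lborel. (norm (J (grid T n i) \<omega> - J u \<omega>))\<^sup>2)
            = (\<Sum>i<grid_size n. LINT u:{grid T n i..grid T n (Suc i)}|lborel. (norm (?S u \<omega> - J u \<omega>))\<^sup>2)"
            by (intro sum.cong) auto
          also have "\<dots> = (LINT u:{grid T n 0..grid T n (grid_size n)}|lborel. (norm (?S u \<omega> - J u \<omega>))\<^sup>2)"
            by (intro set_integral_combine_sum grid_mono S_int grid_nonneg[OF T]) simp
          also have "\<dots> = ?X n \<omega>"
          proof -
            have "grid T n (grid_size n) = T" using n0 that by (intro grid_end) auto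
            then show ?thesis by (simp only: grid_0[OF T])
          qed
          finally show ?thesis .
        qed
        then show ?case
          by (intro Lim_transform_eventually[OF lim]) (auto simp: eventually_sequentially)
      qed
    qed
    then show ?thesis
      by (subst conv_in_prob_iff_small_in_prob[OF X_meas])
        (auto elim!: small_in_prob_mono)
  qed
  have N_meas: "?N T \<in> borel_measurable M" if T: "0 \<le> T" for T
  proof -
    have \<beta>_meas: "(\<lambda>(u, \<omega>). \<beta> c u \<omega>) \<in> borel_measurable (restrict_space borel {0..T} \<Otimes>\<^sub>M M)" for c
      unfolding \<beta>_def case_prod_beta
      using prog_measurable_jointly[OF y_prog T] prog_measurable_jointly[OF b_prog T] prog_measurable_jointly[OF H_prog T]
      unfolding case_prod_beta
      by (intro borel_measurable_add borel_measurable_divide borel_measurable_sum borel_measurable_const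
          C2.measurable_deriv1_comp C2.measurable_deriv2_comp measurable_matrix_vector_mult) auto
    show ?thesis
      by (intro borel_measurable_vec_lambda borel_measurable_diff C2.measurable_function_comp prog_measurable_at[OF y_prog]
          time_integral_measurable[OF \<beta>_meas T] T order_refl)
  qed
  have integral_conv: "conv_in_prob M (\<lambda>r. simple_integral W (grid_size r) (\<tau> r) (\<xi> r) T) (?N T)" if T: "0 \<le> T" for T
  proof -
    let ?I = "\<lambda>r. simple_integral W (grid_size r) (\<tau> r) (\<xi> r) T"
    let ?d = "\<lambda>c r \<omega>. (\<Sum>i<grid_size r. \<psi>1 c (y (grid T r i) \<omega>) (H (grid T r i) \<omega> *v incr (grid T r i) (grid T r (Suc i)) \<omega>))
       - (\<psi> c (y T \<omega>) - \<psi> c (y 0 \<omega>) - (LINT u:{0..T}|lborel. \<beta> c u \<omega>))"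
    have d_small: "small_in_prob M (?d c)" for c
    proof -
      interpret ito_C2 M F W y b N H "\<psi> c" "\<psi>1 c" "\<psi>2 c" T
        by unfold_locales (rule T)
      show ?thesis using ito_left_point_sums unfolding ito_drift_def trace2_def \<beta>_def .
    qed
    have "(?I r \<omega> - ?N T \<omega>) $ c = ?d c r \<omega>" for c r \<omega>
    proof -
      have "?I r \<omega> = (\<Sum>i<grid_size r. J (grid T r i) \<omega> *v incr (grid T r i) (grid T r (Suc i)) \<omega>)"
        unfolding simple_integral_def
      proof (intro sum.cong refl)
        fix i
        show "\<xi> r i \<omega> *v (W (min T (\<tau> r (Suc i))) \<omega> - W (min T (\<tau> r i)) \<omega>)
            = J (grid T r i) \<omega> *v incr (grid T r i) (grid T r (Suc i)) \<omega>"
        proof (cases "\<tau> r i < T")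
          case True
          then show ?thesis by (simp add: grid \<xi>_def min_def)
        next
          case False
          then have "min T (\<tau> r i) = T" "min T (\<tau> r (Suc i)) = T" using \<tau>(2)[of r i "Suc i"] by auto
          then show ?thesis by (simp add: grid)
        qed
      qed
      then show ?thesis by (simp add: J_apply)
    qed
    then have "norm (?I r \<omega> - ?N T \<omega>) \<le> (\<Sum>c\<in>UNIV. \<bar>?d c r \<omega>\<bar>)" for r \<omega>
      using norm_le_l1_cart[of "?I r \<omega> - ?N T \<omega>"] by simp
    moreover have "small_in_prob M (\<lambda>r \<omega>. \<Sum>c\<in>UNIV. \<bar>?d c r \<omega>\<bar>)"
    proof (rule small_in_prob_sum)
      fix c
      show "small_in_prob M (\<lambda>r \<omega>. \<bar>?d c r \<omega>\<bar>)"
        by (rule small_in_prob_mono[OF d_small[of c]]) (simp only: abs_idempotent order_refl always_eventually AE_I2 simp_thms)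
    qed
    ultimately have "small_in_prob M (\<lambda>r \<omega>. norm (?I r \<omega> - ?N T \<omega>))"
      by (elim small_in_prob_mono) (intro always_eventually allI AE_I2, simp add: order_trans[OF _ abs_ge_self])
    then show ?thesis
      by (subst conv_in_prob_iff_small_in_prob[OF simple_integral_measurable[OF simple T] N_meas[OF T]])
  qed
  have square_integrable: "AE \<omega> in M. \<forall>T\<ge>0. set_integrable lborel {0..T} (\<lambda>t. (norm (J t \<omega>))\<^sup>2)"
    using AE_paths
  proof eventually_elim
    case (elim \<omega>)
    then have path: "continuous_on {0..} (\<lambda>s. J s \<omega>)" using J_path by blast
    have "continuous_on {0..T} (\<lambda>s. J s \<omega>)" for T
      by (rule continuous_on_subset[OF path]) simp
    then show ?case by (intro allI impI borel_integrable_atLeastAtMost' continuous_intros)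
  qed
  have N_paths: "continuous_paths M ?N"
    unfolding continuous_paths_def using AE_paths
  proof eventually_elim
    case (elim \<omega>)
    then have y: "continuous_on {0..} (\<lambda>s. y s \<omega>)" and \<beta>: "continuous_on {0..} (\<lambda>s. \<beta> c s \<omega>)" for c
      using \<beta>_path by blast+
    show ?case
      by (intro continuous_on_vec_lambda continuous_on_diff C2.continuous_on_function_comp continuous_on_const
          continuous_on_indefinite_integral y \<beta>)
  qed
  show ?thesis
    unfolding is_ito_integral_def
    by (intro conjI exI[of _ "\<lambda>n. grid_size n"] exI[of _ \<tau>] exI[of _ \<xi>] allI impI
        J_prog square_integrable N_paths simple square_conv integral_conv)
qed

end

section \<open>The deviation from the slow manifold\<close>

lemma C2_function_frechet_derivative:
  fixes \<psi> :: "'a::euclidean_space \<Rightarrow> real"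
  assumes "C_k_on 2 \<psi> UNIV"
  shows "C2_function \<psi> (\<lambda>v. frechet_derivative \<psi> (at v))
    (\<lambda>v a. frechet_derivative (\<lambda>u. frechet_derivative \<psi> (at u) a) (at v))"
proof
  have \<psi>: "C_k_on (Suc (Suc 0)) \<psi> UNIV" using assms by (simp only: numeral_2_eq_2)
  have \<psi>': "C_k_on (Suc 0) (\<lambda>u. frechet_derivative \<psi> (at u) a) UNIV" for a
    using \<psi> by (simp only: C_k_on.simps(2)[of "Suc 0"])
  show "(\<psi> has_derivative frechet_derivative \<psi> (at v)) (at v)" for v
    by (rule C_k_on_SucD[OF \<psi>]) simp
  show "((\<lambda>u. frechet_derivative \<psi> (at u) a) has_derivative
      frechet_derivative (\<lambda>u. frechet_derivative \<psi> (at u) a) (at v)) (at v)" for v a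
    by (rule C_k_on_SucD[OF \<psi>']) simp
  show "continuous_on UNIV (\<lambda>v. frechet_derivative (\<lambda>u. frechet_derivative \<psi> (at u) a) (at v) c)" for a c
    using \<psi>'[of a] by simp
qed

lemma linear_axis_expansion:
  fixes L :: "real^'m::finite \<Rightarrow> real"
  assumes "linear L"
  shows "L a = (\<Sum>j\<in>UNIV. a $ j * L (axis j 1))"
proof -
  have "L a = L (\<Sum>j\<in>UNIV. a $ j *\<^sub>R axis j 1)"
    using basis_expansion[of a] by (simp add: scalar_mult_eq_scaleR)
  also have "\<dots> = (\<Sum>j\<in>UNIV. a $ j * L (axis j 1))"
    by (simp add: linear_sum[OF assms] linear_scale[OF assms])
  finally show ?thesis .
qed

lemma set_integral_component:
  fixes G :: "real \<Rightarrow> real^'n::finite"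
  assumes "set_integrable lborel A G"
  shows "(LINT u:A|lborel. G u) $ c = (LINT u:A|lborel. G u $ c)"
proof -
  have "bounded_linear (\<lambda>v :: real^'n. v $ c)" by (rule bounded_linear_vec_nth)
  from integral_bounded_linear[OF this assms[unfolded set_integrable_def]]
  show ?thesis unfolding set_lebesgue_integral_def by simp
qed

lemma matrix_product_column:
  "(A :: real^'m::finite^'n::finite) *v ((r *\<^sub>R B) *v axis l 1) = (\<chi> c. r * (A ** B) $ c $ l)"
proof -
  have "(r *\<^sub>R B) *v axis l 1 = (\<chi> j. r * B $ j $ l)"
    unfolding matrix_vector_mult_basis column_def by simp
  then show ?thesis
    by (simp add: matrix_vector_mult_def matrix_matrix_mult_def sum_distrib_left ac_simps)
qed

text \<open>The Ito formula is applied to compactly supported extensions \<open>\<psi>\<close> of the components of \<open>- X\<close>,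
  which on \<open>K\<close> have the same derivatives, so that \<open>z = x + \<psi>(y)\<close> whenever \<open>y\<close> is in \<open>K\<close>.\<close>

theorem lemma4p5:
  fixes M :: "'w measure" and F :: "real \<Rightarrow> 'w measure"
    and W :: "real \<Rightarrow> 'w \<Rightarrow> real^'d::finite"
    and f :: "(real^'n::finite) \<times> (real^'m::finite) \<Rightarrow> real^'n"
    and g :: "(real^'n) \<times> (real^'m) \<Rightarrow> real^'m"
    and h :: "real^'m \<Rightarrow> real^'d^'m"
    and \<epsilon> \<sigma> :: real
    and K :: "(real^'m) set"
    and Xs :: "real^'m \<Rightarrow> real^'n"
    and x z :: "real \<Rightarrow> 'w \<Rightarrow> real^'n" and y :: "real \<Rightarrow> 'w \<Rightarrow> real^'m"
  assumes W: "brownian_motion M F W"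
    and "\<epsilon> > 0" and "\<sigma> > 0"
    and f: "C_k_on 4 f UNIV" and g: "C_k_on 2 g UNIV" and h: "C_k_on 2 h UNIV"
    and sol: "slow_fast_solution M F W f g h \<epsilon> \<sigma> x y"
    and K: "compact K" and Xs: "C_k_on_compact 3 Xs K"
    and equilibrium: "\<forall>v\<in>K. f (Xs v, v) = 0"
    and z: "\<forall>t \<omega>. z t \<omega> = x t \<omega> - Xs (y t \<omega>)"
  shows "let drift_z = (\<lambda>\<zeta> v. f (Xs v + \<zeta>, v)
                 - \<epsilon> *\<^sub>R (jacobian Xs (at v) *v g (Xs v + \<zeta>, v))
                 - (\<sigma>\<^sup>2 / 2) *\<^sub>R D2_contract Xs v (h v));
             \<Sigma>_z = (\<lambda>(\<zeta> :: real^'n) v. - (\<sigma> *\<^sub>R (jacobian Xs (at v) ** h v)))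
         in has_ito_differential_on M F W (\<lambda>\<omega>. {t. y t \<omega> \<in> K}) z
              (\<lambda>t \<omega>. drift_z (z t \<omega>) (y t \<omega>))
              (\<lambda>t \<omega>. \<Sigma>_z (z t \<omega>) (y t \<omega>))
          \<and> (\<forall>v \<zeta> \<zeta>'. \<Sigma>_z \<zeta> v = \<Sigma>_z \<zeta>' v)"
proof -
  interpret brownian_setting M F W by unfold_locales (rule W)
  have cont_f: "continuous_on UNIV f" and cont_g: "continuous_on UNIV g" and cont_h: "continuous_on UNIV h"
    using f g h by (auto intro: C_k_on_imp_continuous_on simp del: C_k_on.simps)
  obtain U where U: "open U" "K \<subseteq> U" "C_k_on 3 Xs U"
    using Xs unfolding C_k_on_compact_def by blast
  define P where "P c \<psi> V C \<longleftrightarrow> C_k_on 2 \<psi> UNIV \<and> open V \<and> K \<subseteq> V \<and> V \<subseteq> U \<and> (\<forall>v\<in>V. \<psi> v = - (Xs v $ c)) \<and>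
    compact C \<and> (\<forall>v. v \<notin> C \<longrightarrow> \<psi> v = 0)" for c :: 'n and \<psi> and V C :: "(real^'m) set"
  have Xs_c: "C_k_on 2 (\<lambda>v. - (Xs v $ c)) U" for c
  proof -
    have "bounded_linear (\<lambda>w :: real^'n. - (w $ c))"
      by (intro bounded_linear_minus bounded_linear_vec_nth)
    from C_k_on_bounded_linear_comp[OF U(1) this U(3)] show ?thesis
      by (rule C_k_on_le[rotated]) simp
  qed
  have "\<exists>\<psi> V C. P c \<psi> V C" for c
    by (rule C_k_on_compact_extension[OF K U(1,2) Xs_c[of c]]) (unfold P_def, blast)
  then obtain \<psi> V C where PP: "\<And>c. P c (\<psi> c) (V c) (C c)" by metis
  have \<psi>_C2: "C_k_on 2 (\<psi> c) UNIV" and V: "open (V c)" "K \<subseteq> V c" "V c \<subseteq> U"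
    and \<psi>_V: "\<And>v. v \<in> V c \<Longrightarrow> \<psi> c v = - (Xs v $ c)"
    and C: "compact (C c)" and \<psi>_C: "\<And>v. v \<notin> C c \<Longrightarrow> \<psi> c v = 0" for c
    using PP[of c] unfolding P_def by blast+
  define \<psi>1 where "\<psi>1 c v = frechet_derivative (\<psi> c) (at v)" for c v
  define \<psi>2 where "\<psi>2 c v a = frechet_derivative (\<lambda>u. frechet_derivative (\<psi> c) (at u) a) (at v)" for c v a
  have C2: "C2_function (\<psi> c) (\<psi>1 c) (\<psi>2 c)" for c
    unfolding \<psi>1_def[abs_def] \<psi>2_def[abs_def] by (rule C2_function_frechet_derivative[OF \<psi>_C2])
  interpret C2: C2_function "\<psi> c" "\<psi>1 c" "\<psi>2 c" for c by (rule C2)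
  from sol obtain B H N where x_prog: "prog_measurable F x" and x_cont: "continuous_paths M x"
    and y_prog: "prog_measurable F y" and y_cont: "continuous_paths M y"
    and x_eq: "AE \<omega> in M. \<forall>t\<ge>0. x t \<omega> = x 0 \<omega> + (LINT s:{0..t}|lborel. f (x s \<omega>, y s \<omega>))"
    and B_prog: "prog_measurable F B" and N_int: "is_ito_integral M F W H N"
    and agree: "\<forall>\<omega>\<in>space M. \<forall>t\<ge>0. t \<in> {0..} \<longrightarrow> B t \<omega> = \<epsilon> *\<^sub>R g (x t \<omega>, y t \<omega>) \<and> H t \<omega> = \<sigma> *\<^sub>R h (y t \<omega>)"
    and y_eq: "AE \<omega> in M. \<forall>s t. 0 \<le> s \<and> s \<le> t \<and> {s..t} \<subseteq> {0..} \<longrightarrow>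
           set_integrable lborel {s..t} (\<lambda>u. B u \<omega>) \<and>
           y t \<omega> - y s \<omega> = (LINT u:{s..t}|lborel. B u \<omega>) + (N t \<omega> - N s \<omega>)"
    unfolding slow_fast_solution_def has_ito_differential_on_def by blast
  have B_eq: "B t \<omega> = \<epsilon> *\<^sub>R g (x t \<omega>, y t \<omega>)" and H_eq: "H t \<omega> = \<sigma> *\<^sub>R h (y t \<omega>)"
    if "\<omega> \<in> space M" "0 \<le> t" for t \<omega>
    using agree that by auto
  have AE_paths: "AE \<omega> in M. \<omega> \<in> space M \<and> continuous_on {0..} (\<lambda>t. x t \<omega>) \<and> continuous_on {0..} (\<lambda>t. y t \<omega>)
      \<and> continuous_on {0..} (\<lambda>t. B t \<omega>) \<and> continuous_on {0..} (\<lambda>t. H t \<omega>)"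
    using x_cont[unfolded continuous_paths_def] y_cont[unfolded continuous_paths_def] AE_space
  proof eventually_elim
    case (elim \<omega>)
    have "continuous_on {0..} (\<lambda>t. \<epsilon> *\<^sub>R g (x t \<omega>, y t \<omega>))"
      by (intro continuous_intros continuous_on_compose2[OF cont_g] elim) auto
    then have "continuous_on {0..} (\<lambda>t. B t \<omega>)"
      by (rule continuous_on_eq) (use B_eq elim in auto)
    moreover have "continuous_on {0..} (\<lambda>t. \<sigma> *\<^sub>R h (y t \<omega>))"
      by (intro continuous_intros continuous_on_compose2[OF cont_h] elim) auto
    then have "continuous_on {0..} (\<lambda>t. H t \<omega>)"
      by (rule continuous_on_eq) (use H_eq elim in auto)
    ultimately show ?case using elim by blast
  qed
  interpret ito_process M F W y B N H
  proof unfold_locales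
    show "continuous_paths M B" "continuous_paths M H"
      unfolding continuous_paths_def using AE_paths by (auto elim: eventually_mono)
    show "AE \<omega> in M. \<forall>s t. 0 \<le> s \<and> s \<le> t \<longrightarrow>
      y t \<omega> - y s \<omega> = (LINT u:{s..t}|lborel. B u \<omega>) + (N t \<omega> - N s \<omega>)"
      using y_eq by (rule eventually_mono) auto
  qed (rule y_prog y_cont B_prog N_int)+
  define J where "J t \<omega> = (\<chi> c l. \<psi>1 c (y t \<omega>) (H t \<omega> *v axis l 1))" for t \<omega>
  define \<beta> where "\<beta> c u \<omega> = \<psi>1 c (y u \<omega>) (B u \<omega>) + (\<Sum>l\<in>UNIV. \<psi>2 c (y u \<omega>) (H u \<omega> *v axis l 1) (H u \<omega> *v axis l 1)) / 2"
    for c u \<omega>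
  define Nz where "Nz t \<omega> = (\<chi> c. \<psi> c (y t \<omega>) - \<psi> c (y 0 \<omega>) - (LINT u:{0..t}|lborel. \<beta> c u \<omega>))" for t \<omega>
  \<comment> \<open>the diffusion coefficient is bounded since \<open>\<psi>\<close> has compact support\<close>
  have J_bounded: "bounded (J t ` space M)" if "0 \<le> t" for t
  proof -
    define j where "j v = (\<chi> c l. \<psi>1 c v ((\<sigma> *\<^sub>R h v) *v axis l 1))" for v
    have "continuous_on UNIV j"
      unfolding j_def by (intro continuous_on_vec_lambda C2.continuous_on_deriv1_comp continuous_intros cont_h)
    then have "compact (j ` (\<Union>c\<in>UNIV. C c))"
      using C by (intro compact_continuous_image compact_UN) (auto intro: continuous_on_subset)
    then have bounded: "bounded (insert 0 (j ` (\<Union>c\<in>UNIV. C c)))"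
      by (simp add: compact_imp_bounded)
    have j_in: "j v \<in> insert 0 (j ` (\<Union>c\<in>UNIV. C c))" for v
    proof (cases "v \<in> (\<Union>c\<in>UNIV. C c)")
      case False
      have "\<psi>1 c v = (\<lambda>a. 0)" for c
      proof -
        have "((\<lambda>u. 0) has_derivative (\<lambda>a. 0)) (at v)" by simp
        then have "(\<psi> c has_derivative (\<lambda>a. 0)) (at v)"
          by (rule has_derivative_transform_within_open[of _ _ _ _ "- C c"])
            (use False C[of c] \<psi>_C in \<open>auto simp: compact_imp_closed open_Compl\<close>)
        from has_derivative_unique[OF C2.deriv1 this] show ?thesis .
      qed
      then show ?thesis by (simp add: j_def vec_eq_iff)
    qed simp
    have "J t \<omega> = j (y t \<omega>)" if "\<omega> \<in> space M" for \<omega>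
      unfolding J_def j_def H_eq[OF that \<open>0 \<le> t\<close>] ..
    then have "J t ` space M \<subseteq> insert 0 (j ` (\<Union>c\<in>UNIV. C c))"
      using j_in by (intro image_subsetI) simp
    with bounded show ?thesis by (rule bounded_subset)
  qed
  have Nz_int: "is_ito_integral M F W J Nz"
    unfolding J_def[abs_def] Nz_def[abs_def] \<beta>_def
    by (rule ito_formula[OF C2]) (use J_bounded in \<open>simp add: J_def[abs_def]\<close>)
  define Bz where "Bz t \<omega> = f (x t \<omega>, y t \<omega>) + (\<chi> c. \<beta> c t \<omega>)" for t \<omega>
  have Bz_prog: "prog_measurable F Bz"
    unfolding prog_measurable_def
  proof (intro allI impI)
    fix T :: real assume T: "0 \<le> T"
    note m = prog_measurableD[OF x_prog T] prog_measurableD[OF y_prog T] prog_measurableD[OF B_prog T]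
      prog_measurableD[OF H_prog T]
    have "(\<lambda>p. f (x (fst p) (snd p), y (fst p) (snd p))) \<in> borel_measurable (restrict_space borel {0..T} \<Otimes>\<^sub>M F T)"
      using m unfolding case_prod_beta by (intro borel_measurable_continuous_on[OF cont_f] borel_measurable_Pair)
    moreover have "(\<lambda>p. \<beta> c (fst p) (snd p)) \<in> borel_measurable (restrict_space borel {0..T} \<Otimes>\<^sub>M F T)" for c
      unfolding \<beta>_def using m unfolding case_prod_beta
      by (intro borel_measurable_add borel_measurable_divide borel_measurable_sum borel_measurable_const
          C2.measurable_deriv1_comp C2.measurable_deriv2_comp measurable_matrix_vector_mult)
    ultimately show "(\<lambda>(t, \<omega>). Bz t \<omega>) \<in> borel_measurable (restrict_space borel {0..T} \<Otimes>\<^sub>M F T)"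
      unfolding Bz_def case_prod_beta by (intro borel_measurable_add borel_measurable_vec_lambda)
  qed
  \<comment> \<open>on \<open>K\<close> the derivatives of \<open>\<psi>\<close> are those of \<open>- X\<close>\<close>
  have Xs_diff: "Xs differentiable (at v)" if "v \<in> U" for v
    using U(3) that by (simp add: eval_nat_numeral)
  have \<psi>1_eq: "\<psi>1 c v a = - (jacobian Xs (at v) *v a) $ c" if "v \<in> V c" for c v a
  proof -
    have "(Xs has_derivative (\<lambda>a. jacobian Xs (at v) *v a)) (at v)"
      using Xs_diff[of v] that V(3) jacobian_works by blast
    then have "((\<lambda>u. - (Xs u $ c)) has_derivative (\<lambda>a. - (jacobian Xs (at v) *v a) $ c)) (at v)"
      by (intro has_derivative_minus bounded_linear.has_derivative[OF bounded_linear_vec_nth])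
    then have "(\<psi> c has_derivative (\<lambda>a. - (jacobian Xs (at v) *v a) $ c)) (at v)"
      by (rule has_derivative_transform_within_open[OF _ V(1)[of c] that]) (simp add: \<psi>_V)
    from has_derivative_unique[OF C2.deriv1 this] show ?thesis by simp
  qed
  have partial_eq: "partial_deriv k (\<lambda>w. Xs w $ c) v = - \<psi>1 c v (axis k 1)" if "v \<in> V c" for c k v
  proof -
    have "(\<psi> c has_derivative \<psi>1 c v) (at v)" by (rule C2.deriv1)
    then have "((\<lambda>u. - \<psi> c u) has_derivative (\<lambda>a. - \<psi>1 c v a)) (at v)" by (rule has_derivative_minus)
    then have "((\<lambda>w. Xs w $ c) has_derivative (\<lambda>a. - \<psi>1 c v a)) (at v)"
      by (rule has_derivative_transform_within_open[OF _ V(1)[of c] that]) (simp add: \<psi>_V)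
    from frechet_derivative_at[OF this] show ?thesis unfolding partial_deriv_def by (metis)
  qed
  have partial2_eq: "partial_deriv j (partial_deriv k (\<lambda>w. Xs w $ c)) v = - \<psi>2 c v (axis k 1) (axis j 1)"
    if "v \<in> V c" for c j k v
  proof -
    have "((\<lambda>u. - \<psi>1 c u (axis k 1)) has_derivative (\<lambda>a. - \<psi>2 c v (axis k 1) a)) (at v)"
      by (intro has_derivative_minus C2.deriv2)
    then have "(partial_deriv k (\<lambda>w. Xs w $ c) has_derivative (\<lambda>a. - \<psi>2 c v (axis k 1) a)) (at v)"
      by (rule has_derivative_transform_within_open[OF _ V(1)[of c] that]) (simp add: partial_eq)
    from frechet_derivative_at[OF this] show ?thesis unfolding partial_deriv_def[of j] by metis
  qed
  have trace_eq: "(\<Sum>l\<in>UNIV. \<psi>2 c v ((\<sigma> *\<^sub>R h v) *v axis l 1) ((\<sigma> *\<^sub>R h v) *v axis l 1))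
      = - \<sigma>\<^sup>2 * D2_contract Xs v (h v) $ c" if "v \<in> V c" for c v
  proof -
    have comp: "((\<sigma> *\<^sub>R h v) *v axis l 1) $ j = \<sigma> * h v $ j $ l" for l j
      by (simp add: matrix_vector_mult_basis column_def)
    have "\<psi>2 c v a a = (\<Sum>k\<in>UNIV. \<Sum>j\<in>UNIV. a $ k * (a $ j * \<psi>2 c v (axis k 1) (axis j 1)))" for a
      by (subst linear_axis_expansion[OF C2.linear_deriv2_left], subst linear_axis_expansion[OF C2.linear_deriv2_right])
        (simp only: sum_distrib_left)
    then have "(\<Sum>l\<in>UNIV. \<psi>2 c v ((\<sigma> *\<^sub>R h v) *v axis l 1) ((\<sigma> *\<^sub>R h v) *v axis l 1))
      = (\<Sum>l\<in>UNIV. \<Sum>k\<in>UNIV. \<Sum>j\<in>UNIV. - \<sigma>\<^sup>2 * (partial_deriv j (partial_deriv k (\<lambda>w. Xs w $ c)) v * h v $ j $ l * h v $ k $ l))"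
      by (simp add: comp partial2_eq[OF that] power2_eq_square ac_simps)
    also have "\<dots> = (\<Sum>l\<in>UNIV. \<Sum>j\<in>UNIV. \<Sum>k\<in>UNIV. - \<sigma>\<^sup>2 * (partial_deriv j (partial_deriv k (\<lambda>w. Xs w $ c)) v * h v $ j $ l * h v $ k $ l))"
      by (intro sum.cong refl sum.swap)
    also have "\<dots> = (\<Sum>j\<in>UNIV. \<Sum>l\<in>UNIV. \<Sum>k\<in>UNIV. - \<sigma>\<^sup>2 * (partial_deriv j (partial_deriv k (\<lambda>w. Xs w $ c)) v * h v $ j $ l * h v $ k $ l))"
      by (rule sum.swap)
    also have "\<dots> = (\<Sum>j\<in>UNIV. \<Sum>k\<in>UNIV. \<Sum>l\<in>UNIV. - \<sigma>\<^sup>2 * (partial_deriv j (partial_deriv k (\<lambda>w. Xs w $ c)) v * h v $ j $ l * h v $ k $ l))"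
      by (intro sum.cong refl sum.swap)
    also have "\<dots> = - \<sigma>\<^sup>2 * D2_contract Xs v (h v) $ c"
      by (simp only: D2_contract_def vec_lambda_beta sum_distrib_left)
    finally show ?thesis .
  qed
  have Bz_eq: "Bz t \<omega> = f (Xs (y t \<omega>) + z t \<omega>, y t \<omega>)
      - \<epsilon> *\<^sub>R (jacobian Xs (at (y t \<omega>)) *v g (Xs (y t \<omega>) + z t \<omega>, y t \<omega>))
      - (\<sigma>\<^sup>2 / 2) *\<^sub>R D2_contract Xs (y t \<omega>) (h (y t \<omega>))"
    and J_eq: "J t \<omega> = - (\<sigma> *\<^sub>R (jacobian Xs (at (y t \<omega>)) ** h (y t \<omega>)))"
    if "\<omega> \<in> space M" "0 \<le> t" "y t \<omega> \<in> K" for t \<omega>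
  proof -
    have yV: "y t \<omega> \<in> V c" for c using that(3) V(2) by blast
    have x: "Xs (y t \<omega>) + z t \<omega> = x t \<omega>" using z by simp
    show "Bz t \<omega> = f (Xs (y t \<omega>) + z t \<omega>, y t \<omega>)
      - \<epsilon> *\<^sub>R (jacobian Xs (at (y t \<omega>)) *v g (Xs (y t \<omega>) + z t \<omega>, y t \<omega>))
      - (\<sigma>\<^sup>2 / 2) *\<^sub>R D2_contract Xs (y t \<omega>) (h (y t \<omega>))"
      unfolding x vec_eq_iff Bz_def \<beta>_def B_eq[OF that(1,2)] H_eq[OF that(1,2)] trace_eq[OF yV] \<psi>1_eq[OF yV]
      by (simp add: matrix_vector_mult_scaleR)
    show "J t \<omega> = - (\<sigma> *\<^sub>R (jacobian Xs (at (y t \<omega>)) ** h (y t \<omega>)))"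
      unfolding J_def H_eq[OF that(1,2)] \<psi>1_eq[OF yV] matrix_product_column vec_eq_iff by simp
  qed
  have increment: "AE \<omega> in M. \<forall>s t. 0 \<le> s \<and> s \<le> t \<and> {s..t} \<subseteq> {t. y t \<omega> \<in> K} \<longrightarrow>
      set_integrable lborel {s..t} (\<lambda>u. Bz u \<omega>) \<and>
      z t \<omega> - z s \<omega> = (LINT u:{s..t}|lborel. Bz u \<omega>) + (Nz t \<omega> - Nz s \<omega>)"
    using AE_paths x_eq
  proof eventually_elim
    case (elim \<omega>)
    have paths: "continuous_on {0..} (\<lambda>t. x t \<omega>)" "continuous_on {0..} (\<lambda>t. y t \<omega>)"
      "continuous_on {0..} (\<lambda>t. B t \<omega>)" "continuous_on {0..} (\<lambda>t. H t \<omega>)" using elim by blast+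
    have f_path: "continuous_on {0..} (\<lambda>t. f (x t \<omega>, y t \<omega>))"
      by (intro continuous_on_compose2[OF cont_f] continuous_on_Pair paths) auto
    have \<beta>_path: "continuous_on {0..} (\<lambda>t. \<beta> c t \<omega>)" for c
      unfolding \<beta>_def by (intro continuous_intros C2.continuous_on_deriv1_comp C2.continuous_on_deriv2_comp paths) auto
    have \<beta>s_path: "continuous_on {0..} (\<lambda>t. \<chi> c. \<beta> c t \<omega>)"
      by (intro continuous_on_vec_lambda \<beta>_path)
    have int: "set_integrable lborel {a..e} G" if "continuous_on {0..} G" "0 \<le> a"
      for G :: "real \<Rightarrow> 'z::euclidean_space" and a e
      by (intro borel_integrable_atLeastAtMost' continuous_on_subset[OF that(1)]) (use that(2) in auto)
    show ?case
    proof (intro allI impI)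
      fix s t assume st: "0 \<le> s \<and> s \<le> t \<and> {s..t} \<subseteq> {t. y t \<omega> \<in> K}"
      then have s: "0 \<le> s" "s \<le> t" "0 \<le> t" and "y s \<omega> \<in> K" "y t \<omega> \<in> K" by auto
      then have yV: "y s \<omega> \<in> V c" "y t \<omega> \<in> V c" for c using V(2) by blast+
      have split: "(LINT u:{0..t}|lborel. G u) = (LINT u:{0..s}|lborel. G u) + (LINT u:{s..t}|lborel. G u)"
        if "continuous_on {0..} G" for G :: "real \<Rightarrow> 'z::euclidean_space"
        by (rule set_integral_combine[OF s(1,2) int[OF that order_refl]])
      have Bz_int: "set_integrable lborel {s..t} (\<lambda>u. Bz u \<omega>)"
        unfolding Bz_def by (intro set_integral_add int f_path \<beta>s_path s)
      have "(z t \<omega> - z s \<omega>) $ c = ((LINT u:{s..t}|lborel. Bz u \<omega>) + (Nz t \<omega> - Nz s \<omega>)) $ c" for c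
      proof -
        have zc: "z t \<omega> $ c = x t \<omega> $ c - Xs (y t \<omega>) $ c" "z s \<omega> $ c = x s \<omega> $ c - Xs (y s \<omega>) $ c"
          using z by simp_all
        have "x t \<omega> - x s \<omega> = (LINT u:{s..t}|lborel. f (x u \<omega>, y u \<omega>))"
        proof -
          have "x t \<omega> = x 0 \<omega> + (LINT u:{0..t}|lborel. f (x u \<omega>, y u \<omega>))"
            "x s \<omega> = x 0 \<omega> + (LINT u:{0..s}|lborel. f (x u \<omega>, y u \<omega>))"
            using elim(2) s by blast+
          then show ?thesis using split[OF f_path] by simp
        qed
        then have "x t \<omega> $ c - x s \<omega> $ c = (LINT u:{s..t}|lborel. f (x u \<omega>, y u \<omega>)) $ c"
          by (simp add: vec_eq_iff)
        moreover have "(LINT u:{s..t}|lborel. Bz u \<omega>)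
            = (LINT u:{s..t}|lborel. f (x u \<omega>, y u \<omega>)) + (LINT u:{s..t}|lborel. (\<chi> c. \<beta> c u \<omega>))"
          unfolding Bz_def by (intro set_integral_add(2) int f_path \<beta>s_path s)
        moreover have "(LINT u:{s..t}|lborel. (\<chi> c. \<beta> c u \<omega>)) $ c = (LINT u:{s..t}|lborel. \<beta> c u \<omega>)"
          using set_integral_component[OF int[OF \<beta>s_path s(1)], of t c] by simp
        ultimately show ?thesis
          using split[OF \<beta>_path[of c]] \<psi>_V[OF yV(1)[of c]] \<psi>_V[OF yV(2)[of c]]
          by (simp add: Nz_def zc)
      qed
      then show "set_integrable lborel {s..t} (\<lambda>u. Bz u \<omega>) \<and>
        z t \<omega> - z s \<omega> = (LINT u:{s..t}|lborel. Bz u \<omega>) + (Nz t \<omega> - Nz s \<omega>)"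
        using Bz_int by (simp add: vec_eq_iff)
    qed
  qed
  have adapted: "(\<lambda>\<omega>. if t \<in> {t. y t \<omega> \<in> K} then z t \<omega> else 0) \<in> borel_measurable (F t)" if "0 \<le> t" for t
  proof -
    have [measurable]: "x t \<in> borel_measurable (F t)" "y t \<in> borel_measurable (F t)"
      using prog_measurable_adapted x_prog y_prog that by blast+
    have [measurable]: "K \<in> sets borel" using K by (simp add: borel_closed compact_imp_closed)
    have "(\<lambda>\<omega>. \<chi> c. \<psi> c (y t \<omega>)) \<in> borel_measurable (F t)"
      by (intro borel_measurable_vec_lambda C2.measurable_function_comp) measurable
    then have "(\<lambda>\<omega>. if y t \<omega> \<in> K then x t \<omega> + (\<chi> c. \<psi> c (y t \<omega>)) else 0) \<in> borel_measurable (F t)"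
      by measurable
    also have "(\<lambda>\<omega>. if y t \<omega> \<in> K then x t \<omega> + (\<chi> c. \<psi> c (y t \<omega>)) else 0)
        = (\<lambda>\<omega>. if t \<in> {t. y t \<omega> \<in> K} then z t \<omega> else 0)"
    proof
      fix \<omega>
      show "(if y t \<omega> \<in> K then x t \<omega> + (\<chi> c. \<psi> c (y t \<omega>)) else 0) = (if t \<in> {t. y t \<omega> \<in> K} then z t \<omega> else 0)"
      proof (cases "y t \<omega> \<in> K")
        case True
        then have "\<psi> c (y t \<omega>) = - (Xs (y t \<omega>) $ c)" for c using V(2) by (intro \<psi>_V) blast
        then show ?thesis using z by (simp add: vec_eq_iff)
      qed simp
    qed
    finally show ?thesis .
  qed
  have "has_ito_differential_on M F W (\<lambda>\<omega>. {t. y t \<omega> \<in> K}) z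
     (\<lambda>t \<omega>. f (Xs (y t \<omega>) + z t \<omega>, y t \<omega>)
        - \<epsilon> *\<^sub>R (jacobian Xs (at (y t \<omega>)) *v g (Xs (y t \<omega>) + z t \<omega>, y t \<omega>))
        - (\<sigma>\<^sup>2 / 2) *\<^sub>R D2_contract Xs (y t \<omega>) (h (y t \<omega>)))
     (\<lambda>t \<omega>. - (\<sigma> *\<^sub>R (jacobian Xs (at (y t \<omega>)) ** h (y t \<omega>))))"
    unfolding has_ito_differential_on_def
  proof (rule conjI, use adapted in blast, rule exI[of _ Bz], rule exI[of _ J], rule exI[of _ Nz],
      intro conjI Bz_prog Nz_int)
    show "\<forall>\<omega>\<in>space M. \<forall>t\<ge>0. t \<in> {t. y t \<omega> \<in> K} \<longrightarrow>
       Bz t \<omega> = f (Xs (y t \<omega>) + z t \<omega>, y t \<omega>)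
        - \<epsilon> *\<^sub>R (jacobian Xs (at (y t \<omega>)) *v g (Xs (y t \<omega>) + z t \<omega>, y t \<omega>))
        - (\<sigma>\<^sup>2 / 2) *\<^sub>R D2_contract Xs (y t \<omega>) (h (y t \<omega>)) \<and>
       J t \<omega> = - (\<sigma> *\<^sub>R (jacobian Xs (at (y t \<omega>)) ** h (y t \<omega>)))"
      using Bz_eq J_eq by simp
  qed (rule increment)
  then show ?thesis by (simp add: Let_def)
qed

end
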